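(* Let $n\ge2$ and let $\varphi:\mathbb C^n\to\mathbb R$ be a decoupled weight $\varphi(z_1,\dots,z_n)=\sum_{j=1}^n\varphi_j(z_j)$ with each $\varphi_j:\mathbb C\to\mathbb R$ of class $C^\infty$. Suppose that there exist $j\in\{1,\dots,n\}$ and $r_j>0$ such that $\varphi_j$ satisfies condition $(H_{r_j})$. Then $\square^{(0,1)}_\varphi$ has a non-compact resolvent.
   Context: Condition $(H_r)$ ($r$ an integer) for a smooth $\psi:\mathbb C\cong\mathbb R^2\to\mathbb R$: put $B=\Delta\psi$ (the magnetic field of the magnetic potential $(-\partial_y\psi,\partial_x\psi)$), and, for $q\ge1$, $m_q(x)=\sum_{|\alpha|=q-1}|\partial_x^\alpha B(x)|$ (with $m_0=0$), and $m^r(x)=1+\sum_{q=0}^r m_q(x)$. Then $\psi$ satisfies $(H_r)$ if there exist a sequence $(B_i)_{i\ge1}$ of pairwise disjoint balls in $\mathbb R^2$ of radius $\ge1$ and a constant $C$ such that $m_{r+1}(x)\le C\,m^r(x)$ for all $x\in\bigcup_i B_i$. The complex Witten Laplacian: for $v\in L^2(\mathbb C^n)$ let $\overline D_1v=\sum_{k=1}^n\left(\frac{\partial v}{\partial\overline z_k}+\frac{\partial\varphi}{\partial\overline z_k}v\right)d\overline z_k$, and for a $(0,1)$-form $g=\sum_j g_j\,d\overline z_j$ let $\overline D_2g=\sum_{j,k=1}^n\left(\frac{\partial g_j}{\partial\overline z_k}+\frac{\partial\varphi}{\partial\overline z_k}g_j\right)d\overline z_k\wedge d\overline z_j$. Adjoints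 are taken in the unweighted $L^2$ spaces of $(0,q)$-forms on $\mathbb C^n$, in which the $d\overline z_J$, $J$ increasing, are orthonormal at each point. Then $\square^{(0,0)}_\varphi=\overline D_1^*\overline D_1$ and $\square^{(0,1)}_\varphi=\overline D_1\overline D_1^*+\overline D_2^*\overline D_2=\square^{(0,0)}_\varphi\otimes I+2M_\varphi$, where $M_\varphi=\left(\frac{\partial^2\varphi}{\partial z_j\partial\overline z_k}\right)_{j,k}$. The symbol $\square^{(0,1)}_\varphi$ also denotes its self-adjoint realization on $L^2_{(0,1)}(\mathbb C^n)$ (the space of $(0,1)$-forms with $L^2(\mathbb C^n)$ coefficients), i.e. the closure from forms with $C_0^\infty$ coefficients. *)

theory Defs
  imports "HOL-Analysis.Analysis"
begin

section \<open>Smooth functions and partial derivatives\<close>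

text \<open>In finite dimension, being differentiable with all directional derivatives of class
  \<open>C^k\<close> amounts to being of class \<open>C^(k+1)\<close>.\<close>

primrec Ck :: "nat \<Rightarrow> ('a::euclidean_space \<Rightarrow> 'b::euclidean_space) \<Rightarrow> bool" where
  "Ck 0 f \<longleftrightarrow> continuous_on UNIV f"
| "Ck (Suc k) f \<longleftrightarrow>
     (\<forall>x. f differentiable (at x)) \<and> (\<forall>v. Ck k (\<lambda>x. frechet_derivative f (at x) v))"

definition smooth :: "('a::euclidean_space \<Rightarrow> 'b::euclidean_space) \<Rightarrow> bool" where
  "smooth f \<longleftrightarrow> (\<forall>k. Ck k f)"

definition test_functions :: "('a::euclidean_space \<Rightarrow> 'b::euclidean_space) set" where
  "test_functions = {f. smooth f \<and> compact (closure {x. f x \<noteq> 0})}"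

definition dir_deriv :: "'a::euclidean_space \<Rightarrow> ('a \<Rightarrow> 'b::euclidean_space) \<Rightarrow> 'a \<Rightarrow> 'b" where
  "dir_deriv v f = (\<lambda>x. frechet_derivative f (at x) v)"

definition dzbar :: "'n::finite \<Rightarrow> (complex^'n \<Rightarrow> complex) \<Rightarrow> complex^'n \<Rightarrow> complex" where
  "dzbar k f = (\<lambda>z. (dir_deriv (axis k 1) f z + \<i> * dir_deriv (axis k \<i>) f z) / 2)"

section \<open>Condition \<open>(H\<^sub>r)\<close>\<close>

text \<open>The plane \<open>\<real>\<^sup>2\<close> is the type \<^typ>\<open>complex\<close>; its coordinate directions are \<open>1\<close> and \<open>\<i>\<close>.\<close>

definition magnetic_field :: "(complex \<Rightarrow> real) \<Rightarrow> complex \<Rightarrow> real" where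
  "magnetic_field \<psi> = (\<lambda>z. (dir_deriv 1 ^^ 2) \<psi> z + (dir_deriv \<i> ^^ 2) \<psi> z)"

definition m_sub :: "(complex \<Rightarrow> real) \<Rightarrow> nat \<Rightarrow> complex \<Rightarrow> real" where
  "m_sub \<psi> q z =
     (if q = 0 then 0
      else \<Sum>(a, b)\<in>{(a, b). a + b = q - 1}.
             \<bar>((dir_deriv 1 ^^ a) ((dir_deriv \<i> ^^ b) (magnetic_field \<psi>))) z\<bar>)"

definition m_sup :: "(complex \<Rightarrow> real) \<Rightarrow> nat \<Rightarrow> complex \<Rightarrow> real" where
  "m_sup \<psi> r z = 1 + (\<Sum>q=0..r. m_sub \<psi> q z)"

definition cond_H :: "nat \<Rightarrow> (complex \<Rightarrow> real) \<Rightarrow> bool" where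
  "cond_H r \<psi> \<longleftrightarrow>
     (\<exists>(c :: nat \<Rightarrow> complex) (\<rho> :: nat \<Rightarrow> real) (C :: real).
        (\<forall>i. \<rho> i \<ge> 1) \<and>
        (\<forall>i j. i \<noteq> j \<longrightarrow> ball (c i) (\<rho> i) \<inter> ball (c j) (\<rho> j) = {}) \<and>
        (\<forall>z \<in> (\<Union>i. ball (c i) (\<rho> i)). m_sub \<psi> (r + 1) z \<le> C * m_sup \<psi> r z))"

section \<open>Unbounded operators on \<open>L\<^sup>2\<close>\<close>

text \<open>Elements of \<open>L\<^sup>2\<close> are represented by Borel functions, with equality almost everywhere.
  An unbounded operator is represented by its graph, a set of pairs \<open>(u, f)\<close>, where \<open>f\<close> is a
  value of the operator at \<open>u\<close>.\<close>

definition L2_space :: "('a::euclidean_space \<Rightarrow> 'b::euclidean_space) set" where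
  "L2_space = {u \<in> borel_measurable lborel. integrable lborel (\<lambda>x. (norm (u x))\<^sup>2)}"

definition L2_dist :: "('a::euclidean_space \<Rightarrow> 'b::euclidean_space) \<Rightarrow> ('a \<Rightarrow> 'b) \<Rightarrow> real" where
  "L2_dist u v = sqrt (LINT x|lborel. (norm (u x - v x))\<^sup>2)"

definition L2_norm :: "('a::euclidean_space \<Rightarrow> 'b::euclidean_space) \<Rightarrow> real" where
  "L2_norm u = sqrt (LINT x|lborel. (norm (u x))\<^sup>2)"

definition L2_graph_closure ::
  "(('a::euclidean_space \<Rightarrow> 'b::euclidean_space) \<times> ('a \<Rightarrow> 'b)) set \<Rightarrow> (('a \<Rightarrow> 'b) \<times> ('a \<Rightarrow> 'b)) set"
where
  "L2_graph_closure T =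
     {(u, f). u \<in> L2_space \<and> f \<in> L2_space \<and>
        (\<exists>U F. (\<forall>k::nat. (U k, F k) \<in> T) \<and>
           (\<lambda>k. L2_dist (U k) u) \<longlonglongrightarrow> 0 \<and> (\<lambda>k. L2_dist (F k) f) \<longlonglongrightarrow> 0)}"

text \<open>The following definitions concern operators on \<open>L\<^sup>2\<close> with values in \<open>\<complex>\<^sup>n\<close>; the complex
  scalar multiplication there is \<open>*s\<close>.\<close>

definition resolvent_set ::
  "(('a::euclidean_space \<Rightarrow> complex^'n) \<times> ('a \<Rightarrow> complex^'n)) set \<Rightarrow> complex set"
where
  "resolvent_set T =
     {\<mu>. (\<exists>C::real. \<forall>(u, f)\<in>T. L2_norm u \<le> C * L2_norm (\<lambda>x. f x - \<mu> *s u x)) \<and>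
         (\<forall>g\<in>L2_space. \<exists>(u, f)\<in>T. AE x in lborel. f x - \<mu> *s u x = g x)}"

definition resolvent ::
  "(('a::euclidean_space \<Rightarrow> complex^'n) \<times> ('a \<Rightarrow> complex^'n)) set \<Rightarrow> complex \<Rightarrow>
     (('a \<Rightarrow> complex^'n) \<times> ('a \<Rightarrow> complex^'n)) set"
where
  "resolvent T \<mu> =
     {(g, u). g \<in> L2_space \<and> (\<exists>f. (u, f) \<in> T \<and> (AE x in lborel. f x - \<mu> *s u x = g x))}"

definition compact_operator ::
  "(('a::euclidean_space \<Rightarrow> complex^'n) \<times> ('a \<Rightarrow> complex^'n)) set \<Rightarrow> bool"
where
  "compact_operator R \<longleftrightarrow>
     (\<forall>(g :: nat \<Rightarrow> _) u.
        (\<forall>k. (g k, u k) \<in> R) \<and> (\<exists>M. \<forall>k. L2_norm (g k) \<le> M) \<longrightarrow>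
        (\<exists>s. strict_mono (s :: nat \<Rightarrow> nat) \<and>
           (\<exists>v\<in>L2_space. (\<lambda>k. L2_dist (u (s k)) v) \<longlonglongrightarrow> 0)))"

text \<open>By the resolvent identity, one resolvent is compact iff all of them are.\<close>

definition has_compact_resolvent ::
  "(('a::euclidean_space \<Rightarrow> complex^'n) \<times> ('a \<Rightarrow> complex^'n)) set \<Rightarrow> bool"
where
  "has_compact_resolvent T \<longleftrightarrow> (\<exists>\<mu>\<in>resolvent_set T. compact_operator (resolvent T \<mu>))"

section \<open>The complex Witten Laplacian on \<open>(0,1)\<close>-forms\<close>

text \<open>A \<open>(0,1)\<close>-form \<open>\<Sum>\<^sub>j g\<^sub>j dzbar\<^sub>j\<close> is the function \<open>g\<close> into \<^typ>\<open>complex^'n\<close>. A \<open>(0,2)\<close>-form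
  \<open>\<Sum>\<^sub>k\<^sub><\<^sub>j h\<^sub>k\<^sub>j dzbar\<^sub>k \<and> dzbar\<^sub>j\<close> is a function into \<^typ>\<open>complex^'n^'n\<close> whose components \<open>h $ k $ j\<close>
  vanish unless \<open>k < j\<close>. The linear order on the index type serves only to single out the
  increasing multi-indices.\<close>

type_synonym 'n form00 = "(complex, 'n) vec \<Rightarrow> complex"
type_synonym 'n form01 = "(complex, 'n) vec \<Rightarrow> (complex, 'n) vec"
type_synonym 'n form02 = "(complex, 'n) vec \<Rightarrow> ((complex, 'n) vec, 'n) vec"
type_synonym 'n weight = "(complex, 'n) vec \<Rightarrow> real"

definition wdbar :: "('n::finite) weight \<Rightarrow> 'n \<Rightarrow> 'n form00 \<Rightarrow> 'n form00" where
  "wdbar \<phi> k f = (\<lambda>z. dzbar k f z + dzbar k (\<lambda>w. complex_of_real (\<phi> w)) z * f z)"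

definition D1 :: "('n::finite) weight \<Rightarrow> 'n form00 \<Rightarrow> 'n form01" where
  "D1 \<phi> v = (\<lambda>z. \<chi> k. wdbar \<phi> k v z)"

text \<open>Collecting the terms of \<open>\<Sum>\<^sub>j\<^sub>,\<^sub>k (\<dots>) dzbar\<^sub>k \<and> dzbar\<^sub>j\<close> over increasing multi-indices uses
  \<open>dzbar\<^sub>j \<and> dzbar\<^sub>k = - dzbar\<^sub>k \<and> dzbar\<^sub>j\<close>.\<close>

definition D2 :: "('n::{finite,linorder}) weight \<Rightarrow> 'n form01 \<Rightarrow> 'n form02" where
  "D2 \<phi> g = (\<lambda>z. \<chi> k j. if k < j
       then wdbar \<phi> k (\<lambda>w. g w $ j) z - wdbar \<phi> j (\<lambda>w. g w $ k) z else 0)"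

definition inner00 :: "('n::finite) form00 \<Rightarrow> 'n form00 \<Rightarrow> complex" where
  "inner00 u v = (LINT z|lborel. u z * cnj (v z))"

definition inner01 :: "('n::finite) form01 \<Rightarrow> 'n form01 \<Rightarrow> complex" where
  "inner01 u v = (LINT z|lborel. (\<Sum>j\<in>UNIV. u z $ j * cnj (v z $ j)))"

definition inner02 :: "('n::finite) form02 \<Rightarrow> 'n form02 \<Rightarrow> complex" where
  "inner02 u v = (LINT z|lborel. (\<Sum>k\<in>UNIV. \<Sum>j\<in>UNIV. u z $ k $ j * cnj (v z $ k $ j)))"

text \<open>The adjoints of \<^const>\<open>D1\<close> and \<^const>\<open>D2\<close> on compactly supported smooth forms, as graphs:
  \<open>(u, h)\<close> belongs to the graph iff \<open>\<langle>D w, u\<rangle> = \<langle>w, h\<rangle>\<close> for all test forms \<open>w\<close>. For smooth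
  \<open>\<phi>\<close> such an \<open>h\<close> exists and is unique (integration by parts and density of test forms).\<close>

definition D1_adjoint :: "('n::finite) weight \<Rightarrow> ('n form01 \<times> 'n form00) set" where
  "D1_adjoint \<phi> = {(u, h). u \<in> test_functions \<and> h \<in> test_functions \<and>
     (\<forall>w\<in>test_functions. inner01 (D1 \<phi> w) u = inner00 w h)}"

definition D2_adjoint :: "('n::{finite,linorder}) weight \<Rightarrow> ('n form02 \<times> 'n form01) set" where
  "D2_adjoint \<phi> = {(u, h). u \<in> test_functions \<and> h \<in> test_functions \<and>
     (\<forall>w\<in>test_functions. inner02 (D2 \<phi> w) u = inner01 w h)}"

definition box01_test :: "('n::{finite,linorder}) weight \<Rightarrow> ('n form01 \<times> 'n form01) set" where
  "box01_test \<phi> = {(u, \<lambda>z. D1 \<phi> h z + k z) | u h k.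
     (u, h) \<in> D1_adjoint \<phi> \<and> (D2 \<phi> u, k) \<in> D2_adjoint \<phi>}"

definition box01 :: "('n::{finite,linorder}) weight \<Rightarrow> ('n form01 \<times> 'n form01) set" where
  "box01 \<phi> = L2_graph_closure (box01_test \<phi>)"

end

theory Submission
  imports Defs
begin

text \<open>
  For a decoupled weight the complex Witten Laplacian acts on the coefficient \<open>u\<^sub>k\<close> of a
  \<open>(0,1)\<close>-form as \<open>\<Sum>\<^sub>j\<^sub>\<noteq>\<^sub>k D\<^sub>j\<^sup>* D\<^sub>j + D\<^sub>k D\<^sub>k\<^sup>*\<close>, where \<open>D\<^sub>j = \<partial>/\<partial>zbar\<^sub>j + \<partial>\<phi>\<^sub>j/\<partial>zbar\<^sub>j\<close> involves the variable
  \<open>z\<^sub>j\<close> alone. The idea is to find infinitely many orthonormal forms of bounded energy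
  \<open>\<parallel>D\<^sub>1\<^sup>* u\<parallel>\<^sup>2 + \<parallel>D\<^sub>2 u\<parallel>\<^sup>2\<close>; this excludes a compact resolvent (\<open>noncompact_resolvent_criterion\<close>,
  whose hypothesis on the closed operator is \<open>box01_cauchy_schwarz\<close>).

  The forms are products. In the variable \<open>z\<^sub>j\<close> for which \<open>\<phi>\<^sub>j\<close> satisfies the condition, the factor
  is localized in one of the disjoint balls; in the other variables it is a fixed bump. The
  component \<open>k\<close> may be chosen freely: for \<open>k \<noteq> j\<close>, which exists as \<open>n \<ge> 2\<close>, the energy contains
  \<open>D\<^sub>j\<close> of the localized factor, for \<open>k = j\<close> it contains \<open>D\<^sub>j\<^sup>*\<close>. So it is enough that in every ball
  one of \<open>D\<^sub>j\<close> and \<open>D\<^sub>j\<^sup>*\<close> is bounded on some normalized test function, with a bound common to all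
  balls (\<open>localized_modes_of_cond_H\<close>). Which one depends on the sign of the magnetic field
  \<open>B = \<Delta>\<phi>\<^sub>j\<close> there.

  The condition gives, in each ball, a smaller ball of fixed radius on which \<open>B\<close> varies slowly in
  comparison with \<open>1 + |B|\<close> at the centre (\<open>slowly_varying_point\<close>): the order of the controlled
  derivatives is lowered one by one, because a large derivative makes the derivative below it large
  nearby. On such a ball the field is nearly constant, and the lowest Landau state of the constant
  field, cut off at the fixed radius and carried over by a gauge transformation, is an approximate
  zero mode (\<open>localized_mode\<close>). The gauge transformation is essential, because the condition
  controls \<open>B\<close> but not \<open>\<phi>\<^sub>j\<close>, to which any harmonic function may be added.
\<close>

section \<open>Calculus of smooth functions\<close>

lemma Ck_SucI:
  assumes "\<And>x. (f has_derivative f' x) (at x)" and "\<And>v. Ck k (\<lambda>x. f' x v)"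
  shows "Ck (Suc k) f"
proof -
  have "frechet_derivative f (at x) = f' x" for x
    using frechet_derivative_at[OF assms(1)] by simp
  then show ?thesis using assms by (auto simp: differentiable_def)
qed

lemma Ck_has_derivative:
  "Ck (Suc k) f \<Longrightarrow> (f has_derivative (\<lambda>v. dir_deriv v f x)) (at x)"
  unfolding dir_deriv_def using frechet_derivative_works by auto

lemma Ck_dir_deriv: "Ck (Suc k) f \<Longrightarrow> Ck k (dir_deriv v f)"
  unfolding dir_deriv_def by simp

lemma dir_deriv_eq: "(f has_derivative f') (at x) \<Longrightarrow> dir_deriv v f x = f' v"
  unfolding dir_deriv_def using frechet_derivative_at by metis

lemma Ck_SucD: "Ck (Suc k) f \<Longrightarrow> Ck k f"
proof (induction k arbitrary: f)
  case 0
  then show ?case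
    by (auto intro!: continuous_at_imp_continuous_on differentiable_imp_continuous_within)
next
  case (Suc k)
  then show ?case by (metis Ck.simps(2))
qed

lemma Ck_continuous: "Ck k f \<Longrightarrow> continuous_on UNIV f"
  by (induction k) (use Ck_SucD in \<open>auto simp del: Ck.simps(2)\<close>)

lemma Ck_const: "Ck k (\<lambda>x. c)"
proof (induction k arbitrary: c)
  case (Suc k)
  show ?case by (rule Ck_SucI[where f' = "\<lambda>x v. 0"]) (use Suc in auto)
qed auto

lemma Ck_bounded_linear: "bounded_linear L \<Longrightarrow> Ck k L"
proof (cases k)
  case 0
  assume "bounded_linear L"
  then show ?thesis using 0 by (simp add: linear_continuous_on)
next
  case (Suc m)
  assume "bounded_linear L"
  then show ?thesis unfolding Suc
    by (intro Ck_SucI[where f' = "\<lambda>x v. L v"] bounded_linear_imp_has_derivative Ck_const)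
qed

lemma Ck_compose_linear:
  assumes "bounded_linear T" shows "Ck k f \<Longrightarrow> Ck k (\<lambda>x. T (f x))"
proof (induction k arbitrary: f)
  case 0
  then show ?case
    using linear_continuous_on_compose[OF _ assms[THEN bounded_linear.linear]] by auto
next
  case (Suc k)
  show ?case
    by (rule Ck_SucI[where f' = "\<lambda>x v. T (dir_deriv v f x)"])
      (auto intro!: bounded_linear.has_derivative[OF assms] Ck_has_derivative[OF Suc.prems] Suc.IH
         Ck_dir_deriv[OF Suc.prems] simp del: Ck.simps)
qed

lemma Ck_add: "Ck k f \<Longrightarrow> Ck k g \<Longrightarrow> Ck k (\<lambda>x. f x + g x)"
proof (induction k arbitrary: f g)
  case 0
  then show ?case by (auto intro: continuous_intros)
next
  case (Suc k)
  show ?case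
    by (rule Ck_SucI[where f' = "\<lambda>x v. dir_deriv v f x + dir_deriv v g x"])
      (auto intro!: has_derivative_add Ck_has_derivative[OF Suc.prems(1)]
        Ck_has_derivative[OF Suc.prems(2)] Suc.IH
         Ck_dir_deriv[OF Suc.prems(1)] Ck_dir_deriv[OF Suc.prems(2)] simp del: Ck.simps)
qed

lemma Ck_bilinear:
  assumes "bounded_bilinear P" shows "Ck k f \<Longrightarrow> Ck k g \<Longrightarrow> Ck k (\<lambda>x. P (f x) (g x))"
proof (induction k arbitrary: f g)
  case 0
  then show ?case using bounded_bilinear.continuous_on[OF assms] by auto
next
  case (Suc k)
  show ?case
    by (rule Ck_SucI[where f' = "\<lambda>x v. P (f x) (dir_deriv v g x) + P (dir_deriv v f x) (g x)"])
      (auto intro!: bounded_bilinear.FDERIV[OF assms] Ck_has_derivative[OF Suc.prems(1)]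
        Ck_has_derivative[OF Suc.prems(2)] Suc.IH Ck_add
         Ck_dir_deriv[OF Suc.prems(1)] Ck_dir_deriv[OF Suc.prems(2)] Ck_SucD[OF Suc.prems(1)]
         Ck_SucD[OF Suc.prems(2)] simp del: Ck.simps)
qed

lemma Ck_sum: "(\<And>i. i \<in> I \<Longrightarrow> Ck k (f i)) \<Longrightarrow> Ck k (\<lambda>x. \<Sum>i\<in>I. f i x)"
  by (induction I rule: infinite_finite_induct) (auto intro: Ck_const Ck_add)

lemma dir_deriv_compose:
  fixes f :: "'b::euclidean_space \<Rightarrow> 'c::euclidean_space"
  assumes "Ck (Suc k) f" and "(g has_derivative g') (at x)"
  shows "((\<lambda>x. f (g x)) has_derivative (\<lambda>v. dir_deriv (g' v) f (g x))) (at x)"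
  using has_derivative_compose[OF assms(2) Ck_has_derivative[OF assms(1)]] .

lemma dir_deriv_expand:
  fixes f :: "'b::euclidean_space \<Rightarrow> 'c::euclidean_space"
  assumes "Ck (Suc k) f"
  shows "dir_deriv v f x = (\<Sum>b\<in>Basis. (v \<bullet> b) *\<^sub>R dir_deriv b f x)"
proof -
  have l: "linear (\<lambda>v. dir_deriv v f x)"
    using Ck_has_derivative[OF assms] has_derivative_linear by blast
  have "dir_deriv v f x = dir_deriv (\<Sum>b\<in>Basis. (v \<bullet> b) *\<^sub>R b) f x"
    by (simp add: euclidean_representation)
  also have "\<dots> = (\<Sum>b\<in>Basis. (v \<bullet> b) *\<^sub>R dir_deriv b f x)"
    unfolding linear_sum[OF l] linear_cmul[OF l] ..
  finally show ?thesis .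
qed

lemma Ck_compose:
  fixes f :: "'b::euclidean_space \<Rightarrow> 'c::euclidean_space"
    and g :: "'a::euclidean_space \<Rightarrow> 'b"
  shows "Ck k f \<Longrightarrow> Ck k g \<Longrightarrow> Ck k (\<lambda>x. f (g x))"
proof (induction k arbitrary: f)
  case 0
  then show ?case by (auto intro: continuous_on_compose2)
next
  case (Suc k)
  note g = Ck_SucD[OF Suc.prems(2)]
  have "Ck k (\<lambda>x. dir_deriv (dir_deriv v g x) f (g x))" for v
    unfolding dir_deriv_expand[OF Suc.prems(1), of "dir_deriv v g _"]
    by (intro Ck_sum Ck_bilinear[OF bounded_bilinear_scaleR] Suc.IH Ck_dir_deriv[OF Suc.prems(1)] g
        Ck_compose_linear[OF bounded_linear_inner_left] Ck_dir_deriv[OF Suc.prems(2)])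
  then show ?case
    by (intro Ck_SucI[OF dir_deriv_compose[OF Suc.prems(1) Ck_has_derivative[OF Suc.prems(2)]]])
qed

lemma smooth_Ck: "smooth f \<Longrightarrow> Ck k f"
  by (simp add: smooth_def)

lemma smooth_has_derivative: "smooth f \<Longrightarrow> (f has_derivative (\<lambda>v. dir_deriv v f x)) (at x)"
  using Ck_has_derivative smooth_Ck by blast

lemma smooth_dir_deriv: "smooth f \<Longrightarrow> smooth (dir_deriv v f)"
  using Ck_dir_deriv unfolding smooth_def by blast

lemma smooth_continuous_on: "smooth f \<Longrightarrow> continuous_on S f"
  using Ck_continuous smooth_Ck continuous_on_subset by blast

lemma smooth_const: "smooth (\<lambda>x. c)"
  by (auto simp: smooth_def intro: Ck_const simp del: Ck.simps)

lemma smooth_linear: "bounded_linear L \<Longrightarrow> smooth L"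
  by (auto simp: smooth_def intro: Ck_bounded_linear simp del: Ck.simps)

lemma smooth_compose_linear: "bounded_linear T \<Longrightarrow> smooth f \<Longrightarrow> smooth (\<lambda>x. T (f x))"
  by (auto simp: smooth_def intro: Ck_compose_linear simp del: Ck.simps)

lemma smooth_add: "smooth f \<Longrightarrow> smooth g \<Longrightarrow> smooth (\<lambda>x. f x + g x)"
  by (auto simp: smooth_def intro: Ck_add simp del: Ck.simps)

lemma smooth_bilinear:
  "bounded_bilinear P \<Longrightarrow> smooth f \<Longrightarrow> smooth g \<Longrightarrow> smooth (\<lambda>x. P (f x) (g x))"
  by (auto simp: smooth_def intro: Ck_bilinear simp del: Ck.simps)

lemma smooth_sum: "(\<And>i. i \<in> I \<Longrightarrow> smooth (f i)) \<Longrightarrow> smooth (\<lambda>x. \<Sum>i\<in>I. f i x)"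
  by (auto simp: smooth_def intro: Ck_sum simp del: Ck.simps)

lemma smooth_compose: "smooth f \<Longrightarrow> smooth g \<Longrightarrow> smooth (\<lambda>x. f (g x))"
  by (auto simp: smooth_def intro: Ck_compose simp del: Ck.simps)

lemmas smooth_mult = smooth_bilinear[OF bounded_bilinear_mult]
lemmas smooth_scaleR = smooth_bilinear[OF bounded_bilinear_scaleR]
lemmas smooth_inner = smooth_bilinear[OF bounded_bilinear_inner]
lemmas smooth_of_real = smooth_compose_linear[OF bounded_linear_of_real]
lemmas smooth_cnj = smooth_compose_linear[OF bounded_linear_cnj]
lemmas smooth_ident = smooth_linear[OF bounded_linear_ident]

lemma smooth_uminus: "smooth f \<Longrightarrow> smooth (\<lambda>x. - f x)"
  using smooth_compose_linear[OF bounded_linear_minus[OF bounded_linear_ident]] .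

lemma smooth_diff: "smooth f \<Longrightarrow> smooth g \<Longrightarrow> smooth (\<lambda>x. f x - g x)"
  using smooth_add[OF _ smooth_uminus, of f g] by simp

lemma smooth_cmult:
  fixes c :: "'a::{euclidean_space, real_normed_algebra}"
  shows "smooth f \<Longrightarrow> smooth (\<lambda>x. c * f x)"
  using smooth_mult[OF smooth_const] .

lemma smooth_prod:
  fixes f :: "'i \<Rightarrow> 'a::euclidean_space \<Rightarrow> complex"
  shows "(\<And>i. i \<in> I \<Longrightarrow> smooth (f i)) \<Longrightarrow> smooth (\<lambda>x. \<Prod>i\<in>I. f i x)"
  by (induction I rule: infinite_finite_induct) (auto intro: smooth_const smooth_mult)

lemma smooth_vec_lambda:
  fixes F :: "'n::finite \<Rightarrow> 'a::euclidean_space \<Rightarrow> 'b::euclidean_space"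
  assumes "\<And>k. smooth (F k)"
  shows "smooth (\<lambda>x. \<chi> k. F k x)"
proof -
  have "(\<lambda>x. \<chi> k. F k x) = (\<lambda>x. \<Sum>k\<in>UNIV. axis k (F k x))"
    by (auto simp: vec_eq_iff axis_def)
  moreover have "bounded_linear (axis k :: 'b \<Rightarrow> _)" for k :: 'n
    by (intro linear_conv_bounded_linear[THEN iffD1] linearI) (auto simp: axis_def vec_eq_iff)
  ultimately show ?thesis
    using smooth_sum[of UNIV "\<lambda>k x. axis k (F k x)", OF smooth_compose_linear[OF _ assms]] by simp
qed

lemma Ck_complex_exp: "Ck k (exp :: complex \<Rightarrow> complex)"
proof (induction k)
  case 0
  then show ?case by (auto intro: continuous_intros)
next
  case (Suc k)
  show ?case
  proof (rule Ck_SucI[where f' = "\<lambda>x v. exp x * v"])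
    show "(exp has_derivative (*) (exp x)) (at x)" for x :: complex
      using DERIV_exp[of x] unfolding has_field_derivative_def .
  qed (rule Ck_bilinear[OF bounded_bilinear_mult Suc Ck_const])
qed

lemma smooth_exp: "smooth f \<Longrightarrow> smooth (\<lambda>x. exp (f x :: complex))"
  using smooth_compose[of exp f] Ck_complex_exp by (simp add: smooth_def del: Ck.simps)

lemma param_integral_has_derivative:
  fixes f :: "real \<times> 'a::euclidean_space \<Rightarrow> 'b::euclidean_space"
  assumes "Ck (Suc k) f"
  shows "((\<lambda>x. integral {0..1} (\<lambda>t. f (t, x))) has_derivative
     (\<lambda>v. integral {0..1} (\<lambda>t. dir_deriv (0, v) f (t, x)))) (at x)"
proof -
  define F where "F x t = Blinfun (\<lambda>v. dir_deriv (0, v) f (t, x))" for x t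
  have d: "((\<lambda>x. f (t, x)) has_derivative (\<lambda>v. dir_deriv (0, v) f (t, x))) (at x)" for t x
    by (rule dir_deriv_compose[OF assms]) (auto intro!: derivative_eq_intros)
  then have F: "blinfun_apply (F x t) = (\<lambda>v. dir_deriv (0, v) f (t, x))" for x t
    unfolding F_def by (intro bounded_linear_Blinfun_apply has_derivative_bounded_linear)
  have c: "continuous_on S f" "continuous_on S (dir_deriv v f)" for S v
    using Ck_continuous[OF assms] Ck_continuous[OF Ck_dir_deriv[OF assms]] continuous_on_subset by blast+
  have "continuous_on (UNIV \<times> cbox 0 1) (\<lambda>p. dir_deriv (0, v) f (snd p, fst p))" for v
    by (rule continuous_on_compose2[OF c(2)[of UNIV]])
      (auto intro!: continuous_on_Pair continuous_on_fst continuous_on_snd continuous_on_id)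
  then have cF: "continuous_on (UNIV \<times> cbox 0 1) (\<lambda>(x, t). F x t)"
    by (intro continuous_on_blinfun_componentwise) (simp add: case_prod_unfold F)
  have ci: "continuous_on (cbox 0 1) (\<lambda>t. h (t, x))"
    if "continuous_on UNIV h" for h :: "real \<times> 'a \<Rightarrow> 'b" and x
    by (rule continuous_on_compose2[OF that])
      (auto intro!: continuous_on_Pair continuous_on_const continuous_on_id)
  have "((\<lambda>x. integral (cbox 0 1) (\<lambda>t. f (t, x))) has_derivative integral (cbox 0 1) (F x)) (at x within UNIV)"
    by (rule leibniz_rule[OF _ _ cF]) (simp_all add: F d integrable_continuous[OF ci[OF c(1)], simplified])
  moreover have "blinfun_apply (integral (cbox 0 1) (F x)) v = integral {0..1} (\<lambda>t. dir_deriv (0, v) f (t, x))" for v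
  proof -
    have "F x integrable_on cbox 0 1"
      by (intro integrable_continuous continuous_on_blinfun_componentwise) (simp only: F ci[OF c(2)])
    from blinfun_apply_integral[OF this, of v] show ?thesis by (simp add: F)
  qed
  then have "blinfun_apply (integral (cbox 0 1) (F x)) = (\<lambda>v. integral {0..1} (\<lambda>t. dir_deriv (0, v) f (t, x)))" by auto
  ultimately show ?thesis by simp
qed

text \<open>Every directional derivative of a parameter integral is again a parameter integral, of a
  directional derivative of the integrand.\<close>

lemma Ck_param_integral:
  fixes f :: "real \<times> 'a::euclidean_space \<Rightarrow> 'b::euclidean_space"
  shows "Ck k f \<Longrightarrow> Ck k (\<lambda>x. integral {0..1} (\<lambda>t. f (t, x)))"
proof (induction k arbitrary: f)
  case 0
  then have f: "continuous_on UNIV f" by simp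
  have "continuous_on (UNIV \<times> cbox 0 1) (\<lambda>p. f (snd p, fst p))"
    by (rule continuous_on_compose2[OF f]) (auto intro!: continuous_on_Pair continuous_on_fst continuous_on_snd continuous_on_id)
  then have "continuous_on UNIV (\<lambda>x. integral (cbox 0 1) (\<lambda>t. f (t, x)))"
    by (intro integral_continuous_on_param) (simp add: case_prod_unfold)
  then show ?case by simp
next
  case (Suc k)
  show ?case
    by (rule Ck_SucI[OF param_integral_has_derivative[OF Suc.prems]])
      (intro Suc.IH Ck_dir_deriv[OF Suc.prems])
qed

lemma smooth_param_integral:
  fixes f :: "real \<times> 'a::euclidean_space \<Rightarrow> 'b::euclidean_space"
  shows "smooth f \<Longrightarrow> smooth (\<lambda>x. integral {0..1} (\<lambda>t. f (t, x)))"
  by (auto simp: smooth_def intro: Ck_param_integral simp del: Ck.simps)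

text \<open>Integrating \<open>D\<^sub>v f\<close> along a segment in direction \<open>v\<close> gives an increment of \<open>f\<close>. Applying
  \<open>D\<^sub>u\<close> under the integral and letting the segment shrink interchanges the two derivatives.\<close>

lemma dir_deriv_commute:
  fixes f :: "'a::euclidean_space \<Rightarrow> 'b::euclidean_space"
  assumes f: "smooth f"
  shows "dir_deriv u (dir_deriv v f) x = dir_deriv v (dir_deriv u f) x"
proof -
  let ?g = "dir_deriv u (dir_deriv v f)"
  define G where "G t = integral {0..1} (\<lambda>\<tau>. ?g (x + (\<tau> * t) *\<^sub>R v))" for t :: real
  note sm = smooth_compose[OF f] smooth_compose[OF smooth_dir_deriv[OF f]]
    smooth_compose[OF smooth_dir_deriv[OF smooth_dir_deriv[OF f]]]
    smooth_add smooth_const smooth_scaleR smooth_mult smooth_linear bounded_linear_fst bounded_linear_snd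
  have G: "smooth G" unfolding G_def
    using smooth_param_integral[of "\<lambda>p. ?g (x + (fst p * snd p) *\<^sub>R v)"] by (simp add: sm)
  have inc: "dir_deriv u f (x + t *\<^sub>R v) - dir_deriv u f x = t *\<^sub>R G t" for t
  proof -
    have "f (y + t *\<^sub>R v) - f y = integral {0..1} (\<lambda>\<tau>. t *\<^sub>R dir_deriv v f (y + (\<tau> * t) *\<^sub>R v))" for y
    proof -
      have "((\<lambda>\<tau>. t *\<^sub>R dir_deriv v f (y + (\<tau> * t) *\<^sub>R v)) has_integral
          f (y + (1 * t) *\<^sub>R v) - f (y + (0 * t) *\<^sub>R v)) {0..1}"
      proof (rule fundamental_theorem_of_calculus)
        show "((\<lambda>\<tau>. f (y + (\<tau> * t) *\<^sub>R v)) has_vector_derivative t *\<^sub>R dir_deriv v f (y + (\<tau> * t) *\<^sub>R v))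
          (at \<tau> within {0..1})" for \<tau>
        proof -
          have l: "linear (\<lambda>v. dir_deriv v f (y + (\<tau> * t) *\<^sub>R v'))" for v'
            using smooth_has_derivative[OF f] has_derivative_linear by blast
          have "((\<lambda>\<tau>. f (y + (\<tau> * t) *\<^sub>R v)) has_derivative
             (\<lambda>s. dir_deriv ((s * t) *\<^sub>R v) f (y + (\<tau> * t) *\<^sub>R v))) (at \<tau>)"
            by (rule dir_deriv_compose[OF smooth_Ck[OF f]]) (auto intro!: derivative_eq_intros)
          then have "((\<lambda>\<tau>. f (y + (\<tau> * t) *\<^sub>R v)) has_vector_derivative t *\<^sub>R dir_deriv v f (y + (\<tau> * t) *\<^sub>R v)) (at \<tau>)"
            unfolding has_vector_derivative_def linear_cmul[OF l] by simp
          then show ?thesis by (rule has_vector_derivative_at_within)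
        qed
      qed simp
      from integral_unique[OF this] show ?thesis by simp
    qed
    then have "(\<lambda>y. f (y + t *\<^sub>R v) - f y) = (\<lambda>y. t *\<^sub>R integral {0..1} (\<lambda>\<tau>. dir_deriv v f (y + (\<tau> * t) *\<^sub>R v)))"
      by auto
    moreover have "((\<lambda>y. f (y + t *\<^sub>R v) - f y) has_derivative
      (\<lambda>w. dir_deriv w f (x + t *\<^sub>R v) - dir_deriv w f x)) (at x)"
      by (intro has_derivative_diff smooth_has_derivative[OF f] dir_deriv_compose[OF smooth_Ck[OF f]])
        (auto intro!: derivative_eq_intros)
    moreover have "((\<lambda>y. t *\<^sub>R integral {0..1} (\<lambda>\<tau>. dir_deriv v f (y + (\<tau> * t) *\<^sub>R v))) has_derivative
      (\<lambda>w. t *\<^sub>R integral {0..1} (\<lambda>\<tau>. dir_deriv w (dir_deriv v f) (x + (\<tau> * t) *\<^sub>R v)))) (at x)"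
    proof -
      let ?F = "\<lambda>p. dir_deriv v f (snd p + (fst p * t) *\<^sub>R v)"
      have sF: "smooth ?F" by (simp add: sm)
      have "dir_deriv (0, w) ?F (\<tau>, y) = dir_deriv w (dir_deriv v f) (y + (\<tau> * t) *\<^sub>R v)" for w \<tau> y
      proof -
        have "(?F has_derivative (\<lambda>h. dir_deriv (snd h + (fst h * t) *\<^sub>R v) (dir_deriv v f) (snd (\<tau>, y) + (fst (\<tau>, y) * t) *\<^sub>R v))) (at (\<tau>, y))"
          by (rule dir_deriv_compose[OF smooth_Ck[OF smooth_dir_deriv[OF f]]]) (auto intro!: derivative_eq_intros)
        from dir_deriv_eq[OF this, of "(0, w)"] show ?thesis by simp
      qed
      then show ?thesis
        using has_derivative_scaleR_right[OF param_integral_has_derivative[OF smooth_Ck[OF sF]], of t x] by simp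
    qed
    ultimately have "(\<lambda>w. dir_deriv w f (x + t *\<^sub>R v) - dir_deriv w f x) =
       (\<lambda>w. t *\<^sub>R integral {0..1} (\<lambda>\<tau>. dir_deriv w (dir_deriv v f) (x + (\<tau> * t) *\<^sub>R v)))"
      using has_derivative_unique[of "\<lambda>y. f (y + t *\<^sub>R v) - f y"] by simp
    from fun_cong[OF this, of u] show ?thesis unfolding G_def .
  qed
  have "((\<lambda>t. dir_deriv u f (x + t *\<^sub>R v)) has_derivative
      (\<lambda>s. dir_deriv (s *\<^sub>R v) (dir_deriv u f) (x + 0 *\<^sub>R v))) (at 0)"
    by (rule dir_deriv_compose[OF smooth_Ck[OF smooth_dir_deriv[OF f]]]) (auto intro!: derivative_eq_intros)
  moreover have l: "linear (\<lambda>w. dir_deriv w (dir_deriv u f) x)"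
    using smooth_has_derivative[OF smooth_dir_deriv[OF f]] has_derivative_linear by blast
  ultimately have "((\<lambda>t. dir_deriv u f (x + t *\<^sub>R v)) has_vector_derivative dir_deriv v (dir_deriv u f) x) (at 0)"
    by (simp add: has_vector_derivative_def linear_cmul[OF l])
  moreover have "((\<lambda>t. dir_deriv u f (x + t *\<^sub>R v)) has_vector_derivative G 0) (at 0)"
  proof -
    have "dir_deriv u f (x + t *\<^sub>R v) = dir_deriv u f x + t *\<^sub>R G t" for t
      using inc[of t] by (simp add: algebra_simps)
    moreover have "((\<lambda>t. dir_deriv u f x + t *\<^sub>R G t) has_derivative
        (\<lambda>s. 0 + (0 *\<^sub>R dir_deriv s G 0 + s *\<^sub>R G 0))) (at 0)"
      by (intro has_derivative_add has_derivative_const has_derivative_scaleR has_derivative_ident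
          smooth_has_derivative[OF G])
    ultimately show ?thesis by (simp add: has_vector_derivative_def)
  qed
  ultimately have "dir_deriv v (dir_deriv u f) x = G 0" by (rule vector_derivative_unique_at)
  then show ?thesis by (simp add: G_def)
qed

section \<open>Points where the magnetic field varies slowly\<close>

text \<open>The next functions express \<open>m\<^sub>q\<close> and \<open>m\<^sup>r\<close> through the field \<open>B\<close>, which is all that enters the
  condition, and count derivatives by their order \<open>q - 1\<close>.\<close>

definition mixed :: "nat \<Rightarrow> nat \<Rightarrow> (complex \<Rightarrow> real) \<Rightarrow> complex \<Rightarrow> real" where
  "mixed a b B = (dir_deriv 1 ^^ a) ((dir_deriv \<i> ^^ b) B)"

definition jet :: "nat \<Rightarrow> (complex \<Rightarrow> real) \<Rightarrow> complex \<Rightarrow> real" where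
  "jet q B z = (\<Sum>(a, b)\<in>{(a, b). a + b = q}. \<bar>mixed a b B z\<bar>)"

definition jets :: "nat \<Rightarrow> (complex \<Rightarrow> real) \<Rightarrow> complex \<Rightarrow> real" where
  "jets r B z = 1 + (\<Sum>q<r. jet q B z)"

text \<open>The number of partial derivatives of order less than \<open>r\<close>.\<close>

definition jet_count :: "nat \<Rightarrow> real" where
  "jet_count r = (\<Sum>q<r. real (card {(a, b). a + b = (q::nat)}))"

lemma m_sub_eq_jet: "m_sub \<psi> (Suc q) z = jet q (magnetic_field \<psi>) z"
  by (simp add: m_sub_def jet_def mixed_def)

lemma m_sup_eq_jets: "m_sup \<psi> r z = jets r (magnetic_field \<psi>) z"
proof -
  have "{0..r} = insert 0 (Suc ` {..<r})"
    using atLeast0AtMost atMost_Suc_eq_insert_0 lessThan_Suc_atMost lessThan_Suc_eq_insert_0 by metis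
  then show ?thesis
    by (simp add: m_sup_def jets_def sum.reindex m_sub_eq_jet) (simp add: m_sub_def)
qed

lemma finite_index: "finite {(a, b). a + b = (q::nat)}"
  by (rule finite_subset[of _ "{..q} \<times> {..q}"]) auto

lemma jet_count_mono: "r \<le> s \<Longrightarrow> jet_count r \<le> jet_count s"
  unfolding jet_count_def by (intro sum_mono2) auto

lemma card_le_jet_count: "q < r \<Longrightarrow> real (card {(a, b). a + b = q}) \<le> jet_count r"
  unfolding jet_count_def by (intro member_le_sum) auto

lemma jet_count_ge_1: "1 \<le> jet_count (Suc r)"
proof -
  have "{(a, b). a + b = (0::nat)} = {(0, 0)}" by auto
  then have "1 = real (card {(a, b). a + b = (0::nat)})" by simp
  also have "\<dots> \<le> jet_count (Suc r)" by (rule card_le_jet_count) simp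
  finally show ?thesis .
qed

lemma jet_nonneg: "0 \<le> jet q B z"
  unfolding jet_def by (intro sum_nonneg) auto

lemma jet_le_jets: "q < r \<Longrightarrow> jet q B z \<le> jets r B z"
  unfolding jets_def using member_le_sum[of q "{..<r}" "\<lambda>q. jet q B z"] by (auto simp: jet_nonneg)

lemma jets_ge_1: "1 \<le> jets r B z"
  unfolding jets_def by (simp add: sum_nonneg jet_nonneg)

lemma mixed_le_jet: "a + b = q \<Longrightarrow> \<bar>mixed a b B z\<bar> \<le> jet q B z"
  unfolding jet_def
  using member_le_sum[of "(a, b)" "{(a, b). a + b = q}" "\<lambda>(a, b). \<bar>mixed a b B z\<bar>"] finite_index[of q]
  by auto

lemma smooth_mixed: "smooth B \<Longrightarrow> smooth (mixed a b B)"
proof -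
  assume B: "smooth B"
  have "smooth ((dir_deriv \<i> ^^ b) B)" by (induction b) (auto intro: B smooth_dir_deriv)
  then show ?thesis unfolding mixed_def by (induction a) (auto intro: smooth_dir_deriv)
qed

lemma dir_deriv_1_mixed: "dir_deriv 1 (mixed a b B) = mixed (Suc a) b B"
  by (simp add: mixed_def)

lemma dir_deriv_i_mixed:
  assumes "smooth B" shows "dir_deriv \<i> (mixed a b B) = mixed a (Suc b) B"
proof (induction a)
  case 0
  then show ?case by (simp add: mixed_def)
next
  case (Suc a)
  have "dir_deriv \<i> (mixed (Suc a) b B) = dir_deriv 1 (dir_deriv \<i> (mixed a b B))"
    unfolding dir_deriv_1_mixed[symmetric]
    using dir_deriv_commute[OF smooth_mixed[OF assms], of \<i> 1] by blast
  then show ?case by (simp add: Suc dir_deriv_1_mixed)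
qed

lemma dir_deriv_complex:
  fixes f :: "complex \<Rightarrow> 'b::euclidean_space"
  assumes "smooth f"
  shows "dir_deriv v f z = Re v *\<^sub>R dir_deriv 1 f z + Im v *\<^sub>R dir_deriv \<i> f z"
  using dir_deriv_expand[OF smooth_Ck[OF assms], of v z] by (simp add: Basis_complex_def inner_complex_def)

lemma abs_dir_deriv_le:
  fixes f :: "complex \<Rightarrow> real"
  assumes "smooth f"
  shows "\<bar>dir_deriv v f z\<bar> \<le> (\<bar>dir_deriv 1 f z\<bar> + \<bar>dir_deriv \<i> f z\<bar>) * norm v"
proof -
  have "\<bar>dir_deriv v f z\<bar> \<le> \<bar>Re v\<bar> * \<bar>dir_deriv 1 f z\<bar> + \<bar>Im v\<bar> * \<bar>dir_deriv \<i> f z\<bar>"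
    unfolding dir_deriv_complex[OF assms, of v z] by (simp add: abs_mult[symmetric])
  also have "\<dots> \<le> norm v * \<bar>dir_deriv 1 f z\<bar> + norm v * \<bar>dir_deriv \<i> f z\<bar>"
    by (intro add_mono mult_right_mono abs_Re_le_cmod abs_Im_le_cmod) auto
  finally show ?thesis by (simp add: algebra_simps)
qed

lemma mixed_gradient_le_jet:
  "\<bar>mixed (Suc a) b B z\<bar> + \<bar>mixed a (Suc b) B z\<bar> \<le> jet (Suc (a + b)) B z"
proof -
  have "(\<Sum>(a, b)\<in>{(Suc a, b), (a, Suc b)}. \<bar>mixed a b B z\<bar>) \<le> jet (Suc (a + b)) B z"
    unfolding jet_def by (intro sum_mono2 finite_index) auto
  then show ?thesis by simp
qed

text \<open>Both first partial derivatives of a derivative of order \<open>q\<close> occur, after commuting the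
  derivatives, as distinct terms of the sum over order \<open>q + 1\<close>.\<close>

lemma mixed_lipschitz:
  assumes B: "smooth B" and S: "convex S" "x \<in> S" "y \<in> S"
    and K: "\<And>z. z \<in> S \<Longrightarrow> jet (Suc (a + b)) B z \<le> K"
  shows "\<bar>mixed a b B x - mixed a b B y\<bar> \<le> K * norm (x - y)"
proof -
  have "norm (mixed a b B x - mixed a b B y) \<le> K * norm (x - y)"
  proof (rule differentiable_bound[OF S(1) _ _ S(2,3)])
    show "(mixed a b B has_derivative (\<lambda>v. dir_deriv v (mixed a b B) z)) (at z within S)" for z
      using smooth_has_derivative[OF smooth_mixed[OF B]] has_derivative_at_withinI by blast
    fix z assume "z \<in> S"
    have "\<bar>dir_deriv v (mixed a b B) z\<bar> \<le> K * norm v" for v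
    proof -
      have "\<bar>dir_deriv v (mixed a b B) z\<bar>
        \<le> (\<bar>dir_deriv 1 (mixed a b B) z\<bar> + \<bar>dir_deriv \<i> (mixed a b B) z\<bar>) * norm v"
        by (rule abs_dir_deriv_le[OF smooth_mixed[OF B]])
      also have "\<dots> \<le> K * norm v"
        unfolding dir_deriv_1_mixed dir_deriv_i_mixed[OF B]
        by (rule mult_right_mono[OF order_trans[OF mixed_gradient_le_jet K[OF \<open>z \<in> S\<close>]]]) simp
      finally show ?thesis .
    qed
    then show "onorm (\<lambda>v. dir_deriv v (mixed a b B) z) \<le> K"
      by (intro onorm_le) simp
  qed
  then show ?thesis by simp
qed

lemma jets_lipschitz:
  assumes B: "smooth B" and S: "convex S" "x \<in> S" "y \<in> S"
    and K: "\<And>z q. z \<in> S \<Longrightarrow> q < r \<Longrightarrow> jet (Suc q) B z \<le> K"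
  shows "\<bar>jets r B x - jets r B y\<bar> \<le> jet_count r * (K * norm (x - y))"
proof -
  have "\<bar>jet q B x - jet q B y\<bar> \<le> real (card {(a, b). a + b = q}) * (K * norm (x - y))" if "q < r" for q
  proof -
    let ?I = "{(a, b). a + b = q}"
    have "\<bar>jet q B x - jet q B y\<bar> = \<bar>\<Sum>(a, b)\<in>?I. \<bar>mixed a b B x\<bar> - \<bar>mixed a b B y\<bar>\<bar>"
      unfolding jet_def by (simp add: case_prod_unfold sum_subtractf)
    also have "\<dots> \<le> (\<Sum>(a, b)\<in>?I. K * norm (x - y))"
    proof (rule order_trans[OF sum_abs], rule sum_mono)
      fix p assume p: "p \<in> ?I"
      obtain a b where ab: "p = (a, b)" by (cases p)
      have "\<bar>\<bar>mixed a b B x\<bar> - \<bar>mixed a b B y\<bar>\<bar> \<le> \<bar>mixed a b B x - mixed a b B y\<bar>" by simp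
      also have "\<dots> \<le> K * norm (x - y)"
        by (rule mixed_lipschitz[OF B S]) (use K p ab that in auto)
      finally show "\<bar>case p of (a, b) \<Rightarrow> \<bar>mixed a b B x\<bar> - \<bar>mixed a b B y\<bar>\<bar> \<le> (case p of (a, b) \<Rightarrow> K * norm (x - y))"
        by (simp add: ab)
    qed
    finally show ?thesis by simp
  qed
  then have "(\<Sum>q<r. \<bar>jet q B x - jet q B y\<bar>) \<le> jet_count r * (K * norm (x - y))"
    unfolding jet_count_def sum_distrib_right by (intro sum_mono) auto
  moreover have "\<bar>jets r B x - jets r B y\<bar> \<le> (\<Sum>q<r. \<bar>jet q B x - jet q B y\<bar>)"
    unfolding jets_def by (simp add: sum_subtractf[symmetric] sum_abs)
  ultimately show ?thesis by linarith
qed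

lemma continuous_jets:
  assumes "smooth B" shows "continuous_on S (jets r B)"
proof -
  have "jets r B = (\<lambda>z. 1 + (\<Sum>q<r. \<Sum>p\<in>{(a, b). a + b = q}. \<bar>mixed (fst p) (snd p) B z\<bar>))"
    by (auto simp: jets_def jet_def case_prod_unfold)
  moreover have "continuous_on S (mixed a b B)" for a b
    by (rule smooth_continuous_on[OF smooth_mixed[OF assms]])
  ultimately show ?thesis
    by (auto intro!: continuous_on_add continuous_on_const continuous_on_sum continuous_on_rabs)
qed

text \<open>Where the derivatives of order \<open>r\<close> are controlled by the lower ones, the lower ones satisfy
  a differential inequality, so that they are comparable at nearby points. Instead of integrating
  the inequality, evaluate the Lipschitz bound at a point where the maximum is attained.\<close>

lemma jets_comparable:
  assumes B: "smooth B" and C: "1 \<le> C" and s: "0 < s" "2 * jet_count r * C * s \<le> 1"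
    and H: "\<And>z. z \<in> cball c s \<Longrightarrow> jet r B z \<le> C * jets r B z"
  obtains S where "1 \<le> S" "\<And>z. z \<in> cball c s \<Longrightarrow> jets r B z \<le> S"
    "\<And>z q. z \<in> cball c s \<Longrightarrow> q < r \<Longrightarrow> jet (Suc q) B z \<le> C * S"
    "S \<le> 2 * jets r B c"
proof -
  obtain y where y: "y \<in> cball c s" "\<And>z. z \<in> cball c s \<Longrightarrow> jets r B z \<le> jets r B y"
    using continuous_attains_sup[OF compact_cball _ continuous_jets[OF B, of "cball c s" r], of ] s(1) by force
  define S where "S = jets r B y"
  have S1: "1 \<le> S" unfolding S_def by (rule jets_ge_1)
  have CS: "S \<le> C * S" using C S1 mult_right_mono[of 1 C S] by simp
  have d: "jet (Suc q) B z \<le> C * S" if z: "z \<in> cball c s" and q: "q < r" for z q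
  proof (cases "Suc q = r")
    case True
    have "jet (Suc q) B z \<le> C * jets r B z" using H[OF z] True by simp
    also have "\<dots> \<le> C * S" using y(2)[OF z] C by (simp add: S_def)
    finally show ?thesis .
  next
    case False
    then have "jet (Suc q) B z \<le> jets r B z" using q by (intro jet_le_jets) simp
    then show ?thesis using y(2)[OF z] CS by (simp add: S_def)
  qed
  have "\<bar>jets r B y - jets r B c\<bar> \<le> jet_count r * (C * S * norm (y - c))"
    by (rule jets_lipschitz[OF B convex_cball y(1) _ d]) (use s in auto)
  also have "\<dots> \<le> jet_count r * (C * S * s)"
    using y(1) S1 C by (intro mult_left_mono) (auto simp: dist_norm norm_minus_commute jet_count_def sum_nonneg)
  also have "\<dots> = (2 * jet_count r * C * s) * S / 2" by simp
  also have "\<dots> \<le> S / 2" using s(2) S1 mult_right_mono[of "2 * jet_count r * C * s" 1 S] by simp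
  finally have "S \<le> 2 * jets r B c" unfolding S_def by linarith
  with that[of S] S1 y(2) d show ?thesis unfolding S_def by blast
qed

text \<open>One order can be removed on a smaller ball. If the derivatives of order \<open>r + 1\<close> dominate at
  the centre, then along a suitable segment some derivative of order \<open>r\<close> grows at a definite rate,
  hence is itself large at one end of the segment.\<close>

lemma jet_bound_descend:
  assumes C: "1 \<le> C" and R: "0 < R"
  shows "\<exists>\<rho>>0. \<exists>C'\<ge>1. \<forall>B c. smooth B \<longrightarrow>
    (\<forall>z\<in>ball c R. jet (Suc (Suc r)) B z \<le> C * jets (Suc (Suc r)) B z) \<longrightarrow>
    (\<exists>y. ball y \<rho> \<subseteq> ball c R \<and> (\<forall>z\<in>ball y \<rho>. jet (Suc r) B z \<le> C' * jets (Suc r) B z))"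
proof -
  define n where "n = Suc (Suc r)"
  define k where "k = jet_count n"
  have k1: "1 \<le> k" unfolding k_def n_def by (rule jet_count_ge_1)
  \<comment> \<open>On radius \<open>s\<close> the derivatives of order at most \<open>r + 1\<close> are comparable; along a segment of length
    \<open>s'\<close> a large derivative keeps half of its size; \<open>\<delta>\<close> is the share of the total that the
    derivatives of order at most \<open>r\<close> reach at a suitable point.\<close>
  define s where "s = min (R / 2) (1 / (2 * k * C))"
  define s' where "s' = min (s / 2) (1 / (8 * k * C))"
  define \<delta> where "\<delta> = min (1 / 4) (s' / (16 * k))"
  define \<rho> where "\<rho> = min (s / 2) (\<delta> / (2 * k * C))"
  have s: "0 < s" "s < R" "2 * k * C * s \<le> 1"
  proof -
    show "0 < s" "s < R" using R k1 C by (auto simp: s_def)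
    have "2 * k * C * s \<le> 2 * k * C * (1 / (2 * k * C))"
      using k1 C unfolding s_def by (intro mult_left_mono) auto
    then show "2 * k * C * s \<le> 1" using k1 C by simp
  qed
  have s': "0 < s'" "s' \<le> s / 2" using s k1 C by (auto simp: s'_def)
  have s'k: "C * s' \<le> 1 / (8 * k)"
  proof -
    have "C * s' \<le> C * (1 / (8 * k * C))" using C unfolding s'_def by (intro mult_left_mono) auto
    then show ?thesis using C by (simp add: field_simps)
  qed
  have \<delta>: "0 < \<delta>" "\<delta> \<le> 1 / 4" "\<delta> \<le> s' / (16 * k)" using s' k1 by (auto simp: \<delta>_def)
  have \<rho>: "0 < \<rho>" "\<rho> \<le> s / 2" using s \<delta> k1 C by (auto simp: \<rho>_def)
  have \<rho>k: "k * C * \<rho> \<le> \<delta> / 2"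
  proof -
    have "k * C * \<rho> \<le> k * C * (\<delta> / (2 * k * C))" using C k1 unfolding \<rho>_def by (intro mult_left_mono) auto
    then show ?thesis using C k1 by (simp add: field_simps)
  qed
  have "\<exists>y. ball y \<rho> \<subseteq> ball c R \<and> (\<forall>z\<in>ball y \<rho>. jet (Suc r) B z \<le> (2 / \<delta>) * jets (Suc r) B z)"
    if B: "smooth B" and H: "\<And>z. z \<in> ball c R \<Longrightarrow> jet n B z \<le> C * jets n B z" for B c
  proof -
    have sub: "cball c s \<subseteq> ball c R" using s by auto
    obtain S where S: "1 \<le> S" "\<And>z. z \<in> cball c s \<Longrightarrow> jets n B z \<le> S"
      "\<And>z q. z \<in> cball c s \<Longrightarrow> q < n \<Longrightarrow> jet (Suc q) B z \<le> C * S"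
      "S \<le> 2 * jets n B c"
    proof (rule jets_comparable[OF B C s(1), of n c])
      show "2 * jet_count n * C * s \<le> 1" using s(3) by (simp add: k_def)
    qed (use H sub in auto)
    have split: "jets n B z = jets (Suc r) B z + jet (Suc r) B z" for z
      by (simp add: jets_def n_def)
    have "\<exists>y\<in>cball c (s / 2). \<delta> * S \<le> jets (Suc r) B y"
    proof (cases "S / 4 \<le> jets (Suc r) B c")
      case True
      moreover have "\<delta> * S \<le> (1 / 4) * S" using \<delta>(2) S(1) by (intro mult_right_mono) auto
      ultimately show ?thesis using s by (intro bexI[of _ c]) auto
    next
      case False
      let ?I = "{(a, b). a + b = Suc r}"
      from False have big: "S / 4 < jet (Suc r) B c" using S(4) split[of c] by linarith
      have "\<exists>(a, b)\<in>?I. S / (4 * k) < \<bar>mixed a b B c\<bar>"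
      proof (rule ccontr)
        assume "\<not> ?thesis"
        then have "jet (Suc r) B c \<le> real (card ?I) * (S / (4 * k))"
          unfolding jet_def by (intro sum_bounded_above) (auto simp: not_less)
        also have "\<dots> \<le> k * (S / (4 * k))"
          using card_le_jet_count[of "Suc r" n] S(1) k1 by (intro mult_right_mono) (auto simp: k_def n_def)
        also have "\<dots> = S / 4" using k1 by simp
        finally show False using big by simp
      qed
      then obtain a b where ab: "a + b = Suc r" "S / (4 * k) < \<bar>mixed a b B c\<bar>" by auto
      obtain e a' b' where e: "norm e = 1" "a' + b' = r" "dir_deriv e (mixed a' b' B) = mixed a b B"
      proof (cases a)
        case 0
        then show ?thesis using that[of \<i> 0 r] dir_deriv_i_mixed[OF B, of 0 r] ab(1) by simp
      next
        case (Suc a')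
        then show ?thesis using that[of 1 a' b] dir_deriv_1_mixed[of a' b B] ab(1) by simp
      qed
      let ?P = "mixed a' b' B"
      have der: "((\<lambda>t. ?P (c + t *\<^sub>R e)) has_real_derivative mixed a b B (c + t *\<^sub>R e)) (at t)" for t
      proof -
        have "((\<lambda>t. ?P (c + t *\<^sub>R e)) has_derivative (\<lambda>h. dir_deriv (h *\<^sub>R e) ?P (c + t *\<^sub>R e))) (at t)"
          by (rule dir_deriv_compose[OF smooth_Ck[OF smooth_mixed[OF B]]]) (auto intro!: derivative_eq_intros)
        moreover have l: "linear (\<lambda>v. dir_deriv v ?P (c + t *\<^sub>R e))"
          using smooth_has_derivative[OF smooth_mixed[OF B]] has_derivative_linear by blast
        ultimately show ?thesis
          by (simp add: has_field_derivative_def linear_cmul[OF l] e(3) mult_commute_abs)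
      qed
      obtain \<xi> where \<xi>: "0 < \<xi>" "\<xi> < s'"
        "?P (c + s' *\<^sub>R e) - ?P (c + 0 *\<^sub>R e) = (s' - 0) * mixed a b B (c + \<xi> *\<^sub>R e)"
        using MVT2[OF s'(1), of "\<lambda>t. ?P (c + t *\<^sub>R e)" "\<lambda>t. mixed a b B (c + t *\<^sub>R e)"] der by blast
      define T where "T = S / (8 * k)"
      have "\<bar>mixed a b B (c + \<xi> *\<^sub>R e) - mixed a b B c\<bar> \<le> C * S * norm (c + \<xi> *\<^sub>R e - c)"
        by (rule mixed_lipschitz[OF B convex_cball[of c s]])
          (use \<xi> s s' e(1) ab(1) S(3)[of _ "Suc r"] in \<open>auto simp: n_def dist_norm\<close>)
      also have "\<dots> \<le> S * (C * s')" using \<xi> e(1) C S(1) by simp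
      also have "\<dots> \<le> S * (1 / (8 * k))" using s'k S(1) by (intro mult_left_mono) auto
      finally have "\<bar>mixed a b B (c + \<xi> *\<^sub>R e) - mixed a b B c\<bar> \<le> T" by (simp add: T_def)
      moreover have "2 * T < \<bar>mixed a b B c\<bar>" using ab(2) by (simp add: T_def)
      ultimately have "T \<le> \<bar>mixed a b B (c + \<xi> *\<^sub>R e)\<bar>" by linarith
      then have "s' * T \<le> s' * \<bar>mixed a b B (c + \<xi> *\<^sub>R e)\<bar>"
        using s' by (intro mult_left_mono) auto
      also have "\<dots> = \<bar>?P (c + s' *\<^sub>R e) - ?P c\<bar>" using \<xi>(3) s' by (simp add: abs_mult)
      finally have "s' * T \<le> \<bar>?P (c + s' *\<^sub>R e)\<bar> + \<bar>?P c\<bar>" by linarith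
      moreover have "s' * T = 2 * (s' * S / (16 * k))" by (simp add: T_def)
      ultimately have "s' * S / (16 * k) \<le> \<bar>?P (c + s' *\<^sub>R e)\<bar> \<or> s' * S / (16 * k) \<le> \<bar>?P c\<bar>" by linarith
      moreover have "\<bar>?P y\<bar> \<le> jets (Suc r) B y" for y
        using mixed_le_jet[OF e(2), of B y] jet_le_jets[of r "Suc r" B y] by simp
      moreover have "\<delta> * S \<le> s' * S / (16 * k)"
        using mult_right_mono[OF \<delta>(3), of S] S(1) by simp
      moreover have "c + s' *\<^sub>R e \<in> cball c (s / 2)" using s' e(1) by (simp add: dist_norm)
      moreover have "c \<in> cball c (s / 2)" using s by simp
      ultimately show ?thesis by (meson order_trans)
    qed
    then obtain y where y: "y \<in> cball c (s / 2)" "\<delta> * S \<le> jets (Suc r) B y" by blast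
    have sub2: "ball y \<rho> \<subseteq> cball c s"
    proof
      fix z assume "z \<in> ball y \<rho>"
      then show "z \<in> cball c s" using y(1) \<rho>(2) dist_triangle[of c z y] by auto
    qed
    have "jet (Suc r) B z \<le> (2 / \<delta>) * jets (Suc r) B z" if z: "z \<in> ball y \<rho>" for z
    proof -
      have zc: "z \<in> cball c s" using z sub2 by blast
      have "\<bar>jets (Suc r) B y - jets (Suc r) B z\<bar> \<le> jet_count (Suc r) * (C * S * norm (y - z))"
        by (rule jets_lipschitz[OF B convex_cball[of c s]])
          (use y zc s S(3) in \<open>auto simp: n_def\<close>)
      also have "\<dots> \<le> k * (C * S * \<rho>)"
        using z C S(1) k1 jet_count_mono[of "Suc r" n]
        by (intro mult_mono) (auto simp: dist_norm k_def n_def)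
      also have "\<dots> = (k * C * \<rho>) * S" by simp
      also have "\<dots> \<le> (\<delta> / 2) * S" using \<rho>k S(1) by (intro mult_right_mono) auto
      finally have "(\<delta> / 2) * S \<le> jets (Suc r) B z" using y(2) by (simp add: field_simps) argo
      moreover have "jet (Suc r) B z \<le> S"
        using S(2)[OF zc] split[of z] jets_ge_1[of "Suc r" B z] by linarith
      then have "(\<delta> / 2) * jet (Suc r) B z \<le> (\<delta> / 2) * S" using \<delta>(1) by (intro mult_left_mono) auto
      ultimately have "(\<delta> / 2) * jet (Suc r) B z \<le> jets (Suc r) B z" by linarith
      then show ?thesis using \<delta>(1) by (simp add: field_simps)
    qed
    with sub sub2 show ?thesis by blast
  qed
  moreover have "1 \<le> 2 / \<delta>" using \<delta> by simp
  ultimately show ?thesis using \<rho>(1) unfolding n_def by blast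
qed

text \<open>Descending to order \<open>1\<close> bounds the gradient of \<open>B\<close> by \<open>1 + |B|\<close> on a ball whose radius does not
  depend on \<open>B\<close>; shrinking once more makes \<open>1 + |B|\<close> comparable to its value at the centre.\<close>

lemma slowly_varying_point:
  assumes "1 \<le> C" and "0 < R"
  shows "\<exists>\<rho>>0. \<exists>L\<ge>0. \<forall>B c. smooth B \<longrightarrow>
    (\<forall>z\<in>ball c R. jet (Suc r) B z \<le> C * jets (Suc r) B z) \<longrightarrow>
    (\<exists>x. ball x \<rho> \<subseteq> ball c R \<and> (\<forall>z\<in>ball x \<rho>. \<bar>B z - B x\<bar> \<le> L * (1 + \<bar>B x\<bar>) * norm (z - x)))"
  using assms
proof (induction r arbitrary: C R)
  case 0
  define k where "k = jet_count (Suc 0)"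
  have k1: "1 \<le> k" unfolding k_def by (rule jet_count_ge_1)
  define s where "s = min (R / 2) (1 / (2 * k * C))"
  have s: "0 < s" "s < R" "2 * k * C * s \<le> 1"
  proof -
    show "0 < s" "s < R" using 0 k1 by (auto simp: s_def)
    have "2 * k * C * s \<le> 2 * k * C * (1 / (2 * k * C))"
      using k1 0 unfolding s_def by (intro mult_left_mono) auto
    then show "2 * k * C * s \<le> 1" using k1 0 by simp
  qed
  have "\<bar>B z - B c\<bar> \<le> 2 * C * (1 + \<bar>B c\<bar>) * norm (z - c)"
    if B: "smooth B" and H: "\<And>z. z \<in> ball c R \<Longrightarrow> jet (Suc 0) B z \<le> C * jets (Suc 0) B z"
      and z: "z \<in> ball c s" for B c z
  proof -
    have sub: "cball c s \<subseteq> ball c R" using s by auto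
    obtain S where S: "1 \<le> S" 
      "\<And>z q. z \<in> cball c s \<Longrightarrow> q < Suc 0 \<Longrightarrow> jet (Suc q) B z \<le> C * S"
      "S \<le> 2 * jets (Suc 0) B c"
    proof (rule jets_comparable[OF B 0(1) s(1), of "Suc 0" c])
      show "2 * jet_count (Suc 0) * C * s \<le> 1" using s(3) by (simp add: k_def)
    qed (use H sub in auto)
    have I0: "{(a, b). a + b = (0::nat)} = {(0, 0)}" by auto
    have j: "jets (Suc 0) B c = 1 + \<bar>B c\<bar>"
      by (simp add: jets_def jet_def I0 mixed_def del: add_is_0)
    have m: "mixed 0 0 B = B" by (simp add: mixed_def)
    have "\<bar>mixed 0 0 B z - mixed 0 0 B c\<bar> \<le> (C * S) * norm (z - c)"
      by (rule mixed_lipschitz[OF B convex_cball[of c s]]) (use S(2) z s in auto)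
    also have "\<dots> \<le> (C * (2 * (1 + \<bar>B c\<bar>))) * norm (z - c)"
      using S(3) 0(1) unfolding j by (intro mult_right_mono mult_left_mono) auto
    finally show ?thesis by (simp add: m mult_ac)
  qed
  then have "\<exists>x. ball x s \<subseteq> ball c R \<and> (\<forall>z\<in>ball x s. \<bar>B z - B x\<bar> \<le> 2 * C * (1 + \<bar>B x\<bar>) * norm (z - x))"
    if "smooth B" "\<forall>z\<in>ball c R. jet (Suc 0) B z \<le> C * jets (Suc 0) B z" for B c
    using that s by (intro exI[of _ c] conjI ballI subset_ball) auto
  moreover have "0 \<le> 2 * C" using 0 by simp
  ultimately show ?case using s(1) by blast
next
  case (Suc r)
  obtain \<rho>' C' where 1: "\<rho>' > 0" "C' \<ge> 1" "\<And>B c. smooth B \<Longrightarrow>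
    (\<forall>z\<in>ball c R. jet (Suc (Suc r)) B z \<le> C * jets (Suc (Suc r)) B z) \<Longrightarrow>
    (\<exists>y. ball y \<rho>' \<subseteq> ball c R \<and> (\<forall>z\<in>ball y \<rho>'. jet (Suc r) B z \<le> C' * jets (Suc r) B z))"
    using jet_bound_descend[OF Suc.prems, of r] by metis
  obtain \<rho> L where 2: "\<rho> > 0" "L \<ge> 0" "\<And>B c. smooth B \<Longrightarrow>
    (\<forall>z\<in>ball c \<rho>'. jet (Suc r) B z \<le> C' * jets (Suc r) B z) \<Longrightarrow>
    (\<exists>x. ball x \<rho> \<subseteq> ball c \<rho>' \<and> (\<forall>z\<in>ball x \<rho>. \<bar>B z - B x\<bar> \<le> L * (1 + \<bar>B x\<bar>) * norm (z - x)))"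
    using Suc.IH[OF 1(2,1)] by metis
  have "\<exists>x. ball x \<rho> \<subseteq> ball c R \<and> (\<forall>z\<in>ball x \<rho>. \<bar>B z - B x\<bar> \<le> L * (1 + \<bar>B x\<bar>) * norm (z - x))"
    if B: "smooth B" "\<forall>z\<in>ball c R. jet (Suc (Suc r)) B z \<le> C * jets (Suc (Suc r)) B z" for B c
  proof -
    from 1(3)[OF B] obtain y where y: "ball y \<rho>' \<subseteq> ball c R"
      "\<forall>z\<in>ball y \<rho>'. jet (Suc r) B z \<le> C' * jets (Suc r) B z" by blast
    from 2(3)[OF B(1) y(2)] y(1) show ?thesis by (meson order_trans)
  qed
  with 2(1,2) show ?case by blast
qed

section \<open>A criterion for non-compactness of the resolvent\<close>

text \<open>The real part of the Hermitian product of \<open>L\<^sup>2\<close>. It is enough for all estimates, and serves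
  functions, \<open>(0,1)\<close>-forms and \<open>(0,2)\<close>-forms alike.\<close>

definition ip :: "('a::euclidean_space \<Rightarrow> 'b::euclidean_space) \<Rightarrow> ('a \<Rightarrow> 'b) \<Rightarrow> real" where
  "ip u v = (LINT x|lborel. u x \<bullet> v x)"

lemma L2_norm_power2: "(L2_norm u)\<^sup>2 = ip u u"
  by (simp add: L2_norm_def ip_def power2_norm_eq_inner)

lemma L2_norm_nonneg: "0 \<le> L2_norm u"
  by (simp add: L2_norm_def)

lemma L2_dist_eq: "L2_dist u v = L2_norm (\<lambda>x. u x - v x)"
  by (simp add: L2_dist_def L2_norm_def)

lemma L2_measurable: "u \<in> L2_space \<Longrightarrow> u \<in> borel_measurable borel"
  by (simp add: L2_space_def)

lemma integrable_ip:
  assumes "u \<in> L2_space" "v \<in> L2_space"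
  shows "integrable lborel (\<lambda>x. u x \<bullet> v x)"
proof (rule Bochner_Integration.integrable_bound)
  show "integrable lborel (\<lambda>x. (norm (u x))\<^sup>2 + (norm (v x))\<^sup>2)"
    using assms by (simp add: L2_space_def)
  show "(\<lambda>x. u x \<bullet> v x) \<in> borel_measurable lborel"
    using assms by (auto simp: L2_space_def intro!: borel_measurable_inner)
  have "\<bar>u x \<bullet> v x\<bar> \<le> (norm (u x))\<^sup>2 + (norm (v x))\<^sup>2" for x
  proof -
    have "0 \<le> (norm (u x) - norm (v x))\<^sup>2" by simp
    then have "2 * (norm (u x) * norm (v x)) \<le> (norm (u x))\<^sup>2 + (norm (v x))\<^sup>2"
      by (simp add: power2_diff)
    moreover have "0 \<le> norm (u x) * norm (v x)" by simp
    ultimately show ?thesis using Cauchy_Schwarz_ineq2[of "u x" "v x"] by linarith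
  qed
  then show "AE x in lborel. norm (u x \<bullet> v x) \<le> norm ((norm (u x))\<^sup>2 + (norm (v x))\<^sup>2)" by simp
qed

lemma L2_spaceI:
  assumes "u \<in> borel_measurable borel" "integrable lborel g" "\<And>x. (norm (u x))\<^sup>2 \<le> g x"
  shows "u \<in> L2_space"
proof -
  have "(norm (u x))\<^sup>2 \<le> \<bar>g x\<bar>" for x using assms(3)[of x] by linarith
  then show ?thesis unfolding L2_space_def
    using assms(1) by (auto intro!: Bochner_Integration.integrable_bound[OF assms(2)])
qed

lemma L2_space_scaleR: "u \<in> L2_space \<Longrightarrow> (\<lambda>x. c *\<^sub>R u x) \<in> L2_space"
  by (auto simp: L2_space_def power_mult_distrib intro!: borel_measurable_scaleR)

lemma L2_space_add:
  assumes "u \<in> L2_space" "v \<in> L2_space" shows "(\<lambda>x. u x + v x) \<in> L2_space"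
proof (rule L2_spaceI)
  show "integrable lborel (\<lambda>x. 2 * (norm (u x))\<^sup>2 + 2 * (norm (v x))\<^sup>2)"
    using assms by (simp add: L2_space_def)
  show "(\<lambda>x. u x + v x) \<in> borel_measurable borel"
    using assms by (auto simp: L2_space_def intro!: borel_measurable_add)
  fix x
  have "(norm (u x + v x))\<^sup>2 \<le> (norm (u x) + norm (v x))\<^sup>2"
    by (intro power_mono norm_triangle_ineq) simp
  also have "\<dots> \<le> 2 * (norm (u x))\<^sup>2 + 2 * (norm (v x))\<^sup>2"
    using zero_le_power2[of "norm (u x) - norm (v x)"] by (simp add: power2_diff power2_sum)
  finally show "(norm (u x + v x))\<^sup>2 \<le> 2 * (norm (u x))\<^sup>2 + 2 * (norm (v x))\<^sup>2" .
qed

lemma L2_space_diff: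
  assumes "u \<in> L2_space" "v \<in> L2_space" shows "(\<lambda>x. u x - v x) \<in> L2_space"
  using L2_space_add[OF assms(1) L2_space_scaleR[OF assms(2), of "-1"]] by simp

lemma ip_commute: "ip u v = ip v u"
  by (simp add: ip_def inner_commute)

lemma ip_add_left:
  "u \<in> L2_space \<Longrightarrow> v \<in> L2_space \<Longrightarrow> w \<in> L2_space \<Longrightarrow> ip (\<lambda>x. u x + v x) w = ip u w + ip v w"
  by (simp add: ip_def inner_add_left integrable_ip)

lemma ip_diff_left:
  "u \<in> L2_space \<Longrightarrow> v \<in> L2_space \<Longrightarrow> w \<in> L2_space \<Longrightarrow> ip (\<lambda>x. u x - v x) w = ip u w - ip v w"
  by (simp add: ip_def inner_diff_left integrable_ip)

lemma ip_diff_right: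
  "u \<in> L2_space \<Longrightarrow> v \<in> L2_space \<Longrightarrow> w \<in> L2_space \<Longrightarrow> ip w (\<lambda>x. u x - v x) = ip w u - ip w v"
  by (simp add: ip_def inner_diff_right integrable_ip)

lemma ip_scaleR_left: "ip (\<lambda>x. c *\<^sub>R u x) v = c * ip u v"
  by (simp add: ip_def)

lemma ip_scaleR_right: "ip u (\<lambda>x. c *\<^sub>R v x) = c * ip u v"
  by (simp add: ip_def)

lemma ip_self_nonneg: "0 \<le> ip u u"
  by (simp add: ip_def)

lemma ip_cauchy_schwarz:
  assumes "u \<in> L2_space" "v \<in> L2_space"
  shows "\<bar>ip u v\<bar> \<le> L2_norm u * L2_norm v"
proof -
  have q: "0 \<le> a\<^sup>2 * ip u u - 2 * a * b * ip u v + b\<^sup>2 * ip v v" for a b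
  proof -
    have s: "(\<lambda>x. a *\<^sub>R u x) \<in> L2_space" "(\<lambda>x. b *\<^sub>R v x) \<in> L2_space"
      using assms L2_space_scaleR by blast+
    have "0 \<le> ip (\<lambda>x. a *\<^sub>R u x - b *\<^sub>R v x) (\<lambda>x. a *\<^sub>R u x - b *\<^sub>R v x)" by (rule ip_self_nonneg)
    then show ?thesis
      by (simp add: ip_diff_left ip_diff_right s assms L2_space_diff ip_scaleR_left ip_scaleR_right
          ip_commute[of v u] power2_eq_square algebra_simps)
  qed
  have "(ip u v)\<^sup>2 \<le> ip u u * ip v v"
  proof (cases "ip v v = 0")
    case True
    have "ip u v = 0"
    proof (rule ccontr)
      assume n: "ip u v \<noteq> 0"
      from q[of 1 "(ip u u + 1) / (2 * ip u v)"] True n have "0 \<le> ip u u - (ip u u + 1)"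
        by (simp add: field_simps)
      then show False by simp
    qed
    then show ?thesis using True by simp
  next
    case False
    then have p: "0 < ip v v" using ip_self_nonneg[of v] by simp
    have "0 \<le> ip v v * (ip u u * ip v v - (ip u v)\<^sup>2)"
      using q[of "ip v v" "ip u v"] by (simp add: power2_eq_square algebra_simps)
    then show ?thesis using p by (simp add: zero_le_mult_iff)
  qed
  then have "\<bar>ip u v\<bar>\<^sup>2 \<le> (L2_norm u * L2_norm v)\<^sup>2"
    by (simp add: power_mult_distrib L2_norm_power2)
  then show ?thesis
    by (rule power2_le_imp_le) (simp add: L2_norm_nonneg)
qed

lemma L2_norm_triangle:
  assumes "u \<in> L2_space" "v \<in> L2_space"
  shows "L2_norm (\<lambda>x. u x - v x) \<le> L2_norm u + L2_norm v"
proof -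
  have "(L2_norm (\<lambda>x. u x - v x))\<^sup>2 = ip u u - 2 * ip u v + ip v v"
    using assms by (simp add: L2_norm_power2 ip_diff_left ip_diff_right L2_space_diff ip_commute[of v u])
  also have "\<dots> \<le> (L2_norm u + L2_norm v)\<^sup>2"
    using ip_cauchy_schwarz[OF assms] by (simp add: power2_sum L2_norm_power2)
  finally show ?thesis by (rule power2_le_imp_le) (simp add: L2_norm_nonneg)
qed

lemma ip_tendsto:
  assumes U: "\<And>k. U k \<in> L2_space" "u \<in> L2_space" "(\<lambda>k. L2_dist (U k) u) \<longlonglongrightarrow> 0"
    and V: "\<And>k. V k \<in> L2_space" "v \<in> L2_space" "(\<lambda>k. L2_dist (V k) v) \<longlonglongrightarrow> 0"
  shows "(\<lambda>k. ip (U k) (V k)) \<longlonglongrightarrow> ip u v"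
proof -
  have d: "(\<lambda>x. U k x - u x) \<in> L2_space" "(\<lambda>x. V k x - v x) \<in> L2_space" for k
    using U V by (auto intro: L2_space_diff)
  have e: "ip (U k) (V k) - ip u v = ip (\<lambda>x. U k x - u x) (\<lambda>x. V k x - v x)
      + ip (\<lambda>x. U k x - u x) v + ip u (\<lambda>x. V k x - v x)" for k
    using U V by (simp add: ip_diff_left ip_diff_right d)
  have b: "\<bar>ip (U k) (V k) - ip u v\<bar>
      \<le> L2_dist (U k) u * L2_dist (V k) v + L2_dist (U k) u * L2_norm v + L2_norm u * L2_dist (V k) v" for k
    unfolding e L2_dist_eq
    using ip_cauchy_schwarz[OF d(1) d(2), of k k] ip_cauchy_schwarz[OF d(1) V(2), of k]
      ip_cauchy_schwarz[OF U(2) d(2), of k] by linarith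
  have "(\<lambda>k. L2_dist (U k) u * L2_dist (V k) v + L2_dist (U k) u * L2_norm v + L2_norm u * L2_dist (V k) v)
     \<longlonglongrightarrow> 0 * 0 + 0 * L2_norm v + L2_norm u * 0"
    by (intro tendsto_intros U V)
  then have lim: "(\<lambda>k. L2_dist (U k) u * L2_dist (V k) v + L2_dist (U k) u * L2_norm v + L2_norm u * L2_dist (V k) v) \<longlonglongrightarrow> 0"
    by simp
  have "(\<lambda>k. ip (U k) (V k) - ip u v) \<longlonglongrightarrow> 0"
    by (rule Lim_null_comparison[OF always_eventually lim]) (simp add: b)
  then show ?thesis by (simp add: LIM_zero_iff)
qed

lemma norm_vector_scalar: "norm (c *s x) = norm c * norm x" for x :: "complex ^ 'n::finite"
proof -
  have "(norm (c *s x))\<^sup>2 = (norm c * norm x)\<^sup>2"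
    by (simp add: power2_norm_eq_inner inner_vec_def power_mult_distrib)
      (simp add: power2_norm_eq_inner[symmetric] norm_mult power_mult_distrib sum_distrib_left)
  then show ?thesis by (simp add: power2_eq_iff_nonneg)
qed

lemma L2_space_vector_scalar:
  fixes u :: "'a::euclidean_space \<Rightarrow> complex ^ 'n::finite"
  assumes "u \<in> L2_space"
  shows "(\<lambda>x. c *s u x) \<in> L2_space" "L2_norm (\<lambda>x. c *s u x) = norm c * L2_norm u"
proof -
  have "continuous_on UNIV (\<lambda>x :: complex ^ 'n. c *s x)"
    unfolding vector_scalar_mult_def by (intro continuous_intros)
  then have "(\<lambda>x. c *s u x) \<in> borel_measurable borel"
    using borel_measurable_continuous_on L2_measurable[OF assms] by blast
  then show "(\<lambda>x. c *s u x) \<in> L2_space"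
    using assms by (simp add: L2_space_def norm_vector_scalar power_mult_distrib)
  show "L2_norm (\<lambda>x. c *s u x) = norm c * L2_norm u"
    by (simp add: L2_norm_def norm_vector_scalar power_mult_distrib real_sqrt_mult)
qed

text \<open>Let \<open>u\<^sub>k\<close> be orthonormal with bounded energy, and let \<open>v\<^sub>k = (T - \<mu>)\<^sup>-\<^sup>1 u\<^sub>k\<close>. If two of the \<open>v\<^sub>k\<close> are
  close to each other, then their difference has small energy, because
  \<open>T (v\<^sub>k - v\<^sub>l) = (u\<^sub>k - u\<^sub>l) + \<mu> (v\<^sub>k - v\<^sub>l)\<close> is bounded. The Cauchy-Schwarz inequality for the energy
  form then makes \<open>\<langle>T (v\<^sub>k - v\<^sub>l), u\<^sub>k\<rangle>\<close> small, although it is close to \<open>\<langle>u\<^sub>k - u\<^sub>l, u\<^sub>k\<rangle> = 1\<close>.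
  Only the energy of \<open>u\<^sub>k\<close> enters, so that the approximate zero modes constructed below need not
  make \<open>T u\<^sub>k\<close> bounded.\<close>

lemma noncompact_resolvent_criterion:
  fixes T :: "(('a::euclidean_space \<Rightarrow> complex ^ 'n::finite) \<times> ('a \<Rightarrow> complex ^ 'n)) set"
  assumes T: "\<And>v f. (v, f) \<in> T \<Longrightarrow> v \<in> L2_space \<and> f \<in> L2_space"
    and u: "\<And>k::nat. u k \<in> L2_space" "\<And>k. L2_norm (u k) = 1" "\<And>k l. k \<noteq> l \<Longrightarrow> ip (u k) (u l) = 0"
    and M: "0 \<le> M" "\<And>v f w g k. (v, f) \<in> T \<Longrightarrow> (w, g) \<in> T \<Longrightarrow>
      (ip (\<lambda>x. f x - g x) (u k))\<^sup>2 \<le> M * ip (\<lambda>x. f x - g x) (\<lambda>x. v x - w x)"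
  shows "\<not> has_compact_resolvent T"
proof
  assume "has_compact_resolvent T"
  then obtain \<mu> where \<mu>: "\<mu> \<in> resolvent_set T" "compact_operator (resolvent T \<mu>)"
    unfolding has_compact_resolvent_def by blast
  define P where "P k p \<longleftrightarrow> p \<in> T \<and> (AE x in lborel. snd p x - \<mu> *s fst p x = u k x)" for k p
  have "\<forall>k. \<exists>p. P k p"
    using \<mu>(1) u(1) unfolding resolvent_set_def P_def by fastforce
  then obtain p where p: "\<And>k. P k (p k)" using choice[of P] by blast
  define v f where "v k = fst (p k)" and "f k = snd (p k)" for k
  have vf: "(v k, f k) \<in> T" "AE x in lborel. f k x - \<mu> *s v k x = u k x" for k
    using p[of k] by (simp_all add: v_def f_def P_def)
  have vL: "v k \<in> L2_space" and fL: "f k \<in> L2_space" for k using T[OF vf(1)] by auto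
  have "(u k, v k) \<in> resolvent T \<mu>" for k
    unfolding resolvent_def using u(1) vf by blast
  then obtain s w where s: "strict_mono (s :: nat \<Rightarrow> nat)" "w \<in> L2_space" "(\<lambda>k. L2_dist (v (s k)) w) \<longlonglongrightarrow> 0"
    using \<mu>(2) u(2) unfolding compact_operator_def by (metis order_refl)
  define a where "a = norm \<mu>"
  define e where "e n = L2_norm (\<lambda>x. v (s n) x - v (s (Suc n)) x)" for n
  have e0: "e \<longlonglongrightarrow> 0"
  proof (rule Lim_null_comparison)
    have "e n \<le> L2_dist (v (s n)) w + L2_dist (v (s (Suc n))) w" for n
      unfolding e_def L2_dist_eq
      using L2_norm_triangle[OF L2_space_diff[OF vL[of "s n"] s(2)] L2_space_diff[OF vL[of "s (Suc n)"] s(2)]]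
      by simp
    then show "\<forall>\<^sub>F n in sequentially. norm (e n) \<le> L2_dist (v (s n)) w + L2_dist (v (s (Suc n))) w"
      by (simp add: e_def L2_norm_nonneg)
    show "(\<lambda>n. L2_dist (v (s n)) w + L2_dist (v (s (Suc n))) w) \<longlonglongrightarrow> 0"
      using tendsto_add[OF s(3) LIMSEQ_Suc[OF s(3)]] by simp
  qed
  \<comment> \<open>The inequality that fails in the limit: the \<open>v\<^sub>k\<close> along the convergent subsequence are Cauchy.\<close>
  have "1 \<le> sqrt (M * (2 * e n + a * e n * e n)) + a * e n" for n
  proof -
    let ?k = "s n" and ?l = "s (Suc n)"
    let ?V = "\<lambda>x. v ?k x - v ?l x" and ?U = "\<lambda>x. u ?k x - u ?l x" and ?F = "\<lambda>x. f ?k x - f ?l x"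
    let ?W = "\<lambda>x. \<mu> *s ?V x"
    have kl: "?k \<noteq> ?l" using strict_monoD[OF s(1), of n "Suc n"] by simp
    have L: "?V \<in> L2_space" "?U \<in> L2_space" "?F \<in> L2_space"
      using vL fL u(1) by (auto intro: L2_space_diff)
    note W = L2_space_vector_scalar[OF L(1), of \<mu>]
    have F: "ip ?F h = ip ?U h + ip ?W h" if h: "h \<in> L2_space" for h
    proof -
      have "ip ?F h = ip (\<lambda>x. ?U x + ?W x) h"
        unfolding ip_def
      proof (rule integral_cong_AE)
        show "(\<lambda>x. ?F x \<bullet> h x) \<in> borel_measurable lborel" "(\<lambda>x. (?U x + ?W x) \<bullet> h x) \<in> borel_measurable lborel"
          using L2_measurable[OF L(3)] L2_measurable[OF L2_space_add[OF L(2) W(1)]] L2_measurable[OF h]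
          by (auto intro!: borel_measurable_inner)
        show "AE x in lborel. ?F x \<bullet> h x = (?U x + ?W x) \<bullet> h x"
          using vf(2)[of ?k] vf(2)[of ?l]
        proof eventually_elim
          case (elim x)
          have "?U x + ?W x = ?F x"
            unfolding elim[symmetric] by (simp add: vec_eq_iff algebra_simps)
          then show ?case by simp
        qed
      qed
      then show ?thesis using ip_add_left[OF L(2) W(1) h] by simp
    qed
    have Ue: "L2_norm ?U \<le> 2" using L2_norm_triangle[OF u(1) u(1), of ?k ?l] u(2) by simp
    have "ip ?U (u ?k) = 1"
      using u(3)[OF kl] L2_norm_power2[of "u ?k"] u(2) by (simp add: ip_diff_left u(1) ip_commute[of "u ?l"])
    moreover have "\<bar>ip ?W (u ?k)\<bar> \<le> a * e n"
      using ip_cauchy_schwarz[OF W(1) u(1), of ?k] W(2) u(2) by (simp add: a_def e_def)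
    ultimately have 1: "1 \<le> ip ?F (u ?k) + a * e n" using F[OF u(1)[of ?k]] by linarith
    have "ip ?U ?V \<le> 2 * e n"
      using ip_cauchy_schwarz[OF L(2) L(1)] mult_right_mono[OF Ue L2_norm_nonneg[of ?V]] by (simp add: e_def)
    moreover have "ip ?W ?V \<le> a * e n * e n"
      using ip_cauchy_schwarz[OF W(1) L(1)] W(2) by (simp add: a_def e_def)
    ultimately have "M * ip ?F ?V \<le> M * (2 * e n + a * e n * e n)"
      using F[OF L(1)] M(1) by (intro mult_left_mono) auto
    then have "ip ?F (u ?k) \<le> sqrt (M * (2 * e n + a * e n * e n))"
      using M(2)[OF vf(1) vf(1), of ?k ?l ?k] by (intro real_le_rsqrt) linarith
    with 1 show ?thesis by linarith
  qed
  moreover have "(\<lambda>n. sqrt (M * (2 * e n + a * e n * e n)) + a * e n) \<longlonglongrightarrow> sqrt (M * (2 * 0 + a * 0 * 0)) + a * 0"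
    by (intro tendsto_intros e0)
  ultimately have "1 \<le> sqrt (M * (2 * 0 + a * 0 * 0)) + a * (0::real)"
    by (intro LIMSEQ_le_const) auto
  then show False by simp
qed

section \<open>Test functions\<close>

lemma test_smooth: "f \<in> test_functions \<Longrightarrow> smooth f"
  by (simp add: test_functions_def)

lemma test_functionsI:
  assumes "smooth f" "compact K" "\<And>x. x \<notin> K \<Longrightarrow> f x = 0"
  shows "f \<in> test_functions"
proof -
  have "closure {x. f x \<noteq> 0} \<subseteq> K"
    using assms(2,3) by (intro closure_minimal compact_imp_closed) auto
  then have "compact (closure {x. f x \<noteq> 0})"
    using compact_Int_closed[OF assms(2) closed_closure, of "{x. f x \<noteq> 0}"] by (simp add: Int_absorb1)
  with assms(1) show ?thesis by (simp add: test_functions_def)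
qed

lemma test_functionsE:
  assumes "f \<in> test_functions"
  obtains K where "compact K" "\<And>x. x \<notin> K \<Longrightarrow> f x = 0" "\<And>x v. x \<notin> K \<Longrightarrow> dir_deriv v f x = 0"
proof -
  define K where "K = closure {x. f x \<noteq> 0}"
  have K: "compact K" "closed K" using assms by (simp_all add: test_functions_def K_def)
  have 0: "f x = 0" if "x \<notin> K" for x
    using that closure_subset[of "{x. f x \<noteq> 0}"] unfolding K_def by auto
  have "dir_deriv v f x = 0" if x: "x \<notin> K" for x v
  proof -
    have "((\<lambda>_. 0) has_derivative (\<lambda>v. 0)) (at x)" by simp
    moreover have "open (- K)" by (intro open_Compl K)
    ultimately have "(f has_derivative (\<lambda>v. 0)) (at x)"
      by (rule has_derivative_transform_within_open) (use x 0 in simp_all)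
    from dir_deriv_eq[OF this] show ?thesis .
  qed
  with that[of K] K 0 show ?thesis by blast
qed

lemma test_dir_deriv: "f \<in> test_functions \<Longrightarrow> dir_deriv v f \<in> test_functions"
  by (rule test_functionsE, assumption, rule test_functionsI)
    (auto intro: smooth_dir_deriv test_smooth)

lemma test_bounded:
  assumes "f \<in> test_functions" obtains M where "\<And>x. norm (f x) \<le> M" "0 \<le> M"
proof -
  obtain K where K: "compact K" "\<And>x. x \<notin> K \<Longrightarrow> f x = 0" using test_functionsE[OF assms] by metis
  have "bounded (f ` K)"
    by (intro compact_imp_bounded compact_continuous_image smooth_continuous_on test_smooth assms K)
  then obtain M where M: "\<And>y. y \<in> f ` K \<Longrightarrow> norm y \<le> M" unfolding bounded_iff by blast
  have "norm (f x) \<le> max 0 M" for x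
    using M[of "f x"] K(2)[of x] by (cases "x \<in> K") (auto simp: le_max_iff_disj)
  then show ?thesis using that[of "max 0 M"] by auto
qed

lemma integrable_compact_support:
  fixes g :: "'a::euclidean_space \<Rightarrow> 'b::euclidean_space"
  assumes "continuous_on UNIV g" "compact K" "\<And>x. x \<notin> K \<Longrightarrow> g x = 0"
  shows "integrable lborel g"
proof -
  have "integrable lborel (\<lambda>x. indicator K x *\<^sub>R g x)"
    using borel_integrable_compact[OF assms(2) continuous_on_subset[OF assms(1)]] by simp
  moreover have "(\<lambda>x. indicator K x *\<^sub>R g x) = g"
    using assms(3) by (auto simp: indicator_def)
  ultimately show ?thesis by simp
qed

lemma test_integrable:
  fixes f :: "'a::euclidean_space \<Rightarrow> 'b::euclidean_space" and g :: "'a \<Rightarrow> 'c::euclidean_space"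
  assumes "f \<in> test_functions" "continuous_on UNIV g" "\<And>x. f x = 0 \<Longrightarrow> g x = 0"
  shows "integrable lborel g"
proof -
  obtain K where "compact K" "\<And>x. x \<notin> K \<Longrightarrow> f x = 0" using test_functionsE[OF assms(1)] by metis
  then show ?thesis using integrable_compact_support[OF assms(2)] assms(3) by blast
qed

lemma test_L2: "f \<in> test_functions \<Longrightarrow> f \<in> L2_space"
  using smooth_continuous_on[OF test_smooth, of f UNIV]
  by (auto simp: L2_space_def intro!: borel_measurable_continuous_onI test_integrable[of f]
      continuous_on_power continuous_on_norm)

text \<open>Translation invariance of the integral gives \<open>\<integral> (f (x + t v) - f x) / t = 0\<close> for all \<open>t\<close>.\<close>

lemma integral_dir_deriv_eq_0:
  fixes f :: "'a::euclidean_space \<Rightarrow> 'b::euclidean_space"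
  assumes f: "f \<in> test_functions"
  shows "(LINT x|lborel. dir_deriv v f x) = 0"
proof -
  note sf = test_smooth[OF f] and cf = smooth_continuous_on[OF test_smooth[OF f]]
  obtain M where M: "\<And>x. norm (dir_deriv v f x) \<le> M" "0 \<le> M"
    using test_bounded[OF test_dir_deriv[OF f]] by metis
  obtain K where K: "compact K" "\<And>x. x \<notin> K \<Longrightarrow> f x = 0" using test_functionsE[OF f] by metis
  define t :: "nat \<Rightarrow> real" where "t n = 1 / real (Suc n)" for n
  have t: "0 < t n" "t n \<le> 1" for n by (auto simp: t_def)
  have t0: "t \<longlonglongrightarrow> 0" unfolding t_def by (rule LIMSEQ_Suc[OF lim_1_over_n])
  define g where "g n x = (1 / t n) *\<^sub>R (f (x + t n *\<^sub>R v) - f x)" for n x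
  obtain K' where K': "compact K'" "\<And>n x. x \<notin> K' \<Longrightarrow> g n x = 0"
  proof -
    obtain R where R: "\<And>x. x \<in> K \<Longrightarrow> norm x \<le> R" using compact_imp_bounded[OF K(1)] unfolding bounded_iff by blast
    have "g n x = 0" if "x \<notin> cball 0 (R + norm v)" for n x
    proof -
      have "norm x \<le> norm (x + t n *\<^sub>R v) + t n * norm v"
        using norm_triangle_ineq4[of "x + t n *\<^sub>R v" "t n *\<^sub>R v"] t[of n] by simp
      moreover have "t n * norm v \<le> 1 * norm v" using t[of n] by (intro mult_right_mono) auto
      ultimately have "x \<notin> K" "x + t n *\<^sub>R v \<notin> K" using that R[of x] R[of "x + t n *\<^sub>R v"] norm_ge_zero[of v]
        by (auto simp del: norm_ge_zero)
      then show ?thesis by (simp add: g_def K(2))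
    qed
    then show ?thesis using that[of "cball 0 (R + norm v)"] by simp
  qed
  have der: "((\<lambda>s. f (x + s *\<^sub>R v)) has_vector_derivative dir_deriv v f (x + s *\<^sub>R v)) (at s)" for x s
  proof -
    have l: "linear (\<lambda>w. dir_deriv w f (x + s *\<^sub>R v))"
      using smooth_has_derivative[OF sf] has_derivative_linear by blast
    have "((\<lambda>s. f (x + s *\<^sub>R v)) has_derivative (\<lambda>h. dir_deriv (h *\<^sub>R v) f (x + s *\<^sub>R v))) (at s)"
      by (rule dir_deriv_compose[OF smooth_Ck[OF sf]]) (auto intro!: derivative_eq_intros)
    then show ?thesis by (simp add: has_vector_derivative_def linear_cmul[OF l])
  qed
  have cont: "continuous_on UNIV (\<lambda>x. f (x + s *\<^sub>R v))" for s
    by (rule continuous_on_compose2[OF cf[of UNIV]]) (auto intro!: continuous_on_add continuous_on_id continuous_on_const)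
  have int: "integrable lborel f" by (rule test_integrable[OF f cf]) simp
  have transl: "(LINT x|lborel. f (x + s *\<^sub>R v)) = integral\<^sup>L lborel f" "integrable lborel (\<lambda>x. f (x + s *\<^sub>R v))" for s
  proof -
    have m: "(+) (s *\<^sub>R v) \<in> measurable lborel borel" "f \<in> borel_measurable borel"
      using borel_measurable_continuous_onI[OF cf[of UNIV]] by auto
    have "integral\<^sup>L lborel f = integral\<^sup>L (distr lborel borel ((+) (s *\<^sub>R v))) f"
      by (simp only: lborel_distr_plus)
    also have "\<dots> = (LINT x|lborel. f (x + s *\<^sub>R v))"
      by (subst integral_distr[OF m]) (simp add: add.commute)
    finally show "(LINT x|lborel. f (x + s *\<^sub>R v)) = integral\<^sup>L lborel f" ..
    have "integrable (distr lborel borel ((+) (s *\<^sub>R v))) f" using int by (simp only: lborel_distr_plus)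
    then show "integrable lborel (\<lambda>x. f (x + s *\<^sub>R v))"
      by (subst (asm) integrable_distr_eq[OF m]) (simp add: add.commute)
  qed
  have g0: "integral\<^sup>L lborel (g n) = 0" for n
    unfolding g_def using transl[of "t n"] int by simp
  have "(\<lambda>n. integral\<^sup>L lborel (g n)) \<longlonglongrightarrow> (LINT x|lborel. dir_deriv v f x)"
  proof (rule integral_dominated_convergence[where w = "\<lambda>x. M * indicator K' x"])
    show "dir_deriv v f \<in> borel_measurable lborel"
      using borel_measurable_continuous_onI[OF smooth_continuous_on[OF smooth_dir_deriv[OF sf]]] by simp
    show "g n \<in> borel_measurable lborel" for n
      unfolding g_def using borel_measurable_continuous_onI[OF cont] borel_measurable_continuous_onI[OF cf]
      by (auto intro!: borel_measurable_scaleR borel_measurable_diff)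
    show "integrable lborel (\<lambda>x. M * indicator K' x)"
      using emeasure_bounded_finite[OF compact_imp_bounded[OF K'(1)]] K'(1)
      by (simp add: integrable_indicator_iff borel_compact)
    show "AE x in lborel. (\<lambda>n. g n x) \<longlonglongrightarrow> dir_deriv v f x"
    proof (rule AE_I2)
      fix x
      have "((\<lambda>s. (1 / s) *\<^sub>R (f (x + s *\<^sub>R v) - f x)) \<longlongrightarrow> dir_deriv v f x) (at 0)"
      proof (rule LIM_zero_cancel, rule tendsto_norm_zero_cancel)
        let ?d = "dir_deriv v f x"
        have lim: "((\<lambda>s. norm (f (x + s *\<^sub>R v) - f x - s *\<^sub>R ?d) / norm s) \<longlongrightarrow> 0) (at 0)"
          using der[of x 0] by (simp add: has_vector_derivative_def has_derivative_at)
        have eq: "norm (f (x + s *\<^sub>R v) - f x - s *\<^sub>R ?d) / norm s =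
            norm ((1 / s) *\<^sub>R (f (x + s *\<^sub>R v) - f x) - ?d)" if "s \<noteq> 0" for s
        proof -
          have "(1 / s) *\<^sub>R (f (x + s *\<^sub>R v) - f x) - ?d = (1 / s) *\<^sub>R (f (x + s *\<^sub>R v) - f x - s *\<^sub>R ?d)"
            using that by (simp add: scaleR_diff_right)
          then show ?thesis by simp
        qed
        show "((\<lambda>s. norm ((1 / s) *\<^sub>R (f (x + s *\<^sub>R v) - f x) - ?d)) \<longlongrightarrow> 0) (at 0)"
          by (intro Lim_transform_within[OF lim, of 1] eq) auto
      qed
      moreover have "filterlim t (at 0) sequentially"
        using t0 t by (auto simp: filterlim_at less_imp_neq[symmetric])
      ultimately show "(\<lambda>n. g n x) \<longlonglongrightarrow> dir_deriv v f x"
        unfolding g_def by (rule filterlim_compose)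
    qed
    show "AE x in lborel. norm (g n x) \<le> M * indicator K' x" for n
    proof (rule AE_I2)
      fix x
      have "norm (f (x + t n *\<^sub>R v) - f (x + 0 *\<^sub>R v)) \<le> M * norm (t n - 0)"
      proof (rule differentiable_bound[OF convex_UNIV])
        show "((\<lambda>s. f (x + s *\<^sub>R v)) has_derivative (\<lambda>h. h *\<^sub>R dir_deriv v f (x + s *\<^sub>R v))) (at s within UNIV)" for s
          using der[of x s] by (simp add: has_vector_derivative_def)
        show "onorm (\<lambda>h. h *\<^sub>R dir_deriv v f (x + s *\<^sub>R v)) \<le> M" for s
          by (rule onorm_le)
            (simp only: norm_scaleR mult.commute[of M] real_norm_def mult_left_mono[OF M(1) abs_ge_zero])
      qed auto
      then have "norm (g n x) \<le> M" using t[of n] unfolding g_def norm_scaleR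
        by (simp add: divide_le_eq)
      then show "norm (g n x) \<le> M * indicator K' x" using K'(2)[of x n] by (auto simp: indicator_def)
    qed
  qed
  then have "(\<lambda>n::nat. 0) \<longlonglongrightarrow> (LINT x|lborel. dir_deriv v f x)" by (simp add: g0)
  then show ?thesis using LIMSEQ_unique tendsto_const by blast
qed

lemma test_cmult_smooth:
  fixes f g :: "'a::euclidean_space \<Rightarrow> complex"
  assumes "f \<in> test_functions" "smooth g" shows "(\<lambda>x. f x * g x) \<in> test_functions"
proof -
  obtain K where "compact K" "\<And>x. x \<notin> K \<Longrightarrow> f x = 0" using test_functionsE[OF assms(1)] by metis
  then show ?thesis using smooth_mult[OF test_smooth[OF assms(1)] assms(2)] by (intro test_functionsI) auto
qed

lemma dir_deriv_mult:
  fixes f g :: "'a::euclidean_space \<Rightarrow> complex"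
  assumes "smooth f" "smooth g"
  shows "dir_deriv v (\<lambda>x. f x * g x) x = f x * dir_deriv v g x + dir_deriv v f x * g x"
  using dir_deriv_eq[OF has_derivative_mult[OF smooth_has_derivative[OF assms(1)] smooth_has_derivative[OF assms(2)]]] .

lemma dir_deriv_cnj:
  fixes f :: "'a::euclidean_space \<Rightarrow> complex"
  assumes "smooth f"
  shows "dir_deriv v (\<lambda>x. cnj (f x)) x = cnj (dir_deriv v f x)"
  using dir_deriv_eq[OF bounded_linear.has_derivative[OF bounded_linear_cnj smooth_has_derivative[OF assms]]] .

lemma dir_deriv_of_real:
  fixes f :: "'a::euclidean_space \<Rightarrow> real"
  assumes "smooth f"
  shows "dir_deriv v (\<lambda>x. complex_of_real (f x)) x = complex_of_real (dir_deriv v f x)"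
  using dir_deriv_eq[OF bounded_linear.has_derivative[OF bounded_linear_of_real smooth_has_derivative[OF assms]]] .

lemma dir_deriv_0: "dir_deriv v (\<lambda>x. 0) = (\<lambda>x. 0)"
  using dir_deriv_eq[OF has_derivative_const] by auto

section \<open>The energy form of the complex Witten Laplacian\<close>

text \<open>The formal adjoint of \<^const>\<open>wdbar\<close>.\<close>

definition wdbar_adj :: "('n::finite) weight \<Rightarrow> 'n \<Rightarrow> 'n form00 \<Rightarrow> 'n form00" where
  "wdbar_adj \<phi> k f = (\<lambda>z. - (dir_deriv (axis k 1) f z - \<i> * dir_deriv (axis k \<i>) f z) / 2
      + cnj (dzbar k (\<lambda>w. complex_of_real (\<phi> w)) z) * f z)"

lemma smooth_dzbar: "smooth f \<Longrightarrow> smooth (dzbar k f)"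
  unfolding dzbar_def divide_complex_def
  by (intro smooth_mult smooth_const smooth_add smooth_dir_deriv) assumption

lemma smooth_wdbar: "smooth \<phi> \<Longrightarrow> smooth f \<Longrightarrow> smooth (wdbar \<phi> k f)"
  unfolding wdbar_def by (intro smooth_add smooth_mult smooth_dzbar smooth_of_real)

lemma smooth_wdbar_adj: "smooth \<phi> \<Longrightarrow> smooth f \<Longrightarrow> smooth (wdbar_adj \<phi> k f)"
  unfolding wdbar_adj_def divide_complex_def
  by (intro smooth_add smooth_mult smooth_const smooth_uminus smooth_diff smooth_cnj smooth_dzbar smooth_of_real smooth_dir_deriv)

lemma test_wdbar_adj:
  assumes "smooth \<phi>" "f \<in> test_functions" shows "wdbar_adj \<phi> k f \<in> test_functions"
proof -
  obtain K where K: "compact K" "\<And>x. x \<notin> K \<Longrightarrow> f x = 0" "\<And>x v. x \<notin> K \<Longrightarrow> dir_deriv v f x = 0"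
    using test_functionsE[OF assms(2)] by metis
  show ?thesis
    by (rule test_functionsI[OF smooth_wdbar_adj[OF assms(1) test_smooth[OF assms(2)]] K(1)])
      (simp add: wdbar_adj_def K)
qed

lemma test_D1:
  assumes "smooth \<phi>" "h \<in> test_functions" shows "D1 \<phi> h \<in> test_functions"
proof -
  obtain K where K: "compact K" "\<And>x. x \<notin> K \<Longrightarrow> h x = 0" "\<And>x v. x \<notin> K \<Longrightarrow> dir_deriv v h x = 0"
    using test_functionsE[OF assms(2)] by metis
  show ?thesis
  proof (rule test_functionsI[OF _ K(1)])
    show "smooth (D1 \<phi> h)"
      unfolding D1_def by (intro smooth_vec_lambda smooth_wdbar assms test_smooth)
  qed (simp add: D1_def wdbar_def dzbar_def K vec_eq_iff)
qed

lemma test_component: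
  fixes u :: "'a::euclidean_space \<Rightarrow> complex ^ 'n::finite"
  assumes "u \<in> test_functions" shows "(\<lambda>z. u z $ j) \<in> test_functions"
proof -
  obtain K where K: "compact K" "\<And>x. x \<notin> K \<Longrightarrow> u x = 0" using test_functionsE[OF assms] by metis
  show ?thesis
    by (rule test_functionsI[OF smooth_compose_linear[OF bounded_linear_vec_nth test_smooth[OF assms]] K(1)])
      (simp add: K)
qed

lemma test_D2:
  fixes u :: "('n::{finite,linorder}) form01"
  assumes "smooth \<phi>" "u \<in> test_functions" shows "D2 \<phi> u \<in> test_functions"
proof -
  obtain K where K: "compact K" "\<And>x. x \<notin> K \<Longrightarrow> u x = 0" using test_functionsE[OF assms(2)] by metis
  have d0: "dir_deriv v (\<lambda>w. u w $ j) x = 0" if x: "x \<notin> K" for v x j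
  proof -
    have "((\<lambda>_. 0) has_derivative (\<lambda>v. 0)) (at x)" by simp
    moreover have "open (- K)" by (intro open_Compl compact_imp_closed K)
    ultimately have "((\<lambda>w. u w $ j) has_derivative (\<lambda>v. 0)) (at x)"
      by (rule has_derivative_transform_within_open) (use x K in simp_all)
    from dir_deriv_eq[OF this] show ?thesis .
  qed
  have sw: "smooth (wdbar \<phi> k (\<lambda>w. u w $ j))" for k j
    by (rule smooth_wdbar[OF assms(1) test_smooth[OF test_component[OF assms(2)]]])
  show ?thesis
  proof (rule test_functionsI[OF _ K(1)])
    have "smooth (\<lambda>z. if k < j then wdbar \<phi> k (\<lambda>w. u w $ j) z - wdbar \<phi> j (\<lambda>w. u w $ k) z else 0)" for k j
      using smooth_diff[OF sw sw] smooth_const by (cases "k < j") simp_all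
    then show "smooth (D2 \<phi> u)"
      unfolding D2_def by (intro smooth_vec_lambda)
  qed (simp add: D2_def wdbar_def dzbar_def K(2) d0 vec_eq_iff)
qed

lemma wdbar_parts:
  assumes \<phi>: "smooth \<phi>" and w: "w \<in> test_functions" and f: "f \<in> test_functions"
  shows "(LINT z|lborel. wdbar \<phi> k w z * cnj (f z)) = (LINT z|lborel. w z * cnj (wdbar_adj \<phi> k f z))"
proof -
  let ?g = "\<lambda>z. w z * cnj (f z)"
  note sw = test_smooth[OF w] and sf = test_smooth[OF f]
  have g: "?g \<in> test_functions" by (rule test_cmult_smooth[OF w smooth_cnj[OF sf]])
  have id: "integrable lborel (dir_deriv v ?g)" for v
    by (rule test_integrable[OF test_dir_deriv[OF g]]) (auto intro: smooth_continuous_on smooth_dir_deriv test_smooth[OF g])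
  have eq: "wdbar \<phi> k w z * cnj (f z) = w z * cnj (wdbar_adj \<phi> k f z)
      + (dir_deriv (axis k 1) ?g z + \<i> * dir_deriv (axis k \<i>) ?g z) / 2" for z
    by (simp add: wdbar_def wdbar_adj_def dzbar_def dir_deriv_mult[OF sw smooth_cnj[OF sf]]
        dir_deriv_cnj[OF sf] field_simps)
  have i: "integrable lborel (\<lambda>z. w z * cnj (wdbar_adj \<phi> k f z))"
    by (rule test_integrable[OF w])
      (auto intro!: smooth_continuous_on smooth_mult smooth_cnj smooth_wdbar_adj \<phi> sw sf)
  show ?thesis
    unfolding eq using i id integral_dir_deriv_eq_0[OF g] by simp
qed

lemma D1_adjoint_single:
  assumes \<phi>: "smooth \<phi>" and f: "f \<in> test_functions"
  shows "(\<lambda>z. axis k (f z), wdbar_adj \<phi> k f) \<in> D1_adjoint \<phi>"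
proof -
  obtain K where K: "compact K" "\<And>x. x \<notin> K \<Longrightarrow> f x = 0" using test_functionsE[OF f] by metis
  have "bounded_linear (axis k :: complex \<Rightarrow> _)"
    by (intro linear_conv_bounded_linear[THEN iffD1] linearI) (auto simp: axis_def vec_eq_iff)
  then have "(\<lambda>z. axis k (f z)) \<in> test_functions"
    by (rule test_functionsI[OF smooth_compose_linear[OF _ test_smooth[OF f]] K(1)])
      (simp add: K axis_def vec_eq_iff)
  moreover have "inner01 (D1 \<phi> w) (\<lambda>z. axis k (f z)) = inner00 w (wdbar_adj \<phi> k f)"
    if "w \<in> test_functions" for w
  proof -
    have "(\<Sum>j\<in>UNIV. D1 \<phi> w z $ j * cnj (axis k (f z) $ j)) = wdbar \<phi> k w z * cnj (f z)" for z
      by (simp add: D1_def axis_def if_distrib[of cnj] if_distrib[of "\<lambda>x. _ * x"] cong: if_cong)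
    then show ?thesis
      unfolding inner01_def inner00_def using wdbar_parts[OF \<phi> that f] by simp
  qed
  ultimately show ?thesis unfolding D1_adjoint_def using test_wdbar_adj[OF \<phi> f] by simp
qed

lemma inner_complex_Re: "x \<bullet> y = Re (x * cnj y)" for x y :: complex
  by (simp add: inner_complex_def)

lemma test_continuous: "f \<in> test_functions \<Longrightarrow> continuous_on UNIV f"
  by (rule smooth_continuous_on[OF test_smooth])

lemma Re_inner00:
  assumes "u \<in> test_functions" "v \<in> test_functions"
  shows "Re (inner00 u v) = ip u v"
proof -
  have "integrable lborel (\<lambda>z. u z * cnj (v z))"
    by (rule test_integrable[OF assms(1)])
      (auto intro!: continuous_on_mult continuous_on_cnj test_continuous[OF assms(1)] test_continuous[OF assms(2)])
  then show ?thesis unfolding inner00_def ip_def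
    by (simp add: integral_Re[symmetric] inner_complex_Re)
qed

lemma Re_inner01:
  assumes "u \<in> test_functions" "v \<in> test_functions"
  shows "Re (inner01 u v) = ip u v"
proof -
  have "integrable lborel (\<lambda>z. \<Sum>j\<in>UNIV. u z $ j * cnj (v z $ j))"
    by (rule test_integrable[OF assms(1)])
      (auto intro!: continuous_on_sum continuous_on_mult continuous_on_cnj continuous_on_component test_continuous[OF assms(1)] test_continuous[OF assms(2)])
  then show ?thesis unfolding inner01_def ip_def
    by (simp add: integral_Re[symmetric] inner_vec_def inner_complex_Re)
qed

lemma Re_inner02:
  assumes "u \<in> test_functions" "v \<in> test_functions"
  shows "Re (inner02 u v) = ip u v"
proof -
  have "integrable lborel (\<lambda>z. \<Sum>k\<in>UNIV. \<Sum>j\<in>UNIV. u z $ k $ j * cnj (v z $ k $ j))"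
    by (rule test_integrable[OF assms(1)])
      (auto intro!: continuous_on_sum continuous_on_mult continuous_on_cnj continuous_on_component test_continuous[OF assms(1)] test_continuous[OF assms(2)])
  then show ?thesis unfolding inner02_def ip_def
    by (simp add: integral_Re[symmetric] inner_vec_def inner_complex_Re)
qed

text \<open>The energy identity \<open>\<langle>\<box> v, u\<rangle> = \<langle>D\<^sub>1\<^sup>* v, D\<^sub>1\<^sup>* u\<rangle> + \<langle>D\<^sub>2 v, D\<^sub>2 u\<rangle>\<close> only moves adjoints, so that \<open>\<box>\<close> need
  not be applied to \<open>u\<close>.\<close>

lemma box01_test_energy:
  fixes u :: "('n::{finite,linorder}) form01"
  assumes \<phi>: "smooth \<phi>" and v: "(v, h) \<in> D1_adjoint \<phi>" "(D2 \<phi> v, k) \<in> D2_adjoint \<phi>"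
    and u: "(u, hu) \<in> D1_adjoint \<phi>"
  shows "ip (\<lambda>z. D1 \<phi> h z + k z) u = ip h hu + ip (D2 \<phi> v) (D2 \<phi> u)"
proof -
  have t: "v \<in> test_functions" "h \<in> test_functions" "k \<in> test_functions" "u \<in> test_functions" "hu \<in> test_functions"
    using v u by (auto simp: D1_adjoint_def D2_adjoint_def)
  have "ip (D1 \<phi> h) u = Re (inner01 (D1 \<phi> h) u)" using Re_inner01[OF test_D1[OF \<phi> t(2)] t(4)] by simp
  also have "inner01 (D1 \<phi> h) u = inner00 h hu" using u t(2) by (simp add: D1_adjoint_def)
  also have "Re \<dots> = ip h hu" by (rule Re_inner00[OF t(2,5)])
  finally have 1: "ip (D1 \<phi> h) u = ip h hu" .
  have "ip u k = Re (inner01 u k)" using Re_inner01[OF t(4,3)] by simp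
  also have "inner01 u k = inner02 (D2 \<phi> u) (D2 \<phi> v)" using v(2) t(4) by (simp add: D2_adjoint_def)
  also have "Re \<dots> = ip (D2 \<phi> u) (D2 \<phi> v)" by (rule Re_inner02[OF test_D2[OF \<phi> t(4)] test_D2[OF \<phi> t(1)]])
  finally have 2: "ip k u = ip (D2 \<phi> v) (D2 \<phi> u)" by (simp add: ip_commute)
  have "ip (\<lambda>z. D1 \<phi> h z + k z) u = ip (D1 \<phi> h) u + ip k u"
    by (rule ip_add_left) (intro test_L2 test_D1 \<phi> t)+
  with 1 2 show ?thesis by simp
qed

lemma box01_test_L2:
  assumes "smooth \<phi>" "(v, f) \<in> box01_test \<phi>" shows "v \<in> L2_space" "f \<in> L2_space"
proof -
  obtain h k where hk: "f = (\<lambda>z. D1 \<phi> h z + k z)" "v \<in> test_functions" "h \<in> test_functions" "k \<in> test_functions"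
    using assms(2) by (auto simp: box01_test_def D1_adjoint_def D2_adjoint_def)
  then show "v \<in> L2_space" "f \<in> L2_space"
    using L2_space_add[OF test_L2[OF test_D1[OF assms(1) hk(3)]] test_L2[OF hk(4)]] test_L2 by auto
qed

lemma box01_test_cauchy_schwarz:
  fixes u :: "('n::{finite,linorder}) form01"
  assumes \<phi>: "smooth \<phi>" and v: "(v, f) \<in> box01_test \<phi>" and w: "(w, g) \<in> box01_test \<phi>"
    and u: "(u, hu) \<in> D1_adjoint \<phi>" and M: "ip hu hu + ip (D2 \<phi> u) (D2 \<phi> u) \<le> M"
  shows "(ip (\<lambda>x. f x - g x) u)\<^sup>2 \<le> M * ip (\<lambda>x. f x - g x) (\<lambda>x. v x - w x)"
proof -
  obtain h k where hk: "f = (\<lambda>z. D1 \<phi> h z + k z)" "(v, h) \<in> D1_adjoint \<phi>" "(D2 \<phi> v, k) \<in> D2_adjoint \<phi>"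
    using v by (auto simp: box01_test_def)
  obtain h' k' where hk': "g = (\<lambda>z. D1 \<phi> h' z + k' z)" "(w, h') \<in> D1_adjoint \<phi>" "(D2 \<phi> w, k') \<in> D2_adjoint \<phi>"
    using w by (auto simp: box01_test_def)
  have t: "v \<in> test_functions" "h \<in> test_functions" "w \<in> test_functions" "h' \<in> test_functions"
      "u \<in> test_functions" "hu \<in> test_functions"
    using hk hk' u by (auto simp: D1_adjoint_def)
  note L = test_L2[OF t(2)] test_L2[OF t(4)] test_L2[OF t(6)] test_L2[OF t(5)]
    test_L2[OF test_D2[OF \<phi> t(1)]] test_L2[OF test_D2[OF \<phi> t(3)]] test_L2[OF test_D2[OF \<phi> t(5)]]
    box01_test_L2[OF \<phi> v] box01_test_L2[OF \<phi> w]
  let ?H = "\<lambda>x. h x - h' x" and ?D = "\<lambda>x. D2 \<phi> v x - D2 \<phi> w x"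
  have HD: "?H \<in> L2_space" "?D \<in> L2_space" using L by (auto intro: L2_space_diff)
  note E = box01_test_energy[OF \<phi> hk(2,3), folded hk(1)] and E' = box01_test_energy[OF \<phi> hk'(2,3), folded hk'(1)]
  have Fu: "ip (\<lambda>x. f x - g x) u = ip ?H hu + ip ?D (D2 \<phi> u)"
    using L E[OF u] E'[OF u] by (simp add: ip_diff_left)
  have FV: "ip (\<lambda>x. f x - g x) (\<lambda>x. v x - w x) = ip ?H ?H + ip ?D ?D"
    using L HD E[OF hk(2)] E[OF hk'(2)] E'[OF hk(2)] E'[OF hk'(2)]
    by (simp add: ip_diff_left ip_diff_right L2_space_diff)
  define a b c d where "a = L2_norm ?H" and "b = L2_norm hu" and "c = L2_norm ?D" and "d = L2_norm (D2 \<phi> u)"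
  have "\<bar>ip ?H hu + ip ?D (D2 \<phi> u)\<bar> \<le> a * b + c * d"
    using ip_cauchy_schwarz[OF HD(1) L(3)] ip_cauchy_schwarz[OF HD(2) L(7)] unfolding a_def b_def c_def d_def by linarith
  then have "(ip (\<lambda>x. f x - g x) u)\<^sup>2 \<le> (a * b + c * d)\<^sup>2"
    unfolding Fu using power_mono[of "\<bar>ip ?H hu + ip ?D (D2 \<phi> u)\<bar>" "a * b + c * d" 2] by simp
  also have "\<dots> \<le> (b\<^sup>2 + d\<^sup>2) * (a\<^sup>2 + c\<^sup>2)"
    using zero_le_power2[of "a * d - b * c"] by (simp add: power2_eq_square algebra_simps)
  also have "\<dots> \<le> M * (a\<^sup>2 + c\<^sup>2)"
    using M by (intro mult_right_mono) (auto simp: b_def d_def L2_norm_power2)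
  finally show ?thesis unfolding FV by (simp add: a_def c_def L2_norm_power2)
qed

text \<open>Both sides involve \<open>v\<close>, \<open>f\<close>, \<open>w\<close>, \<open>g\<close> only through inner products, hence pass to the limit in
  the graph closure, although \<open>D\<^sub>1\<^sup>* v\<close> and \<open>D\<^sub>2 v\<close> have no meaning there yet.\<close>

lemma box01_cauchy_schwarz:
  fixes u :: "('n::{finite,linorder}) form01"
  assumes \<phi>: "smooth \<phi>" and v: "(v, f) \<in> box01 \<phi>" and w: "(w, g) \<in> box01 \<phi>"
    and u: "(u, hu) \<in> D1_adjoint \<phi>" and M: "ip hu hu + ip (D2 \<phi> u) (D2 \<phi> u) \<le> M"
  shows "(ip (\<lambda>x. f x - g x) u)\<^sup>2 \<le> M * ip (\<lambda>x. f x - g x) (\<lambda>x. v x - w x)"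
proof -
  obtain V F where V: "\<And>k::nat. (V k, F k) \<in> box01_test \<phi>" "(\<lambda>k. L2_dist (V k) v) \<longlonglongrightarrow> 0"
    "(\<lambda>k. L2_dist (F k) f) \<longlonglongrightarrow> 0" and vf: "v \<in> L2_space" "f \<in> L2_space"
    using v unfolding box01_def L2_graph_closure_def by blast
  obtain W G where W: "\<And>k::nat. (W k, G k) \<in> box01_test \<phi>" "(\<lambda>k. L2_dist (W k) w) \<longlonglongrightarrow> 0"
    "(\<lambda>k. L2_dist (G k) g) \<longlonglongrightarrow> 0" and wg: "w \<in> L2_space" "g \<in> L2_space"
    using w unfolding box01_def L2_graph_closure_def by blast
  have uL: "u \<in> L2_space" using u test_L2 by (auto simp: D1_adjoint_def)
  note VL = box01_test_L2[OF \<phi> V(1)] and WL = box01_test_L2[OF \<phi> W(1)]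
  have c: "(\<lambda>k. L2_dist u u) \<longlonglongrightarrow> 0" by (simp add: L2_dist_def)
  have lim: "(\<lambda>k. ip (\<lambda>x. F k x - G k x) u) \<longlonglongrightarrow> ip (\<lambda>x. f x - g x) u"
  proof -
    have "(\<lambda>k. ip (F k) u - ip (G k) u) \<longlonglongrightarrow> ip f u - ip g u"
      by (intro tendsto_diff ip_tendsto) (use VL WL vf wg V W uL c in auto)
    then show ?thesis using VL WL vf wg uL by (simp add: ip_diff_left)
  qed
  have lim2: "(\<lambda>k. ip (\<lambda>x. F k x - G k x) (\<lambda>x. V k x - W k x)) \<longlonglongrightarrow> ip (\<lambda>x. f x - g x) (\<lambda>x. v x - w x)"
  proof -
    have "(\<lambda>k. (ip (F k) (V k) - ip (F k) (W k)) - (ip (G k) (V k) - ip (G k) (W k)))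
       \<longlonglongrightarrow> (ip f v - ip f w) - (ip g v - ip g w)"
      by (intro tendsto_diff ip_tendsto) (use VL WL vf wg V W in auto)
    then show ?thesis using VL WL vf wg by (simp add: ip_diff_left ip_diff_right L2_space_diff)
  qed
  show ?thesis
  proof (rule LIMSEQ_le[OF tendsto_power[OF lim] tendsto_mult[OF tendsto_const lim2]])
    show "\<exists>N. \<forall>n\<ge>N. (ip (\<lambda>x. F n x - G n x) u)\<^sup>2 \<le> M * ip (\<lambda>x. F n x - G n x) (\<lambda>x. V n x - W n x)"
      using box01_test_cauchy_schwarz[OF \<phi> V(1) W(1) u M] by blast
  qed
qed

section \<open>A smooth bump function\<close>

text \<open>The powers of \<open>1 / x\<close> make the family closed under differentiation.\<close>

definition flat :: "nat \<Rightarrow> real \<Rightarrow> real" where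
  "flat n x = (if x > 0 then (1 / x) ^ n * exp (- (1 / x)) else 0)"

lemma power_le_exp: "0 \<le> y \<Longrightarrow> 0 < m \<Longrightarrow> y ^ m \<le> real m ^ m * exp y"
proof -
  assume y: "0 \<le> y" and m: "0 < m"
  have "y / real m \<le> exp (y / real m)" using exp_ge_add_one_self[of "y / real m"] by linarith
  then have "(y / real m) ^ m \<le> exp (y / real m) ^ m" using y by (intro power_mono) auto
  also have "\<dots> = exp y" using m by (simp add: exp_of_nat_mult[symmetric])
  finally show ?thesis using m by (simp add: power_divide field_simps)
qed

lemma flat_le: "\<bar>flat n x\<bar> \<le> real (n + 2) ^ (n + 2) * x\<^sup>2"
proof (cases "x > 0")
  case True
  have "(1 / x) ^ (n + 2) \<le> real (n + 2) ^ (n + 2) * exp (1 / x)"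
    using True by (intro power_le_exp) auto
  then have "(1 / x) ^ (n + 2) * exp (- (1 / x)) \<le> real (n + 2) ^ (n + 2)"
    by (simp only: exp_minus divide_inverse[symmetric] pos_divide_le_eq[OF exp_gt_zero])
  then have "((1 / x) ^ (n + 2) * exp (- (1 / x))) * x\<^sup>2 \<le> real (n + 2) ^ (n + 2) * x\<^sup>2"
    by (rule mult_right_mono) simp
  moreover have "((1 / x) ^ (n + 2) * exp (- (1 / x))) * x\<^sup>2 = flat n x"
    using True by (simp add: flat_def power_add power2_eq_square)
  moreover have "0 \<le> flat n x" using True by (simp add: flat_def)
  ultimately show ?thesis by linarith
qed (simp add: flat_def)

lemma flat_has_derivative:
  "(flat n has_real_derivative (flat (n + 2) x - real n * flat (n + 1) x)) (at x)"
proof -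
  consider "x > 0" | "x < 0" | "x = 0" by linarith
  then show ?thesis
  proof cases
    case 1
    have "((\<lambda>x. (1 / x) ^ n * exp (- (1 / x))) has_real_derivative
        (real n * (1 / x) ^ (n - 1) * (- 1 / x\<^sup>2)) * exp (- (1 / x))
          + (1 / x) ^ n * (exp (- (1 / x)) * (1 / x\<^sup>2))) (at x)"
      using 1 by (auto intro!: derivative_eq_intros simp: power2_eq_square)
    moreover have "(real n * (1 / x) ^ (n - 1) * (- 1 / x\<^sup>2)) * exp (- (1 / x))
          + (1 / x) ^ n * (exp (- (1 / x)) * (1 / x\<^sup>2)) = flat (n + 2) x - real n * flat (n + 1) x"
      using 1 by (cases n) (simp_all add: flat_def power_add power2_eq_square field_simps)
    ultimately have "((\<lambda>x. (1 / x) ^ n * exp (- (1 / x))) has_real_derivative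
        flat (n + 2) x - real n * flat (n + 1) x) (at x)" by simp
    then show ?thesis
      by (rule has_field_derivative_transform_within_open[where S = "{0<..}"]) (use 1 in \<open>auto simp: flat_def\<close>)
  next
    case 2
    have "((\<lambda>x. 0) has_real_derivative 0) (at x)" by simp
    then have "(flat n has_real_derivative 0) (at x)"
      by (rule has_field_derivative_transform_within_open[where S = "{..<0}"]) (use 2 in \<open>auto simp: flat_def\<close>)
    then show ?thesis using 2 by (simp add: flat_def)
  next
    case 3
    let ?c = "real (n + 2) ^ (n + 2)"
    have "((\<lambda>h. (flat n (0 + h) - flat n 0) / h) \<longlongrightarrow> 0) (at 0)"
    proof (rule Lim_null_comparison)
      have "norm ((flat n (0 + h) - flat n 0) / h) \<le> ?c * \<bar>h\<bar>" for h
      proof (cases "h = 0")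
        case False
        then show ?thesis using flat_le[of n h]
          by (simp add: flat_def[of n 0] divide_le_eq power2_eq_square abs_mult[symmetric] mult.assoc del: of_nat_add)
      qed simp
      then show "\<forall>\<^sub>F h in at 0. norm ((flat n (0 + h) - flat n 0) / h) \<le> ?c * \<bar>h\<bar>" by simp
      show "((\<lambda>h. ?c * \<bar>h\<bar>) \<longlongrightarrow> 0) (at 0)"
        by (rule tendsto_eq_intros refl tendsto_ident_at | simp)+
    qed
    then show ?thesis using 3 by (simp add: DERIV_def flat_def)
  qed
qed

lemma smooth_flat: "smooth (flat n)"
proof -
  have "Ck k (flat n)" for k
  proof (induction k arbitrary: n)
    case 0
    have "isCont (flat n) x" for x using DERIV_isCont[OF flat_has_derivative] .
    then show ?case by (simp add: continuous_at_imp_continuous_on)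
  next
    case (Suc k)
    show ?case
    proof (rule Ck_SucI)
      show "(flat n has_derivative (*) (flat (n + 2) x - real n * flat (n + 1) x)) (at x)" for x
        using flat_has_derivative unfolding has_field_derivative_def .
      fix v :: real
      have "(\<lambda>x. (flat (n + 2) x - real n * flat (n + 1) x) * v)
          = (\<lambda>x. v *\<^sub>R flat (n + 2) x + (- real n * v) *\<^sub>R flat (n + 1) x)"
        by (auto simp: algebra_simps)
      then show "Ck k (\<lambda>x. (flat (n + 2) x - real n * flat (n + 1) x) * v)"
        using Ck_add[OF Ck_compose_linear[OF bounded_linear_scaleR_right Suc, of v "n + 2"]
            Ck_compose_linear[OF bounded_linear_scaleR_right Suc, of "- real n * v" "n + 1"]] by simp
    qed
  qed
  then show ?thesis by (simp add: smooth_def)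
qed

definition bump :: "real \<Rightarrow> complex \<Rightarrow> real" where
  "bump \<rho> \<zeta> = flat 0 (\<rho>\<^sup>2 - \<zeta> \<bullet> \<zeta>)"

lemma smooth_bump: "smooth (bump \<rho>)"
  unfolding bump_def
  by (rule smooth_compose[OF smooth_flat smooth_diff[OF smooth_const smooth_inner[OF smooth_ident smooth_ident]]])

lemma bump_bounds: "0 \<le> bump \<rho> \<zeta>" "bump \<rho> \<zeta> \<le> 1"
  by (auto simp: bump_def flat_def)

lemma bump_eq_0: "0 < \<rho> \<Longrightarrow> \<rho> \<le> norm \<zeta> \<Longrightarrow> bump \<rho> \<zeta> = 0"
  using power_mono[of \<rho> "norm \<zeta>" 2] by (simp add: bump_def flat_def power2_norm_eq_inner)

lemma test_bump: "0 < \<rho> \<Longrightarrow> bump \<rho> \<in> test_functions"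
  by (rule test_functionsI[OF smooth_bump compact_cball[of 0 \<rho>]]) (auto intro: bump_eq_0)

lemma bump_ge:
  assumes "0 < \<rho>" "norm \<zeta> \<le> \<rho> / 2"
  shows "exp (- (4 / (3 * \<rho>\<^sup>2))) \<le> bump \<rho> \<zeta>"
proof -
  have "\<zeta> \<bullet> \<zeta> \<le> (\<rho> / 2)\<^sup>2"
    using power_mono[OF assms(2), of 2] by (simp add: power2_norm_eq_inner)
  then have a: "3 * \<rho>\<^sup>2 / 4 \<le> \<rho>\<^sup>2 - \<zeta> \<bullet> \<zeta>" by (simp add: power_divide)
  moreover have p: "0 < 3 * \<rho>\<^sup>2 / 4" using assms(1) by simp
  moreover have q: "0 < \<rho>\<^sup>2 - \<zeta> \<bullet> \<zeta>" using a p by linarith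
  ultimately have "1 / (\<rho>\<^sup>2 - \<zeta> \<bullet> \<zeta>) \<le> 1 / (3 * \<rho>\<^sup>2 / 4)"
    by (intro divide_left_mono mult_pos_pos) simp_all
  then have "exp (- (4 / (3 * \<rho>\<^sup>2))) \<le> exp (- (1 / (\<rho>\<^sup>2 - \<zeta> \<bullet> \<zeta>)))" by simp
  then show ?thesis using q by (simp add: bump_def flat_def)
qed

section \<open>Localized approximate zero modes in one variable\<close>

definition dbar :: "(complex \<Rightarrow> complex) \<Rightarrow> complex \<Rightarrow> complex" where
  "dbar f = (\<lambda>z. (dir_deriv 1 f z + \<i> * dir_deriv \<i> f z) / 2)"

text \<open>The operator \<open>\<partial>/\<partial>zbar + \<partial>\<psi>/\<partial>zbar\<close> and its formal adjoint.\<close>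

definition annih :: "(complex \<Rightarrow> real) \<Rightarrow> (complex \<Rightarrow> complex) \<Rightarrow> complex \<Rightarrow> complex" where
  "annih \<psi> f = (\<lambda>z. dbar f z + dbar (\<lambda>w. complex_of_real (\<psi> w)) z * f z)"

definition creat :: "(complex \<Rightarrow> real) \<Rightarrow> (complex \<Rightarrow> complex) \<Rightarrow> complex \<Rightarrow> complex" where
  "creat \<psi> f = (\<lambda>z. - (dir_deriv 1 f z - \<i> * dir_deriv \<i> f z) / 2
      + cnj (dbar (\<lambda>w. complex_of_real (\<psi> w)) z) * f z)"

lemma dir_deriv_uminus:
  assumes "smooth f" shows "dir_deriv v (\<lambda>x. - f x) z = - dir_deriv v f z"
  using dir_deriv_eq[OF has_derivative_minus[OF smooth_has_derivative[OF assms]]] .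

text \<open>Complex conjugation together with \<open>\<psi> \<mapsto> - \<psi>\<close> exchanges the two operators, and it reverses the
  sign of the field.\<close>

lemma creat_eq_annih:
  assumes "smooth \<psi>" "smooth f"
  shows "creat \<psi> (\<lambda>z. cnj (f z)) z = - cnj (annih (\<lambda>z. - \<psi> z) f z)"
proof -
  have "dir_deriv v (\<lambda>w. complex_of_real (- \<psi> w)) z = - complex_of_real (dir_deriv v \<psi> z)" for v
    using dir_deriv_of_real[OF smooth_uminus[OF assms(1)], of v z] by (simp add: dir_deriv_uminus[OF assms(1)])
  then show ?thesis
    unfolding creat_def annih_def dbar_def dir_deriv_cnj[OF assms(2)] dir_deriv_of_real[OF assms(1)]
    by (simp add: field_simps)
qed

lemma magnetic_field_eq:
  "magnetic_field \<psi> z = dir_deriv 1 (dir_deriv 1 \<psi>) z + dir_deriv \<i> (dir_deriv \<i> \<psi>) z"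
  by (simp add: magnetic_field_def numeral_2_eq_2)

lemma magnetic_field_uminus:
  assumes "smooth \<psi>" shows "magnetic_field (\<lambda>z. - \<psi> z) z = - magnetic_field \<psi> z"
proof -
  have "dir_deriv v (\<lambda>z. - \<psi> z) = (\<lambda>z. - dir_deriv v \<psi> z)" for v
    using dir_deriv_uminus[OF assms] by auto
  then show ?thesis
    by (simp add: magnetic_field_eq dir_deriv_uminus[OF smooth_dir_deriv[OF assms]])
qed

lemma smooth_magnetic_field: "smooth \<psi> \<Longrightarrow> smooth (magnetic_field \<psi>)"
  unfolding magnetic_field_eq[abs_def] by (intro smooth_add smooth_dir_deriv)

lemma has_integral_radial:
  fixes f :: "complex \<Rightarrow> real"
  assumes f: "smooth f"
  shows "((\<lambda>t. f (x0 + t *\<^sub>R \<zeta>) + t * dir_deriv \<zeta> f (x0 + t *\<^sub>R \<zeta>)) has_integral f (x0 + \<zeta>)) {0..1}"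
proof -
  have "((\<lambda>t. t * f (x0 + t *\<^sub>R \<zeta>)) has_vector_derivative
      (f (x0 + t *\<^sub>R \<zeta>) + t * dir_deriv \<zeta> f (x0 + t *\<^sub>R \<zeta>))) (at t within {0..1})" for t
  proof -
    have l: "linear (\<lambda>w. dir_deriv w f (x0 + t *\<^sub>R \<zeta>))"
      using smooth_has_derivative[OF f] has_derivative_linear by blast
    have "((\<lambda>t. f (x0 + t *\<^sub>R \<zeta>)) has_derivative (\<lambda>h. dir_deriv (h *\<^sub>R \<zeta>) f (x0 + t *\<^sub>R \<zeta>))) (at t)"
      by (rule dir_deriv_compose[OF smooth_Ck[OF f]]) (auto intro!: derivative_eq_intros)
    from has_derivative_mult[OF has_derivative_ident this]
    have "((\<lambda>t. t * f (x0 + t *\<^sub>R \<zeta>)) has_vector_derivative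
      (f (x0 + t *\<^sub>R \<zeta>) + t * dir_deriv \<zeta> f (x0 + t *\<^sub>R \<zeta>))) (at t)"
      by (simp add: has_vector_derivative_def linear_cmul[OF l] algebra_simps)
    then show ?thesis by (rule has_vector_derivative_at_within)
  qed
  from fundamental_theorem_of_calculus[OF _ this] show ?thesis by simp
qed

text \<open>The magnetic potential \<open>A = (- \<partial>\<^sub>y \<psi>, \<partial>\<^sub>x \<psi>)\<close> is gauge equivalent to a potential that depends
  on \<open>\<psi>\<close> only through the field \<open>B\<close>, with no contribution of the harmonic part of \<open>\<psi>\<close>: in the
  radial gauge \<open>\<theta>(z) = \<integral> A(x\<^sub>0 + t (z - x\<^sub>0)) \<bullet> (z - x\<^sub>0) dt\<close>, \<open>A - \<nabla>\<theta>\<close> is a mean of \<open>B\<close> times the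
  rotated vector \<open>i (z - x\<^sub>0)\<close>.\<close>

lemma radial_gauge:
  fixes \<psi> :: "complex \<Rightarrow> real" and x0 :: complex
  assumes \<psi>: "smooth \<psi>"
  defines "b \<equiv> \<lambda>z. integral {0..1} (\<lambda>t. t * magnetic_field \<psi> (x0 + t *\<^sub>R (z - x0)))"
  obtains \<theta> :: "complex \<Rightarrow> real" where "smooth \<theta>"
    "\<And>z. dir_deriv 1 \<theta> z = - dir_deriv \<i> \<psi> z + b z * Im (z - x0)"
    "\<And>z. dir_deriv \<i> \<theta> z = dir_deriv 1 \<psi> z - b z * Re (z - x0)"
proof -
  let ?px = "dir_deriv 1 \<psi>" and ?py = "dir_deriv \<i> \<psi>" and ?B = "magnetic_field \<psi>"
  let ?P = "\<lambda>p. x0 + fst p *\<^sub>R (snd p - x0)"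
  define q :: "real \<times> complex \<Rightarrow> real" where
    "q p = - ?py (?P p) * Re (snd p - x0) + ?px (?P p) * Im (snd p - x0)" for p
  define \<theta> where "\<theta> z = integral {0..1} (\<lambda>t. q (t, z))" for z
  note s1 = smooth_dir_deriv[OF \<psi>]
  have P: "smooth ?P"
    by (intro smooth_add smooth_const smooth_scaleR smooth_diff smooth_linear bounded_linear_fst bounded_linear_snd)
  have lin: "smooth (\<lambda>p. T (snd p - x0))" if "bounded_linear T" for T :: "complex \<Rightarrow> real"
    by (intro smooth_compose_linear[OF that] smooth_diff smooth_const smooth_linear bounded_linear_snd)
  have q: "smooth q" unfolding q_def
    using smooth_add[OF smooth_mult[OF smooth_uminus[OF smooth_compose[OF s1 P]] lin[OF bounded_linear_Re]]
       smooth_mult[OF smooth_compose[OF s1 P] lin[OF bounded_linear_Im]]] .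
  have \<theta>: "smooth \<theta>" unfolding \<theta>_def by (rule smooth_param_integral[OF q])
  have cB: "continuous_on {0..1} (\<lambda>t. t * ?B (x0 + t *\<^sub>R \<zeta>))" for \<zeta>
    by (rule continuous_on_mult[OF continuous_on_id],
        rule continuous_on_compose2[OF smooth_continuous_on[OF smooth_magnetic_field[OF \<psi>], of UNIV]])
      (auto intro!: continuous_on_add continuous_on_scaleR continuous_on_const continuous_on_id)
  have D: "dir_deriv e \<theta> z = integral {0..1} (\<lambda>t. dir_deriv (0, e) q (t, z))" for e z
    unfolding \<theta>_def using dir_deriv_eq[OF param_integral_has_derivative[OF smooth_Ck[OF q]]] .
  have Dq: "dir_deriv (0, e) q (t, z) =
      t * (- dir_deriv e ?py (x0 + t *\<^sub>R (z - x0)) * Re (z - x0) + dir_deriv e ?px (x0 + t *\<^sub>R (z - x0)) * Im (z - x0))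
      - ?py (x0 + t *\<^sub>R (z - x0)) * Re e + ?px (x0 + t *\<^sub>R (z - x0)) * Im e" for e t z
  proof -
    define y where "y = x0 + t *\<^sub>R (z - x0)"
    have Py: "?P (t, z) = y" by (simp add: y_def)
    have l: "linear (\<lambda>w. dir_deriv w f y)" if "smooth f" for f :: "complex \<Rightarrow> real"
      using smooth_has_derivative[OF that] has_derivative_linear by blast
    have d: "((\<lambda>p. f (?P p)) has_derivative (\<lambda>h. dir_deriv (t *\<^sub>R snd h + fst h *\<^sub>R (z - x0)) f y)) (at (t, z))"
      if "smooth f" for f :: "complex \<Rightarrow> real"
    proof -
      have "(?P has_derivative (\<lambda>h. t *\<^sub>R snd h + fst h *\<^sub>R (z - x0))) (at (t, z))"
        by (auto intro!: derivative_eq_intros)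
      from dir_deriv_compose[OF smooth_Ck[OF that] this] show ?thesis unfolding Py .
    qed
    have m: "((\<lambda>p. T (snd p - x0)) has_derivative (\<lambda>h. T (snd h))) (at (t, z))" if "bounded_linear T"
      for T :: "complex \<Rightarrow> real"
    proof -
      have "((\<lambda>p. snd p - x0) has_derivative snd) (at (t, z))"
        by (auto intro!: derivative_eq_intros)
      from bounded_linear.has_derivative[OF that this] show ?thesis .
    qed
    have "(q has_derivative (\<lambda>h. (- ?py y * Re (snd h) + - dir_deriv (t *\<^sub>R snd h + fst h *\<^sub>R (z - x0)) ?py y * Re (snd (t, z) - x0))
       + (?px y * Im (snd h) + dir_deriv (t *\<^sub>R snd h + fst h *\<^sub>R (z - x0)) ?px y * Im (snd (t, z) - x0)))) (at (t, z))"
      unfolding q_def Py[symmetric]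
      by (intro has_derivative_add has_derivative_mult has_derivative_minus d[folded Py] s1 m bounded_linear_Re bounded_linear_Im)
    from dir_deriv_eq[OF this, of "(0, e)"] show ?thesis
      unfolding y_def[symmetric] by (simp add: linear_cmul[OF l[OF s1]] algebra_simps)
  qed
  have main: "dir_deriv e \<theta> z = \<alpha> z + c * b z"
    if \<alpha>: "\<And>z. \<alpha> z = - ?py z * Re e + ?px z * Im e"
      and c: "\<And>y. - dir_deriv e ?py y * Re (z - x0) + dir_deriv e ?px y * Im (z - x0)
          = - dir_deriv (z - x0) ?py y * Re e + dir_deriv (z - x0) ?px y * Im e + c * ?B y"
    for e z \<alpha> c
  proof -
    let ?f = "\<lambda>t. x0 + t *\<^sub>R (z - x0)"
    have 1: "((\<lambda>t. (?py (?f t) + t * dir_deriv (z - x0) ?py (?f t)) * (- Re e)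
        + (?px (?f t) + t * dir_deriv (z - x0) ?px (?f t)) * Im e) has_integral ?py z * (- Re e) + ?px z * Im e) {0..1}"
      using has_integral_add[OF has_integral_mult_left[OF has_integral_radial[OF s1[of \<i>], of x0 "z - x0"], of "- Re e"]
        has_integral_mult_left[OF has_integral_radial[OF s1[of 1], of x0 "z - x0"], of "Im e"]] by simp
    have 2: "((\<lambda>t. c * (t * ?B (?f t))) has_integral c * b z) {0..1}"
      unfolding b_def by (intro has_integral_mult_right integrable_integral integrable_continuous_interval cB)
    have "dir_deriv (0, e) q (t, z) = ((?py (?f t) + t * dir_deriv (z - x0) ?py (?f t)) * (- Re e)
        + (?px (?f t) + t * dir_deriv (z - x0) ?px (?f t)) * Im e) + c * (t * ?B (?f t))" for t
      unfolding Dq c by (simp add: algebra_simps)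
    then have "((\<lambda>t. dir_deriv (0, e) q (t, z)) has_integral (?py z * (- Re e) + ?px z * Im e) + c * b z) {0..1}"
      using has_integral_add[OF 1 2] by simp
    then show ?thesis unfolding D \<alpha> by (simp add: integral_unique)
  qed
  show ?thesis
  proof (rule that[OF \<theta>])
    note ex = dir_deriv_complex[OF s1, of "_ - x0"]
    show "dir_deriv 1 \<theta> z = - ?py z + b z * Im (z - x0)" for z
      using main[of "\<lambda>z. - ?py z" 1 z "Im (z - x0)"] by (simp add: ex magnetic_field_eq algebra_simps)
    show "dir_deriv \<i> \<theta> z = ?px z - b z * Re (z - x0)" for z
      using main[of "?px" \<i> z "- Re (z - x0)"] by (simp add: ex magnetic_field_eq algebra_simps)
  qed
qed


lemma integral_scale2:
  fixes f :: "complex \<Rightarrow> real"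
  assumes f: "f \<in> borel_measurable borel"
  shows "integral\<^sup>L lborel f = 4 * (LINT z|lborel. f (t + 2 *\<^sub>R z))"
proof -
  have m: "(\<lambda>z. t + 2 *\<^sub>R z) \<in> borel_measurable (lborel :: complex measure)"
    by (auto intro!: borel_measurable_continuous_onI continuous_on_add continuous_on_scaleR continuous_on_const continuous_on_id)
  have "lborel = density (distr lborel borel (\<lambda>z. t + 2 *\<^sub>R z)) (\<lambda>_. ennreal (4 :: real))"
    using lborel_affine[of 2 t] by simp
  then have "integral\<^sup>L lborel f = integral\<^sup>L (density (distr lborel borel (\<lambda>z. t + 2 *\<^sub>R z)) (\<lambda>_. ennreal (4 :: real))) f"
    by (rule arg_cong)
  also have "\<dots> = (\<integral>z. 4 *\<^sub>R f z \<partial>distr lborel borel (\<lambda>z. t + 2 *\<^sub>R z))"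
    by (rule integral_density) (use f in simp_all)
  also have "\<dots> = (LINT z|lborel. 4 *\<^sub>R f (t + 2 *\<^sub>R z))"
    by (rule integral_distr[OF m]) (use f in simp)
  finally show ?thesis by simp
qed

lemma annih_scaleR:
  assumes "smooth w" shows "annih \<psi> (\<lambda>z. c *\<^sub>R w z) = (\<lambda>z. c *\<^sub>R annih \<psi> w z)"
proof -
  have "dir_deriv v (\<lambda>z. c *\<^sub>R w z) z = c *\<^sub>R dir_deriv v w z" for v z
    using dir_deriv_eq[OF has_derivative_scaleR_right[OF smooth_has_derivative[OF assms]]] .
  then show ?thesis by (auto simp: annih_def dbar_def scaleR_conv_of_real field_simps)
qed

lemma mult_exp_minus_le: "x * exp (- (x / 8)) \<le> (8 :: real)"
proof -
  have "x / 8 \<le> exp (x / 8)" using exp_ge_add_one_self[of "x / 8"] by linarith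
  then have "(x / 8) * exp (- (x / 8)) \<le> exp (x / 8) * exp (- (x / 8))" by (intro mult_right_mono) auto
  then show ?thesis by (simp add: exp_minus)
qed

text \<open>Where the field is nearly constant and equal to \<open>\<beta> \<ge> 0\<close>, the lowest Landau state
  \<open>exp (- \<beta> |z|\<^sup>2 / 4)\<close>, in the radial gauge and cut off at a fixed radius, is annihilated by \<open>annih \<psi>\<close>
  up to a bounded error, uniformly in \<open>\<beta>\<close>: the variation of the field contributes
  \<open>(1 + \<beta>) |z|\<^sup>2 exp (- \<beta> |z|\<^sup>2 / 4)\<close>. This and the cut-off error are \<open>O(exp (- \<beta> |z|\<^sup>2 / 8))\<close>, and the
  substitution \<open>z \<mapsto> 2 z\<close> compares the norm of such a function with that of the Landau state.\<close>

lemma localized_mode: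
  assumes \<rho>: "0 < \<rho>" and L: "0 \<le> L"
  obtains M where "\<And>\<psi> x0. smooth \<psi> \<Longrightarrow> 0 \<le> magnetic_field \<psi> x0 \<Longrightarrow>
    (\<And>z. z \<in> ball x0 \<rho> \<Longrightarrow>
      \<bar>magnetic_field \<psi> z - magnetic_field \<psi> x0\<bar> \<le> L * (1 + \<bar>magnetic_field \<psi> x0\<bar>) * norm (z - x0)) \<Longrightarrow>
    \<exists>w\<in>test_functions. (\<forall>z. z \<notin> ball x0 \<rho> \<longrightarrow> w z = 0) \<and> L2_norm w = 1 \<and> L2_norm (annih \<psi> w) \<le> M"
proof -
  let ?\<eta> = "bump \<rho>"
  note t\<eta> = test_bump[OF \<rho>]
  obtain G1 where G1: "\<And>z. norm (dir_deriv 1 ?\<eta> z) \<le> G1" "0 \<le> G1" using test_bounded[OF test_dir_deriv[OF t\<eta>]] by metis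
  obtain G2 where G2: "\<And>z. norm (dir_deriv \<i> ?\<eta> z) \<le> G2" "0 \<le> G2" using test_bounded[OF test_dir_deriv[OF t\<eta>]] by metis
  define c where "c = exp (- (4 / (3 * \<rho>\<^sup>2)))"
  have c: "0 < c" by (simp add: c_def)
  \<comment> \<open>\<open>\<rho>\<^sup>2 + 8\<close> bounds \<open>(1 + \<beta>) s\<^sup>2 exp (- \<beta> s\<^sup>2 / 8)\<close> for \<open>0 \<le> s \<le> \<rho>\<close>, uniformly in \<open>\<beta> \<ge> 0\<close>.\<close>
  define C0 where "C0 = G1 + G2 + L * (\<rho>\<^sup>2 + 8)"
  have C0: "0 \<le> C0" using G1(2) G2(2) L by (simp add: C0_def)
  have "\<exists>w\<in>test_functions. (\<forall>z. z \<notin> ball x0 \<rho> \<longrightarrow> w z = 0) \<and> L2_norm w = 1 \<and> L2_norm (annih \<psi> w) \<le> 2 * C0 / c"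
    if \<psi>: "smooth \<psi>" and \<beta>0: "0 \<le> magnetic_field \<psi> x0"
      and var: "\<And>z. z \<in> ball x0 \<rho> \<Longrightarrow>
        \<bar>magnetic_field \<psi> z - magnetic_field \<psi> x0\<bar> \<le> L * (1 + \<bar>magnetic_field \<psi> x0\<bar>) * norm (z - x0)" for \<psi> x0
  proof -
    let ?B = "magnetic_field \<psi>"
    define \<beta> where "\<beta> = ?B x0"
    have \<beta>: "0 \<le> \<beta>" using \<beta>0 by (simp add: \<beta>_def)
    define b where "b z = integral {0..1} (\<lambda>t. t * ?B (x0 + t *\<^sub>R (z - x0)))" for z
    obtain \<theta> :: "complex \<Rightarrow> real" where \<theta>: "smooth \<theta>"
      "\<And>z. dir_deriv 1 \<theta> z = - dir_deriv \<i> \<psi> z + b z * Im (z - x0)"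
      "\<And>z. dir_deriv \<i> \<theta> z = dir_deriv 1 \<psi> z - b z * Re (z - x0)"
      using radial_gauge[OF \<psi>, of x0] unfolding b_def by blast
    have b: "\<bar>b z - \<beta> / 2\<bar> \<le> L * (1 + \<beta>) * norm (z - x0)" if z: "z \<in> ball x0 \<rho>" for z
    proof -
      let ?f = "\<lambda>t. x0 + t *\<^sub>R (z - x0)"
      have "continuous_on {0..1} (\<lambda>t. ?B (?f t))"
        by (rule continuous_on_compose2[OF smooth_continuous_on[OF smooth_magnetic_field[OF \<psi>], of UNIV]])
          (auto intro!: continuous_on_add continuous_on_scaleR continuous_on_const continuous_on_id)
      then have cB: "continuous_on {0..1} (\<lambda>t. t * ?B (?f t))" "continuous_on {0..1} (\<lambda>t. t * ?B (?f t) - \<beta> * t)"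
        by (auto intro!: continuous_on_mult continuous_on_diff continuous_on_const continuous_on_id)
      have "((\<lambda>t. t * ?B (?f t) - \<beta> * t) has_integral (b z - \<beta> * ((1\<^sup>2 - 0\<^sup>2) / 2))) {0..1}"
        unfolding b_def
        by (intro has_integral_diff has_integral_mult_right ident_has_integral integrable_integral
            integrable_continuous_interval cB) simp
      from integral_unique[OF this]
      have e: "integral {0..1} (\<lambda>t. t * ?B (?f t) - \<beta> * t) = b z - \<beta> / 2" by simp
      have "norm (integral {0..1} (\<lambda>t. t * ?B (?f t) - \<beta> * t)) \<le> L * (1 + \<beta>) * norm (z - x0) * (1 - 0)"
      proof (rule integral_bound[OF _ cB(2)])
        fix t :: real assume t: "t \<in> {0..1}"
        have tz: "norm (t *\<^sub>R (z - x0)) \<le> norm (z - x0)" using t by (simp add: mult_left_le_one_le)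
        then have "?f t \<in> ball x0 \<rho>" using z by (simp add: dist_norm norm_minus_commute)
        from var[OF this] have "\<bar>?B (?f t) - \<beta>\<bar> \<le> L * (1 + \<beta>) * norm (t *\<^sub>R (z - x0))"
          using \<beta> by (simp add: \<beta>_def)
        also have "\<dots> \<le> L * (1 + \<beta>) * norm (z - x0)"
          by (rule mult_left_mono[OF tz]) (use L \<beta> in simp)
        finally have bd: "\<bar>?B (?f t) - \<beta>\<bar> \<le> L * (1 + \<beta>) * norm (z - x0)" .
        have "t * ?B (?f t) - \<beta> * t = t * (?B (?f t) - \<beta>)" by (simp add: right_diff_distrib)
        then have "norm (t * ?B (?f t) - \<beta> * t) = t * \<bar>?B (?f t) - \<beta>\<bar>" using t by (simp add: abs_mult)
        also have "\<dots> \<le> 1 * \<bar>?B (?f t) - \<beta>\<bar>" using t by (intro mult_right_mono) auto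
        finally show "norm (t * ?B (?f t) - \<beta> * t) \<le> L * (1 + \<beta>) * norm (z - x0)"
          using bd unfolding mult_1 by (rule order_trans)
      qed simp
      then show ?thesis unfolding e by simp
    qed
    define g where "g z = complex_of_real (- (\<beta> / 4) * ((z - x0) \<bullet> (z - x0))) + \<i> * complex_of_real (\<theta> z)" for z
    define v where "v z = complex_of_real (?\<eta> (z - x0)) * exp (g z)" for z
    have szx: "smooth (\<lambda>z. z - x0)" by (intro smooth_diff smooth_ident smooth_const)
    have sg: "smooth g" unfolding g_def
      by (intro smooth_add smooth_of_real smooth_cmult smooth_inner szx \<theta>)
    have s\<eta>: "smooth (\<lambda>z. ?\<eta> (z - x0))" by (rule smooth_compose[OF smooth_bump szx])
    have sv: "smooth v" unfolding v_def by (intro smooth_mult smooth_of_real s\<eta> smooth_exp sg)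
    have v0: "v z = 0" if "z \<notin> ball x0 \<rho>" for z
      using bump_eq_0[OF \<rho>, of "z - x0"] that by (simp add: v_def dist_norm norm_minus_commute)
    have tv: "v \<in> test_functions"
      by (rule test_functionsI[OF sv compact_cball[of x0 \<rho>]]) (use v0 in auto)
    have dg: "dir_deriv e g z = complex_of_real (- (\<beta> / 2) * ((z - x0) \<bullet> e)) + \<i> * complex_of_real (dir_deriv e \<theta> z)" for e z
    proof -
      have "((\<lambda>z. - (\<beta> / 4) * ((z - x0) \<bullet> (z - x0))) has_derivative (\<lambda>h. - (\<beta> / 4) * ((z - x0) \<bullet> h + h \<bullet> (z - x0)))) (at z)"
        by (auto intro!: derivative_eq_intros)
      note re = bounded_linear.has_derivative[OF bounded_linear_of_real this]
      have "(g has_derivative (\<lambda>h. complex_of_real (- (\<beta> / 4) * ((z - x0) \<bullet> h + h \<bullet> (z - x0))) + \<i> * complex_of_real (dir_deriv h \<theta> z))) (at z)"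
        unfolding g_def
        by (rule has_derivative_add[OF re has_derivative_mult_right[OF
              bounded_linear.has_derivative[OF bounded_linear_of_real smooth_has_derivative[OF \<theta>(1)]]]])
      from dir_deriv_eq[OF this, of e] show ?thesis by (simp add: inner_commute[of e])
    qed
    have de: "dir_deriv e (\<lambda>z. exp (g z)) z = exp (g z) * dir_deriv e g z" for e z
    proof -
      have "((\<lambda>z. exp (g z)) has_derivative (\<lambda>h. exp (g z) * dir_deriv h g z)) (at z)"
        using has_derivative_compose[OF smooth_has_derivative[OF sg] DERIV_exp[unfolded has_field_derivative_def]] .
      from dir_deriv_eq[OF this] show ?thesis .
    qed
    have d\<eta>: "dir_deriv e (\<lambda>z. ?\<eta> (z - x0)) z = dir_deriv e ?\<eta> (z - x0)" for e z
    proof -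
      have "((\<lambda>z. z - x0) has_derivative (\<lambda>h. h)) (at z)" by (auto intro!: derivative_eq_intros)
      from dir_deriv_eq[OF dir_deriv_compose[OF smooth_Ck[OF smooth_bump] this]] show ?thesis .
    qed
    have dv: "dir_deriv e v z = exp (g z) * (complex_of_real (?\<eta> (z - x0)) * dir_deriv e g z + complex_of_real (dir_deriv e ?\<eta> (z - x0)))" for e z
      unfolding v_def dir_deriv_mult[OF smooth_of_real[OF s\<eta>] smooth_exp[OF sg]] de dir_deriv_of_real[OF s\<eta>] d\<eta>
      by (simp add: algebra_simps)
    have av: "annih \<psi> v z = exp (g z) * ((complex_of_real (dir_deriv 1 ?\<eta> (z - x0)) + \<i> * complex_of_real (dir_deriv \<i> ?\<eta> (z - x0))) / 2
        + complex_of_real (?\<eta> (z - x0)) * (z - x0) * complex_of_real (b z - \<beta> / 2) / 2)" for z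
    proof -
      have zx: "z - x0 = complex_of_real (Re (z - x0)) + \<i> * complex_of_real (Im (z - x0))" by (rule complex_eq)
      have "dir_deriv 1 g z + \<i> * dir_deriv \<i> g z + (complex_of_real (dir_deriv 1 \<psi> z) + \<i> * complex_of_real (dir_deriv \<i> \<psi> z))
         = (z - x0) * complex_of_real (b z - \<beta> / 2)"
        unfolding dg \<theta>(2,3) by (simp add: complex_eq_iff inner_complex_def algebra_simps)
      then have *: "dir_deriv 1 g z + \<i> * dir_deriv \<i> g z
         = (z - x0) * complex_of_real (b z - \<beta> / 2) - (complex_of_real (dir_deriv 1 \<psi> z) + \<i> * complex_of_real (dir_deriv \<i> \<psi> z))"
        by (simp add: algebra_simps)
      have "annih \<psi> v z = exp (g z) * ((complex_of_real (?\<eta> (z - x0)) * (dir_deriv 1 g z + \<i> * dir_deriv \<i> g z)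
         + (complex_of_real (dir_deriv 1 ?\<eta> (z - x0)) + \<i> * complex_of_real (dir_deriv \<i> ?\<eta> (z - x0)))) / 2
         + complex_of_real (?\<eta> (z - x0)) * (complex_of_real (dir_deriv 1 \<psi> z) + \<i> * complex_of_real (dir_deriv \<i> \<psi> z)) / 2)"
        unfolding annih_def dbar_def dv dir_deriv_of_real[OF \<psi>] by (simp add: v_def field_simps)
      then show ?thesis unfolding * by (simp add: field_simps)
    qed
    have ng: "norm (exp (g z)) = exp (- (\<beta> / 4 * (norm (z - x0))\<^sup>2))" for z
      by (simp add: norm_exp_eq_Re g_def power2_norm_eq_inner)
    have avb: "norm (annih \<psi> v z) \<le> C0 * exp (- (\<beta> / 8 * (norm (z - x0))\<^sup>2))" if z: "z \<in> cball x0 \<rho>" for z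
    proof -
      define s where "s = norm (z - x0)"
      have s: "0 \<le> s" "s \<le> \<rho>" using z by (auto simp: s_def dist_norm norm_minus_commute)
      define X where "X = exp (- (\<beta> / 8 * s\<^sup>2))"
      have X: "0 < X" "X \<le> 1" using \<beta> by (auto simp: X_def)
      have XX: "norm (exp (g z)) = X * X" unfolding ng X_def s_def by (simp add: mult_exp_exp)
      have A: "norm ((complex_of_real (dir_deriv 1 ?\<eta> (z - x0)) + \<i> * complex_of_real (dir_deriv \<i> ?\<eta> (z - x0))) / 2) \<le> G1 + G2"
      proof -
        have "norm (complex_of_real (dir_deriv 1 ?\<eta> (z - x0)) + \<i> * complex_of_real (dir_deriv \<i> ?\<eta> (z - x0))) \<le> G1 + G2"
          using G1(1)[of "z - x0"] G2(1)[of "z - x0"] by (intro order_trans[OF norm_triangle_ineq]) (simp add: norm_mult)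
        then show ?thesis using G1(2) G2(2) by (simp add: norm_divide)
      qed
      have D: "norm (complex_of_real (?\<eta> (z - x0)) * (z - x0) * complex_of_real (b z - \<beta> / 2) / 2) \<le> L * (1 + \<beta>) * s\<^sup>2"
      proof (cases "z \<in> ball x0 \<rho>")
        case True
        have "norm (complex_of_real (?\<eta> (z - x0)) * (z - x0) * complex_of_real (b z - \<beta> / 2)) = \<bar>?\<eta> (z - x0)\<bar> * (s * \<bar>b z - \<beta> / 2\<bar>)"
          by (simp add: norm_mult s_def del: of_real_diff)
        also have "\<dots> \<le> 1 * (s * (L * (1 + \<beta>) * s))"
          using b[OF True] bump_bounds[of \<rho> "z - x0"] s by (intro mult_mono) (auto simp: s_def)
        also have "\<dots> = L * (1 + \<beta>) * s\<^sup>2" by (simp add: power2_eq_square)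
        finally have "norm (complex_of_real (?\<eta> (z - x0)) * (z - x0) * complex_of_real (b z - \<beta> / 2)) \<le> L * (1 + \<beta>) * s\<^sup>2" .
        moreover have "0 \<le> L * (1 + \<beta>) * s\<^sup>2" using L \<beta> by simp
        ultimately show ?thesis unfolding norm_divide by simp
      next
        case False
        then have "?\<eta> (z - x0) = 0" by (intro bump_eq_0 \<rho>) (simp add: dist_norm norm_minus_commute)
        then show ?thesis using L \<beta> by simp
      qed
      have E: "(1 + \<beta>) * s\<^sup>2 * X \<le> \<rho>\<^sup>2 + 8"
      proof -
        have "s\<^sup>2 * X \<le> \<rho>\<^sup>2 * 1" using s X by (intro mult_mono power_mono) auto
        moreover have "\<beta> * s\<^sup>2 * X \<le> 8" using mult_exp_minus_le[of "\<beta> * s\<^sup>2"] by (simp add: X_def)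
        ultimately show ?thesis by (simp add: algebra_simps)
      qed
      have "norm (annih \<psi> v z) \<le> (X * X) * (G1 + G2 + L * (1 + \<beta>) * s\<^sup>2)"
        unfolding av norm_mult[of "exp (g z)"] XX
        using A D X by (intro mult_left_mono order_trans[OF norm_triangle_ineq] add_mono) auto
      also have "\<dots> = X * ((G1 + G2) * X + L * ((1 + \<beta>) * s\<^sup>2 * X))" by (simp add: algebra_simps)
      also have "\<dots> \<le> X * ((G1 + G2) * 1 + L * (\<rho>\<^sup>2 + 8))"
        using X E L G1(2) G2(2) by (intro mult_left_mono add_mono) auto
      finally show ?thesis by (simp add: C0_def X_def s_def mult.commute)
    qed
    have av0: "annih \<psi> v z = 0" if "z \<notin> cball x0 \<rho>" for z
    proof -
      have "((\<lambda>_. 0) has_derivative (\<lambda>_. 0)) (at z)" by simp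
      moreover have "open (- cball x0 \<rho>)" by (intro open_Compl closed_cball)
      ultimately have "(v has_derivative (\<lambda>_. 0)) (at z)"
        by (rule has_derivative_transform_within_open) (use that v0 in auto)
      then have "dir_deriv e v z = 0" for e using dir_deriv_eq by blast
      moreover have "v z = 0" using that v0 by auto
      ultimately show ?thesis by (simp add: annih_def dbar_def)
    qed
    define J where "J z = indicator (cball x0 \<rho>) z * exp (- (\<beta> / 4 * (norm (z - x0))\<^sup>2))" for z
    have J0: "0 \<le> J z" for z by (simp add: J_def)
    have cex: "continuous_on S (\<lambda>z. exp (- (\<beta> / 4 * (norm (z - x0))\<^sup>2)))" for S
      by (intro continuous_intros)
    have intJ: "integrable lborel J"
      using borel_integrable_compact[OF compact_cball cex, of x0 \<rho>] by (simp add: J_def[abs_def])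
    have mJ: "J \<in> borel_measurable borel" using borel_measurable_integrable[OF intJ] by simp
    have av2: "(norm (annih \<psi> v z))\<^sup>2 \<le> C0\<^sup>2 * J z" for z
    proof (cases "z \<in> cball x0 \<rho>")
      case True
      have "(norm (annih \<psi> v z))\<^sup>2 \<le> (C0 * exp (- (\<beta> / 8 * (norm (z - x0))\<^sup>2)))\<^sup>2"
        using avb[OF True] by (intro power_mono) auto
      also have "\<dots> = C0\<^sup>2 * J z"
        using True by (simp add: J_def power_mult_distrib exp_double[symmetric] mult.assoc[symmetric] del: exp_double)
      finally show ?thesis .
    next
      case False
      then show ?thesis using av0 J0 by simp
    qed
    have av_int: "integrable lborel (\<lambda>z. (norm (annih \<psi> v z))\<^sup>2)"
    proof (rule integrable_compact_support[OF _ compact_cball[of x0 \<rho>]])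
      have "smooth (annih \<psi> v)" unfolding annih_def dbar_def divide_complex_def
        by (intro smooth_add smooth_mult smooth_const smooth_dir_deriv smooth_of_real \<psi> sv)
      then show "continuous_on UNIV (\<lambda>z. (norm (annih \<psi> v z))\<^sup>2)"
        by (intro continuous_on_power continuous_on_norm smooth_continuous_on)
    qed (use av0 in auto)
    have N1: "(L2_norm (annih \<psi> v))\<^sup>2 \<le> C0\<^sup>2 * integral\<^sup>L lborel J"
    proof -
      have "(L2_norm (annih \<psi> v))\<^sup>2 = (LINT z|lborel. (norm (annih \<psi> v z))\<^sup>2)"
        by (simp add: L2_norm_def)
      also have "\<dots> \<le> (LINT z|lborel. C0\<^sup>2 * J z)"
        by (rule integral_mono[OF av_int]) (use intJ av2 in auto)
      finally show ?thesis by simp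
    qed
    have v_int: "integrable lborel (\<lambda>z. (norm (v z))\<^sup>2)"
      using test_L2[OF tv] by (simp add: L2_space_def)
    have vJ: "c\<^sup>2 * J (- x0 + 2 *\<^sub>R z) \<le> (norm (v z))\<^sup>2" for z
    proof (cases "norm (z - x0) \<le> \<rho> / 2")
      case True
      have e: "- x0 + 2 *\<^sub>R z - x0 = 2 *\<^sub>R (z - x0)" by (simp add: scaleR_2 algebra_simps)
      have "J (- x0 + 2 *\<^sub>R z) \<le> exp (- (\<beta> * (norm (z - x0))\<^sup>2))"
        unfolding J_def e by (simp add: power_mult_distrib indicator_def)
      also have "\<dots> \<le> exp (- (\<beta> / 2 * (norm (z - x0))\<^sup>2))" using \<beta> by simp
      finally have "c\<^sup>2 * J (- x0 + 2 *\<^sub>R z) \<le> (?\<eta> (z - x0))\<^sup>2 * exp (- (\<beta> / 2 * (norm (z - x0))\<^sup>2))"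
        using bump_ge[OF \<rho> True] c J0 by (intro mult_mono power_mono) (auto simp: c_def)
      also have "\<dots> = (norm (v z))\<^sup>2"
        unfolding v_def norm_mult ng by (simp add: power_mult_distrib exp_double[symmetric] del: exp_double)
      finally show ?thesis .
    next
      case False
      have "norm (- x0 + 2 *\<^sub>R z - x0) = 2 * norm (z - x0)"
      proof -
        have e: "- x0 + 2 *\<^sub>R z - x0 = 2 *\<^sub>R (z - x0)" by (simp add: scaleR_2 algebra_simps)
        show ?thesis unfolding e by simp
      qed
      then have "- x0 + 2 *\<^sub>R z \<notin> cball x0 \<rho>" using False by (simp add: dist_norm norm_minus_commute)
      then show ?thesis by (simp add: J_def)
    qed
    have N2: "c\<^sup>2 * integral\<^sup>L lborel J \<le> 4 * (L2_norm v)\<^sup>2"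
    proof -
      have "c\<^sup>2 * (LINT z|lborel. J (- x0 + 2 *\<^sub>R z)) = (LINT z|lborel. c\<^sup>2 * J (- x0 + 2 *\<^sub>R z))" by simp
      also have "\<dots> \<le> (LINT z|lborel. (norm (v z))\<^sup>2)"
        by (rule integral_mono'[OF v_int vJ]) simp
      also have "\<dots> = (L2_norm v)\<^sup>2" by (simp add: L2_norm_def)
      finally show ?thesis using integral_scale2[OF mJ, of "- x0"] by simp
    qed
    have Jpos: "0 < integral\<^sup>L lborel J"
    proof -
      define a where "a = exp (- (\<beta> / 4 * \<rho>\<^sup>2))"
      have fin: "emeasure lborel (cball x0 \<rho>) < \<infinity>" by (rule emeasure_bounded_finite[OF bounded_cball])
      have "0 < a * measure lborel (cball x0 \<rho>)"
        using content_cball_pos[OF \<rho>, of x0] by (simp add: a_def)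
      also have "\<dots> = (LINT z|lborel. a * indicator (cball x0 \<rho>) z)" by simp
      also have "\<dots> \<le> integral\<^sup>L lborel J"
      proof (rule integral_mono'[OF intJ _ J0])
        fix z
        have "a \<le> exp (- (\<beta> / 4 * (norm (z - x0))\<^sup>2))" if "z \<in> cball x0 \<rho>"
          using that \<beta> by (auto simp: a_def dist_norm norm_minus_commute intro!: mult_left_mono power_mono)
        then show "a * indicator (cball x0 \<rho>) z \<le> J z" by (auto simp: J_def indicator_def)
      qed
      finally show ?thesis .
    qed
    define N where "N = L2_norm v"
    have "0 < c\<^sup>2 * integral\<^sup>L lborel J" using Jpos c by simp
    then have "0 < N\<^sup>2" using N2 unfolding N_def by linarith
    then have N: "0 < N" using L2_norm_nonneg[of v] unfolding N_def by (simp add: order_less_le)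
    \<comment> \<open>\<open>N1\<close> and \<open>N2\<close> compare both norms with the same integral; the factor \<open>4\<close> is the Jacobian of
      \<open>z \<mapsto> 2 z - x0\<close>, which turns the weaker decay of \<open>J\<close> into that of \<open>v\<close>.\<close>
    have main: "L2_norm (annih \<psi> v) \<le> 2 * C0 / c * N"
    proof (rule power2_le_imp_le)
      have "(L2_norm (annih \<psi> v))\<^sup>2 \<le> C0\<^sup>2 * (4 * N\<^sup>2 / c\<^sup>2)"
        using N1 N2 c by (intro order_trans[OF N1] mult_left_mono) (simp_all add: N_def field_simps)
      then show "(L2_norm (annih \<psi> v))\<^sup>2 \<le> (2 * C0 / c * N)\<^sup>2" by (simp add: power_mult_distrib power_divide mult_ac)
      show "0 \<le> 2 * C0 / c * N" using C0 c N by simp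
    qed
    define w where "w z = (1 / N) *\<^sub>R v z" for z
    have nw: "L2_norm (\<lambda>z. (1 / N) *\<^sub>R f z) = L2_norm f / N" for f :: "complex \<Rightarrow> complex"
      using N by (simp add: L2_norm_def power_mult_distrib real_sqrt_mult power_divide real_sqrt_divide)
    show ?thesis
    proof (intro bexI conjI allI impI)
      show "w \<in> test_functions"
        unfolding w_def by (rule test_functionsI[OF smooth_compose_linear[OF bounded_linear_scaleR_right sv] compact_cball[of x0 \<rho>]])
          (use v0 in auto)
      show "w z = 0" if "z \<notin> ball x0 \<rho>" for z using v0[OF that] by (simp add: w_def)
      show "L2_norm w = 1" unfolding w_def nw using N by (simp add: N_def)
      show "L2_norm (annih \<psi> w) \<le> 2 * C0 / c"
        unfolding w_def annih_scaleR[OF sv] nw using main N by (simp add: divide_le_eq)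
    qed
  qed
  then show ?thesis using that by blast
qed

text \<open>The sign of the field at the slowly varying point of a ball decides between the two operators;
  where it is negative, the previous construction is applied to \<open>- \<psi>\<close> and conjugated.\<close>

lemma localized_modes_of_cond_H:
  assumes \<psi>: "smooth \<psi>" and r: "0 < r" and H: "cond_H r \<psi>"
  obtains M :: real and w :: "nat \<Rightarrow> complex \<Rightarrow> complex" where
    "\<And>i. w i \<in> test_functions" "\<And>i. L2_norm (w i) = 1"
    "\<And>i j z. i \<noteq> j \<Longrightarrow> w i z = 0 \<or> w j z = 0"
    "\<And>i. L2_norm (annih \<psi> (w i)) \<le> M \<or> L2_norm (creat \<psi> (w i)) \<le> M"
proof -
  let ?B = "magnetic_field \<psi>"
  obtain q where q: "r = Suc q" using r gr0_implies_Suc by blast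
  obtain c :: "nat \<Rightarrow> complex" and R :: "nat \<Rightarrow> real" and C :: real where
    R: "\<forall>i. 1 \<le> R i"
    and disj: "\<forall>i j. i \<noteq> j \<longrightarrow> ball (c i) (R i) \<inter> ball (c j) (R j) = {}"
    and H': "\<forall>z\<in>(\<Union>i. ball (c i) (R i)). m_sub \<psi> (r + 1) z \<le> C * m_sup \<psi> r z"
    using H unfolding cond_H_def by (elim exE conjE)
  obtain \<rho> L where \<rho>: "0 < \<rho>" "0 \<le> L" and pt: "\<And>B c. smooth B \<Longrightarrow>
    (\<forall>z\<in>ball c 1. jet (Suc q) B z \<le> max 1 C * jets (Suc q) B z) \<Longrightarrow>
    \<exists>x. ball x \<rho> \<subseteq> ball c 1 \<and> (\<forall>z\<in>ball x \<rho>. \<bar>B z - B x\<bar> \<le> L * (1 + \<bar>B x\<bar>) * norm (z - x))"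
    using slowly_varying_point[of "max 1 C" 1 q] by auto
  have sub: "ball (c i) 1 \<subseteq> ball (c i) (R i)" for i using R by (intro subset_ball) simp
  have jet: "jet (Suc q) ?B z \<le> max 1 C * jets (Suc q) ?B z" if "z \<in> ball (c i) 1" for i z
  proof -
    have "z \<in> (\<Union>i. ball (c i) (R i))" using that sub[of i] by blast
    from bspec[OF H' this] have "jet (Suc q) ?B z \<le> C * jets (Suc q) ?B z"
      using m_sub_eq_jet[of \<psi> r z] by (simp add: m_sup_eq_jets q)
    also have "\<dots> \<le> max 1 C * jets (Suc q) ?B z"
      using jets_ge_1[of "Suc q" ?B z] by (intro mult_right_mono) auto
    finally show ?thesis .
  qed
  have "\<forall>i. \<exists>x. ball x \<rho> \<subseteq> ball (c i) 1 \<and> (\<forall>z\<in>ball x \<rho>. \<bar>?B z - ?B x\<bar> \<le> L * (1 + \<bar>?B x\<bar>) * norm (z - x))"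
    using pt[OF smooth_magnetic_field[OF \<psi>]] jet by blast
  from choice[OF this] obtain x where x: "\<And>i. ball (x i) \<rho> \<subseteq> ball (c i) 1"
    "\<And>i z. z \<in> ball (x i) \<rho> \<Longrightarrow> \<bar>?B z - ?B (x i)\<bar> \<le> L * (1 + \<bar>?B (x i)\<bar>) * norm (z - x i)" by blast
  obtain M where M: "\<And>\<psi> x0. smooth \<psi> \<Longrightarrow> 0 \<le> magnetic_field \<psi> x0 \<Longrightarrow>
    (\<And>z. z \<in> ball x0 \<rho> \<Longrightarrow>
      \<bar>magnetic_field \<psi> z - magnetic_field \<psi> x0\<bar> \<le> L * (1 + \<bar>magnetic_field \<psi> x0\<bar>) * norm (z - x0)) \<Longrightarrow>
    \<exists>w\<in>test_functions. (\<forall>z. z \<notin> ball x0 \<rho> \<longrightarrow> w z = 0) \<and> L2_norm w = 1 \<and> L2_norm (annih \<psi> w) \<le> M"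
    using localized_mode[OF \<rho>] by metis
  have "\<forall>i. \<exists>w. w \<in> test_functions \<and> (\<forall>z. z \<notin> ball (x i) \<rho> \<longrightarrow> w z = 0) \<and> L2_norm w = 1 \<and>
      (L2_norm (annih \<psi> w) \<le> M \<or> L2_norm (creat \<psi> w) \<le> M)"
  proof
    fix i
    show "\<exists>w. w \<in> test_functions \<and> (\<forall>z. z \<notin> ball (x i) \<rho> \<longrightarrow> w z = 0) \<and> L2_norm w = 1 \<and>
      (L2_norm (annih \<psi> w) \<le> M \<or> L2_norm (creat \<psi> w) \<le> M)"
    proof (cases "0 \<le> ?B (x i)")
      case True
      from M[OF \<psi> True x(2)] show ?thesis by blast
    next
      case False
      let ?\<psi> = "\<lambda>z. - \<psi> z"
      have "\<bar>magnetic_field ?\<psi> z - magnetic_field ?\<psi> (x i)\<bar> \<le> L * (1 + \<bar>magnetic_field ?\<psi> (x i)\<bar>) * norm (z - x i)"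
        if "z \<in> ball (x i) \<rho>" for z
        using x(2)[OF that] by (simp add: magnetic_field_uminus[OF \<psi>] abs_minus_commute)
      moreover have "0 \<le> magnetic_field ?\<psi> (x i)" using False by (simp add: magnetic_field_uminus[OF \<psi>])
      ultimately obtain w where w: "w \<in> test_functions" "\<forall>z. z \<notin> ball (x i) \<rho> \<longrightarrow> w z = 0" "L2_norm w = 1"
        "L2_norm (annih ?\<psi> w) \<le> M" using M[OF smooth_uminus[OF \<psi>]] by blast
      have "(\<lambda>z. cnj (w z)) \<in> test_functions"
        by (rule test_functionsI[OF smooth_cnj[OF test_smooth[OF w(1)]] compact_cball[of "x i" \<rho>]])
          (use w(2) in auto)
      moreover have "L2_norm (creat \<psi> (\<lambda>z. cnj (w z))) = L2_norm (annih ?\<psi> w)"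
        unfolding L2_norm_def creat_eq_annih[OF \<psi> test_smooth[OF w(1)]] by simp
      moreover have "L2_norm (\<lambda>z. cnj (w z)) = L2_norm w" by (simp add: L2_norm_def)
      ultimately show ?thesis using w by (intro exI[of _ "\<lambda>z. cnj (w z)"]) simp
    qed
  qed
  from choice[OF this] obtain w where w: "\<And>i. w i \<in> test_functions" "\<And>i z. z \<notin> ball (x i) \<rho> \<Longrightarrow> w i z = 0"
    "\<And>i. L2_norm (w i) = 1" "\<And>i. L2_norm (annih \<psi> (w i)) \<le> M \<or> L2_norm (creat \<psi> (w i)) \<le> M" by blast
  show ?thesis
  proof (rule that[OF w(1) w(3) _ w(4)])
    fix i j z assume "(i :: nat) \<noteq> j"
    then have "ball (x i) \<rho> \<inter> ball (x j) \<rho> = {}"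
      using disj[rule_format, of i j] x(1)[of i] x(1)[of j] sub[of i] sub[of j] by blast
    then show "w i z = 0 \<or> w j z = 0" using w(2)[of z i] w(2)[of z j] by blast
  qed
qed

section \<open>Forms with product coefficients\<close>

lemma measurable_vec_lambda:
  "(\<lambda>f. \<chi> i. f i) \<in> borel_measurable (PiM UNIV (\<lambda>_ :: 'n::finite. lborel :: complex measure))"
proof -
  have "(\<lambda>f. (\<chi> i. f i) \<bullet> b) \<in> borel_measurable (PiM UNIV (\<lambda>_ :: 'n. lborel :: complex measure))"
    if "b \<in> Basis" for b
  proof -
    from that obtain j c where b: "b = axis j c" by (auto simp: Basis_vec_def)
    have "(\<lambda>f. f j) \<in> measurable (PiM UNIV (\<lambda>_ :: 'n. lborel :: complex measure)) borel"
      using measurable_component_singleton[of j UNIV "\<lambda>_ :: 'n. lborel :: complex measure"] by simp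
    then show ?thesis unfolding b inner_axis by (auto intro!: borel_measurable_inner)
  qed
  then show ?thesis by (subst borel_measurable_euclidean_space) blast
qed

text \<open>Norms of product functions factorize because Lebesgue measure on \<open>\<complex>\<^sup>n\<close> is a product measure; the
  two measures agree on boxes.\<close>

lemma lborel_complex_vec:
  "(lborel :: (complex ^ 'n::finite) measure) = distr (PiM UNIV (\<lambda>_. lborel)) borel (\<lambda>f. \<chi> i. f i)"
proof (rule lborel_eqI)
  interpret product_sigma_finite "\<lambda>_ :: 'n. lborel :: complex measure" by standard
  let ?v = "\<lambda>f. (\<chi> i. f i) :: complex ^ 'n"
  fix l u :: "complex ^ 'n"
  assume lu: "\<And>b. b \<in> Basis \<Longrightarrow> l \<bullet> b \<le> u \<bullet> b"
  have lu': "l $ i \<bullet> b \<le> u $ i \<bullet> b" if "b \<in> Basis" for i b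
    using lu[of "axis i b"] that by (simp add: inner_axis axis_in_Basis_iff)
  have "?v -` box l u \<inter> space (PiM UNIV (\<lambda>_. lborel)) = Pi\<^sub>E UNIV (\<lambda>i. box (l $ i) (u $ i))"
    by (auto simp: space_PiM mem_box Basis_vec_def inner_axis PiE_iff)
  then have "emeasure (distr (PiM UNIV (\<lambda>_. lborel)) borel ?v) (box l u)
      = emeasure (PiM UNIV (\<lambda>_ :: 'n. lborel)) (Pi\<^sub>E UNIV (\<lambda>i. box (l $ i) (u $ i)))"
    by (subst emeasure_distr[OF measurable_vec_lambda]) auto
  also have "\<dots> = (\<Prod>i\<in>UNIV. emeasure lborel (box (l $ i) (u $ i)))"
    by (rule emeasure_PiM) auto
  also have "\<dots> = (\<Prod>i\<in>UNIV. ennreal (\<Prod>b\<in>Basis. (u $ i - l $ i) \<bullet> b))"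
    using lu' by (intro prod.cong refl emeasure_lborel_box) auto
  also have "\<dots> = ennreal (\<Prod>i\<in>UNIV. \<Prod>b\<in>Basis. (u $ i - l $ i) \<bullet> b)"
    using lu' by (intro prod_ennreal prod_nonneg) (auto simp: inner_diff_left)
  also have "(\<Prod>i\<in>UNIV. \<Prod>b\<in>Basis. (u $ i - l $ i) \<bullet> b) = (\<Prod>b\<in>Basis. (u - l) \<bullet> b)"
  proof -
    have inj: "inj_on (axis i) (Basis :: complex set)" for i :: 'n
      by (auto simp: inj_on_def axis_eq_axis)
    have "(\<Prod>b\<in>Basis. (u - l) \<bullet> b) = (\<Prod>i\<in>UNIV. \<Prod>b\<in>axis i ` Basis. (u - l) \<bullet> b)"
    proof -
      have B: "(Basis :: (complex ^ 'n) set) = (\<Union>i\<in>UNIV. axis i ` Basis)"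
        by (auto simp: Basis_vec_def)
      show ?thesis unfolding B
        by (rule prod.UNION_disjoint) (auto simp: axis_eq_axis nonzero_Basis)
    qed
    then show ?thesis by (simp add: prod.reindex[OF inj] inner_axis)
  qed
  finally show "emeasure (distr (PiM UNIV (\<lambda>_. lborel)) borel ?v) (box l u) = ennreal (\<Prod>b\<in>Basis. (u - l) \<bullet> b)" .
qed simp

lemma integral_prod_components:
  fixes g :: "'n::finite \<Rightarrow> complex \<Rightarrow> real"
  assumes "\<And>i. integrable lborel (g i)"
  shows "(LINT z|lborel. (\<Prod>i\<in>UNIV. g i (z $ i))) = (\<Prod>i\<in>UNIV. integral\<^sup>L lborel (g i))"
proof -
  interpret product_sigma_finite "\<lambda>_ :: 'n. lborel :: complex measure" by standard
  have m: "(\<lambda>z :: complex ^ 'n. \<Prod>i\<in>UNIV. g i (z $ i)) \<in> borel_measurable borel"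
  proof (intro borel_measurable_prod)
    fix i :: 'n
    have "(\<lambda>z :: complex ^ 'n. z $ i) \<in> borel_measurable borel"
      by (intro borel_measurable_continuous_onI continuous_on_component continuous_on_id)
    moreover have "g i \<in> borel_measurable borel" using borel_measurable_integrable[OF assms[of i]] by simp
    ultimately show "(\<lambda>z :: complex ^ 'n. g i (z $ i)) \<in> borel_measurable borel" by (rule measurable_compose)
  qed
  have "(LINT z|lborel. (\<Prod>i\<in>UNIV. g i (z $ i)))
      = (LINT z|distr (PiM UNIV (\<lambda>_ :: 'n. lborel)) borel (\<lambda>f. \<chi> i. f i). (\<Prod>i\<in>UNIV. g i (z $ i)))"
    by (rule arg_cong[OF lborel_complex_vec])
  also have "\<dots> = (\<integral>f. (\<Prod>i\<in>UNIV. g i (f i)) \<partial>PiM UNIV (\<lambda>_ :: 'n. lborel))"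
    by (subst integral_distr[OF measurable_vec_lambda m]) simp
  also have "\<dots> = (\<Prod>i\<in>UNIV. integral\<^sup>L lborel (g i))"
    by (rule product_integral_prod) (use assms in auto)
  finally show ?thesis .
qed

definition prodfn :: "('n::finite \<Rightarrow> complex \<Rightarrow> complex) \<Rightarrow> 'n form00" where
  "prodfn f = (\<lambda>z. \<Prod>j\<in>UNIV. f j (z $ j))"

lemma L2_norm_prodfn:
  assumes "\<And>j. f j \<in> L2_space"
  shows "(L2_norm (prodfn f))\<^sup>2 = (\<Prod>j\<in>UNIV. (L2_norm (f j))\<^sup>2)"
proof -
  have i: "integrable lborel (\<lambda>z. (norm (f j z))\<^sup>2)" for j using assms[of j] by (simp add: L2_space_def)
  have "(L2_norm (prodfn f))\<^sup>2 = (LINT z|lborel. (norm (prodfn f z))\<^sup>2)" by (simp add: L2_norm_def)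
  also have "\<dots> = (LINT z|lborel. (\<Prod>j\<in>UNIV. (norm (f j (z $ j)))\<^sup>2))"
    by (simp add: prodfn_def prod_norm[symmetric] prod_power_distrib)
  also have "\<dots> = (\<Prod>j\<in>UNIV. (LINT z|lborel. (norm (f j z))\<^sup>2))"
    using integral_prod_components[of "\<lambda>j z. (norm (f j z))\<^sup>2", OF i] .
  also have "\<dots> = (\<Prod>j\<in>UNIV. (L2_norm (f j))\<^sup>2)" by (simp add: L2_norm_def)
  finally show ?thesis .
qed

lemma prodfn_fun_upd: "prodfn (f(k := g)) z = g (z $ k) * (\<Prod>j\<in>UNIV - {k}. f j (z $ j))"
  unfolding prodfn_def by (subst prod.remove[of _ k]) (auto intro!: prod.cong)

lemma prodfn_split: "prodfn f z = f k (z $ k) * (\<Prod>j\<in>UNIV - {k}. f j (z $ j))"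
  using prodfn_fun_upd[of f k "f k" z] by simp

lemma test_prodfn:
  fixes f :: "'n::finite \<Rightarrow> complex \<Rightarrow> complex"
  assumes "\<And>j. f j \<in> test_functions" shows "prodfn f \<in> test_functions"
proof -
  have "\<exists>R. \<forall>z. R < norm z \<longrightarrow> f j z = 0" for j
  proof -
    obtain K where K: "compact K" "\<And>x. x \<notin> K \<Longrightarrow> f j x = 0" using test_functionsE[OF assms[of j]] by metis
    obtain R where "\<And>x. x \<in> K \<Longrightarrow> norm x \<le> R" using compact_imp_bounded[OF K(1)] unfolding bounded_iff by blast
    then show ?thesis using K(2) by (intro exI[of _ R]) force
  qed
  then have "\<forall>j. \<exists>R. \<forall>z. R < norm z \<longrightarrow> f j z = 0" by blast
  from choice[OF this] obtain R where R: "\<And>j z. R j < norm z \<Longrightarrow> f j z = 0" by blast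
  show ?thesis
  proof (rule test_functionsI[OF _ compact_cball[of 0 "\<Sum>j\<in>UNIV. R j"]])
    show "smooth (prodfn f)" unfolding prodfn_def
      by (rule smooth_prod, rule smooth_compose[OF test_smooth[OF assms] smooth_linear[OF bounded_linear_vec_nth]])
    fix z :: "complex ^ 'n" assume "z \<notin> cball 0 (\<Sum>j\<in>UNIV. R j)"
    then have "(\<Sum>j\<in>UNIV. R j) < norm z" by simp
    also have "norm z \<le> (\<Sum>j\<in>UNIV. norm (z $ j))"
      unfolding norm_vec_def by (rule L2_set_le_sum) simp
    finally have "\<exists>j. R j < norm (z $ j)" by (meson not_le sum_mono)
    then obtain j where "f j (z $ j) = 0" using R by blast
    then show "prodfn f z = 0" unfolding prodfn_def by (intro prod_zero) auto
  qed
qed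

lemma dir_deriv_zero_direction: "smooth f \<Longrightarrow> dir_deriv 0 f x = 0"
  using linear_0[OF has_derivative_linear[OF smooth_has_derivative]] .

lemma component_has_derivative:
  fixes f :: "complex \<Rightarrow> 'b::euclidean_space"
  assumes "smooth f"
  shows "((\<lambda>z :: complex ^ 'n::finite. f (z $ j)) has_derivative (\<lambda>h. dir_deriv (h $ j) f (z $ j))) (at z)"
  using has_derivative_compose[OF bounded_linear_imp_has_derivative[OF bounded_linear_vec_nth] smooth_has_derivative[OF assms]] .

lemma dir_deriv_prodfn:
  assumes "\<And>j. smooth (f j)"
  shows "dir_deriv (axis k c) (prodfn f) z = dir_deriv c (f k) (z $ k) * (\<Prod>j\<in>UNIV - {k}. f j (z $ j))"
proof -
  have "(prodfn f has_derivative
      (\<lambda>h. \<Sum>i\<in>UNIV. dir_deriv (h $ i) (f i) (z $ i) * (\<Prod>j\<in>UNIV - {i}. f j (z $ j)))) (at z)"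
    unfolding prodfn_def by (intro has_derivative_prod component_has_derivative assms)
  from dir_deriv_eq[OF this, of "axis k c"]
  have "dir_deriv (axis k c) (prodfn f) z
      = (\<Sum>i\<in>UNIV. dir_deriv (axis k c $ i) (f i) (z $ i) * (\<Prod>j\<in>UNIV - {i}. f j (z $ j)))" .
  also have "\<dots> = (\<Sum>i\<in>{k}. dir_deriv (axis k c $ i) (f i) (z $ i) * (\<Prod>j\<in>UNIV - {i}. f j (z $ j)))"
    by (rule sum.mono_neutral_right) (auto simp: axis_def dir_deriv_zero_direction[OF assms])
  finally show ?thesis by simp
qed

lemma dir_deriv_decoupled:
  fixes \<phi>c :: "'n::finite \<Rightarrow> complex \<Rightarrow> real"
  assumes "\<And>j. smooth (\<phi>c j)"
  shows "dir_deriv (axis k c) (\<lambda>z. \<Sum>j\<in>UNIV. \<phi>c j (z $ j)) z = dir_deriv c (\<phi>c k) (z $ k)"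
proof -
  have "((\<lambda>z. \<Sum>j\<in>UNIV. \<phi>c j (z $ j)) has_derivative (\<lambda>h. \<Sum>i\<in>UNIV. dir_deriv (h $ i) (\<phi>c i) (z $ i))) (at z)"
    by (intro has_derivative_sum component_has_derivative assms)
  from dir_deriv_eq[OF this, of "axis k c"]
  have "dir_deriv (axis k c) (\<lambda>z. \<Sum>j\<in>UNIV. \<phi>c j (z $ j)) z
      = (\<Sum>i\<in>UNIV. dir_deriv (axis k c $ i) (\<phi>c i) (z $ i))" .
  also have "\<dots> = (\<Sum>i\<in>{k}. dir_deriv (axis k c $ i) (\<phi>c i) (z $ i))"
    by (rule sum.mono_neutral_right) (auto simp: axis_def dir_deriv_zero_direction[OF assms])
  finally show ?thesis by simp
qed

lemma smooth_decoupled: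
  fixes \<phi>c :: "'n::finite \<Rightarrow> complex \<Rightarrow> real"
  assumes "\<And>j. smooth (\<phi>c j)" shows "smooth (\<lambda>z :: complex ^ 'n. \<Sum>j\<in>UNIV. \<phi>c j (z $ j))"
  by (rule smooth_sum, rule smooth_compose[OF assms smooth_linear[OF bounded_linear_vec_nth]])

lemma dzbar_decoupled:
  fixes \<phi>c :: "'n::finite \<Rightarrow> complex \<Rightarrow> real"
  assumes \<phi>c: "\<And>j. smooth (\<phi>c j)" and \<phi>: "\<phi> = (\<lambda>z. \<Sum>j\<in>UNIV. \<phi>c j (z $ j))"
  shows "dzbar k (\<lambda>w. complex_of_real (\<phi> w)) z = dbar (\<lambda>w. complex_of_real (\<phi>c k w)) (z $ k)"
proof -
  have s: "smooth \<phi>" unfolding \<phi> by (rule smooth_decoupled[OF \<phi>c])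
  have d: "dir_deriv (axis k c) \<phi> z = dir_deriv c (\<phi>c k) (z $ k)" for c
    unfolding \<phi> by (rule dir_deriv_decoupled[OF \<phi>c])
  show ?thesis unfolding dzbar_def dbar_def dir_deriv_of_real[OF s] dir_deriv_of_real[OF \<phi>c] d ..
qed

lemma wdbar_prodfn:
  assumes \<phi>c: "\<And>j. smooth (\<phi>c j)" and \<phi>: "\<phi> = (\<lambda>z. \<Sum>j\<in>UNIV. \<phi>c j (z $ j))" and f: "\<And>j. smooth (f j)"
  shows "wdbar \<phi> k (prodfn f) = prodfn (f(k := annih (\<phi>c k) (f k)))"
  unfolding wdbar_def fun_eq_iff dzbar_decoupled[OF \<phi>c \<phi>] prodfn_fun_upd
  by (simp add: dzbar_def dir_deriv_prodfn[OF f] annih_def prodfn_split[of f _ k] dbar_def field_simps)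

lemma wdbar_adj_prodfn:
  assumes \<phi>c: "\<And>j. smooth (\<phi>c j)" and \<phi>: "\<phi> = (\<lambda>z. \<Sum>j\<in>UNIV. \<phi>c j (z $ j))" and f: "\<And>j. smooth (f j)"
  shows "wdbar_adj \<phi> k (prodfn f) = prodfn (f(k := creat (\<phi>c k) (f k)))"
  unfolding wdbar_adj_def fun_eq_iff dzbar_decoupled[OF \<phi>c \<phi>] prodfn_fun_upd
  by (simp add: dir_deriv_prodfn[OF f] creat_def prodfn_split[of f _ k] field_simps)

lemma test_annih:
  assumes \<psi>: "smooth \<psi>" and f: "f \<in> test_functions"
  shows "annih \<psi> f \<in> test_functions" "creat \<psi> f \<in> test_functions"
proof -
  obtain K where K: "compact K" "\<And>x. x \<notin> K \<Longrightarrow> f x = 0" "\<And>x v. x \<notin> K \<Longrightarrow> dir_deriv v f x = 0"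
    using test_functionsE[OF f] by metis
  have s: "smooth (annih \<psi> f)" "smooth (creat \<psi> f)"
    unfolding annih_def creat_def dbar_def divide_complex_def
    by (intro smooth_add smooth_mult smooth_const smooth_uminus smooth_diff smooth_cnj smooth_dir_deriv
        smooth_of_real \<psi> test_smooth[OF f])+
  show "annih \<psi> f \<in> test_functions" by (rule test_functionsI[OF s(1) K(1)]) (simp add: annih_def dbar_def K)
  show "creat \<psi> f \<in> test_functions" by (rule test_functionsI[OF s(2) K(1)]) (simp add: creat_def K)
qed

lemma L2_norm_prodfn_upd:
  assumes "\<And>j. f j \<in> L2_space" "\<And>j. L2_norm (f j) = 1" "g \<in> L2_space"
  shows "L2_norm (prodfn (f(k := g))) = L2_norm g"
proof -
  have "(L2_norm (prodfn (f(k := g))))\<^sup>2 = (\<Prod>j\<in>UNIV. (L2_norm ((f(k := g)) j))\<^sup>2)"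
    by (rule L2_norm_prodfn) (use assms in auto)
  also have "\<dots> = (L2_norm g)\<^sup>2"
    by (subst prod.remove[of _ k]) (auto simp: assms intro!: prod.neutral)
  finally show ?thesis using L2_norm_nonneg by (rule power2_eq_imp_eq) (rule L2_norm_nonneg)
qed

text \<open>If only the component \<open>k\<close> is present, then the coefficients of \<open>D\<^sub>2\<close> are, up to sign, the
  \<open>D\<^sub>j\<close> of this component for \<open>j \<noteq> k\<close>, each occurring once.\<close>

lemma D2_single_energy_le:
  fixes \<phi> :: "('n::{finite,linorder}) weight"
  assumes \<phi>: "smooth \<phi>" and F: "F \<in> test_functions" and wF: "\<And>j. wdbar \<phi> j F \<in> L2_space"
  shows "ip (D2 \<phi> (\<lambda>z. axis k (F z))) (D2 \<phi> (\<lambda>z. axis k (F z))) \<le> (\<Sum>j\<in>UNIV - {k}. (L2_norm (wdbar \<phi> j F))\<^sup>2)"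
proof -
  let ?u = "\<lambda>z. axis k (F z)"
  have w0: "wdbar \<phi> j (\<lambda>_. 0) z = 0" for j z
    by (simp add: wdbar_def dzbar_def dir_deriv_0)
  have comp: "(\<lambda>w. ?u w $ b) = (if b = k then F else (\<lambda>_. 0))" for b
    by (auto simp: axis_def)
  have pt: "D2 \<phi> ?u z \<bullet> D2 \<phi> ?u z \<le> (\<Sum>j\<in>UNIV - {k}. (norm (wdbar \<phi> j F z))\<^sup>2)" for z
  proof -
    let ?n = "\<lambda>j. (norm (wdbar \<phi> j F z))\<^sup>2"
    have e: "D2 \<phi> ?u z $ a $ b \<bullet> D2 \<phi> ?u z $ a $ b
      = (if b = k then (if a < k then ?n a else 0) else 0) + (if a = k then (if k < b then ?n b else 0) else 0)" for a b
      unfolding D2_def comp by (auto simp: w0 power2_norm_eq_inner)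
    have "D2 \<phi> ?u z \<bullet> D2 \<phi> ?u z = (\<Sum>a\<in>UNIV. if a < k then ?n a else 0) + (\<Sum>b\<in>UNIV. if k < b then ?n b else 0)"
      unfolding inner_vec_def e by (simp add: sum.distrib if_distrib[of "sum _"] sum.swap[of _ UNIV UNIV] cong: if_cong)
    also have "\<dots> = (\<Sum>j\<in>UNIV. (if j < k then ?n j else 0) + (if k < j then ?n j else 0))"
      by (simp add: sum.distrib)
    also have "\<dots> = (\<Sum>j\<in>UNIV - {k}. (if j < k then ?n j else 0) + (if k < j then ?n j else 0))"
      by (rule sum.mono_neutral_right) auto
    also have "\<dots> \<le> (\<Sum>j\<in>UNIV - {k}. ?n j)" by (intro sum_mono) auto
    finally show ?thesis .
  qed
  have i: "integrable lborel (\<lambda>z. (norm (wdbar \<phi> j F z))\<^sup>2)" for j using wF[of j] by (simp add: L2_space_def)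
  have "ip (D2 \<phi> ?u) (D2 \<phi> ?u) \<le> (LINT z|lborel. (\<Sum>j\<in>UNIV - {k}. (norm (wdbar \<phi> j F z))\<^sup>2))"
    unfolding ip_def by (rule integral_mono'[OF _ pt]) (auto intro: i sum_nonneg)
  also have "\<dots> = (\<Sum>j\<in>UNIV - {k}. (L2_norm (wdbar \<phi> j F))\<^sup>2)"
    using i by (simp add: L2_norm_def)
  finally show ?thesis .
qed

section \<open>Non-compactness of the resolvent\<close>

theorem theorem6p1:
  fixes \<phi> :: "('n::{finite,linorder}) weight"
    and \<phi>c :: "'n \<Rightarrow> complex \<Rightarrow> real"
  assumes "CARD('n) \<ge> 2"
    and "\<And>j. smooth (\<phi>c j)"
    and "\<And>z. \<phi> z = (\<Sum>j\<in>UNIV. \<phi>c j (z $ j))"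
    and "\<exists>j. \<exists>r::nat. r > 0 \<and> cond_H r (\<phi>c j)"
  shows "\<not> has_compact_resolvent (box01 \<phi>)"
proof -
  note \<phi>c = assms(2)
  have \<phi>: "\<phi> = (\<lambda>z. \<Sum>j\<in>UNIV. \<phi>c j (z $ j))" using assms(3) by auto
  have s\<phi>: "smooth \<phi>" unfolding \<phi> by (rule smooth_decoupled[OF \<phi>c])
  obtain j0 r where j0: "(r :: nat) > 0" "cond_H r (\<phi>c j0)" using assms(4) by blast
  obtain M w where w: "\<And>i :: nat. w i \<in> test_functions" "\<And>i. L2_norm (w i) = 1"
    "\<And>i j z. i \<noteq> j \<Longrightarrow> w i z = 0 \<or> w j z = 0"
    and wM: "\<And>i. L2_norm (annih (\<phi>c j0) (w i)) \<le> M \<or> L2_norm (creat (\<phi>c j0) (w i)) \<le> M"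
    using localized_modes_of_cond_H[OF \<phi>c j0] by metis
  have "\<exists>k. k \<noteq> j0"
  proof (rule ccontr)
    assume "\<not> ?thesis"
    then have "UNIV = {j0}" by auto
    then have "CARD('n) = card {j0}" by metis
    then show False using assms(1) by simp
  qed
  then obtain k0 where k0: "k0 \<noteq> j0" by blast
  \<comment> \<open>In component \<open>k0\<close> the energy involves \<open>annih\<close> of the localized factor, in component \<open>j0\<close>
    it involves \<open>creat\<close>.\<close>
  define k where "k i = (if L2_norm (annih (\<phi>c j0) (w i)) \<le> M then k0 else j0)" for i
  \<comment> \<open>The mode \<open>w 0\<close> serves as the fixed normalized bump in the other variables.\<close>
  define f where "f i j = (if j = j0 then w i else w 0)" for i and j :: 'n
  define u where "u i = (\<lambda>z. axis (k i) (prodfn (f i) z))" for i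
  define A where "A = \<bar>M\<bar> + (\<Sum>j\<in>UNIV. L2_norm (annih (\<phi>c j) (w 0)) + L2_norm (creat (\<phi>c j) (w 0)))"
  have tf: "f i j \<in> test_functions" "smooth (f i j)" "f i j \<in> L2_space" "L2_norm (f i j) = 1" for i j
    using w(1,2) test_smooth[OF w(1)] test_L2[OF w(1)] by (simp_all add: f_def)
  have F: "prodfn (f i) \<in> test_functions" for i by (rule test_prodfn[OF tf(1)])
  have "0 \<le> (\<Sum>j\<in>UNIV. L2_norm (annih (\<phi>c j) (w 0)) + L2_norm (creat (\<phi>c j) (w 0)))"
    by (intro sum_nonneg add_nonneg_nonneg L2_norm_nonneg)
  then have AM: "M \<le> A" unfolding A_def by linarith
  have A0: "L2_norm (annih (\<phi>c j) (w 0)) \<le> A" "L2_norm (creat (\<phi>c j) (w 0)) \<le> A" for j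
  proof -
    have "L2_norm (annih (\<phi>c j) (w 0)) + L2_norm (creat (\<phi>c j) (w 0))
      \<le> (\<Sum>j\<in>UNIV. L2_norm (annih (\<phi>c j) (w 0)) + L2_norm (creat (\<phi>c j) (w 0)))"
      by (rule member_le_sum) (auto intro!: add_nonneg_nonneg L2_norm_nonneg)
    then show "L2_norm (annih (\<phi>c j) (w 0)) \<le> A" "L2_norm (creat (\<phi>c j) (w 0)) \<le> A"
      using L2_norm_nonneg[of "annih (\<phi>c j) (w 0)"] L2_norm_nonneg[of "creat (\<phi>c j) (w 0)"]
      unfolding A_def by linarith+
  qed
  have wd: "wdbar \<phi> j (prodfn (f i)) = prodfn ((f i)(j := annih (\<phi>c j) (f i j)))" for i j
    by (rule wdbar_prodfn[OF \<phi>c \<phi> tf(2)])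
  have wd_L2: "wdbar \<phi> j (prodfn (f i)) \<in> L2_space" for i j
    unfolding wd by (intro test_L2 test_prodfn) (auto intro: tf test_annih \<phi>c)
  have b1: "L2_norm (wdbar \<phi> j (prodfn (f i))) \<le> A" if "j \<noteq> k i" for i j
  proof -
    have "L2_norm (annih (\<phi>c j) (f i j)) \<le> A"
    proof (cases "j = j0")
      case True
      then have "L2_norm (annih (\<phi>c j0) (w i)) \<le> M" using that by (auto simp: k_def split: if_splits)
      then show ?thesis using True AM by (simp add: f_def)
    next
      case False
      then show ?thesis using A0 by (simp add: f_def)
    qed
    moreover have "L2_norm (wdbar \<phi> j (prodfn (f i))) = L2_norm (annih (\<phi>c j) (f i j))"
      unfolding wd by (intro L2_norm_prodfn_upd tf test_L2 test_annih \<phi>c)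
    ultimately show ?thesis by simp
  qed
  have b2: "L2_norm (wdbar_adj \<phi> (k i) (prodfn (f i))) \<le> A" for i
  proof -
    have "L2_norm (creat (\<phi>c (k i)) (f i (k i))) \<le> A"
      using wM[of i] AM A0(2)[of k0] k0 by (auto simp: k_def f_def)
    moreover have "L2_norm (wdbar_adj \<phi> (k i) (prodfn (f i))) = L2_norm (creat (\<phi>c (k i)) (f i (k i)))"
      unfolding wdbar_adj_prodfn[OF \<phi>c \<phi> tf(2)] by (intro L2_norm_prodfn_upd tf test_L2 test_annih \<phi>c)
    ultimately show ?thesis by simp
  qed
  define E where "E = A\<^sup>2 + real CARD('n) * A\<^sup>2"
  have energy: "ip (wdbar_adj \<phi> (k i) (prodfn (f i))) (wdbar_adj \<phi> (k i) (prodfn (f i)))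
      + ip (D2 \<phi> (u i)) (D2 \<phi> (u i)) \<le> E" for i
  proof -
    have 1: "ip (wdbar_adj \<phi> (k i) (prodfn (f i))) (wdbar_adj \<phi> (k i) (prodfn (f i))) \<le> A\<^sup>2"
      unfolding L2_norm_power2[symmetric] by (intro power_mono b2 L2_norm_nonneg)
    have "ip (D2 \<phi> (u i)) (D2 \<phi> (u i)) \<le> (\<Sum>j\<in>UNIV - {k i}. (L2_norm (wdbar \<phi> j (prodfn (f i))))\<^sup>2)"
      unfolding u_def by (rule D2_single_energy_le[OF s\<phi> F wd_L2])
    also have "\<dots> \<le> (\<Sum>j\<in>UNIV - {k i}. A\<^sup>2)"
      by (intro sum_mono power_mono b1 L2_norm_nonneg) auto
    also have "\<dots> \<le> (\<Sum>j\<in>(UNIV :: 'n set). A\<^sup>2)" by (intro sum_mono2) auto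
    also have "\<dots> = real CARD('n) * A\<^sup>2" by simp
    finally show ?thesis using 1 unfolding E_def by linarith
  qed
  have ad: "(u i, wdbar_adj \<phi> (k i) (prodfn (f i))) \<in> D1_adjoint \<phi>" for i
    unfolding u_def by (rule D1_adjoint_single[OF s\<phi> F])
  show ?thesis
  proof (rule noncompact_resolvent_criterion)
    show "v \<in> L2_space \<and> g \<in> L2_space" if "(v, g) \<in> box01 \<phi>" for v g
      using that by (simp add: box01_def L2_graph_closure_def)
    show "u i \<in> L2_space" for i using ad[of i] by (auto simp: D1_adjoint_def intro: test_L2)
    show "L2_norm (u i) = 1" for i
    proof -
      have "L2_norm (u i) = L2_norm (prodfn (f i))" by (simp add: L2_norm_def u_def power2_norm_eq_inner inner_axis_axis)
      also have "\<dots> = 1"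
        using L2_norm_prodfn_upd[of "f i" "f i j0" j0] tf by simp
      finally show ?thesis .
    qed
    show "ip (u i) (u l) = 0" if "i \<noteq> l" for i l
    proof -
      have "u i z \<bullet> u l z = 0" for z
      proof -
        have "prodfn (f i) z = 0 \<or> prodfn (f l) z = 0"
          using w(3)[OF that, of "z $ j0"] prodfn_split[of "f i" z j0] prodfn_split[of "f l" z j0]
          by (auto simp: f_def)
        moreover have "axis n (0 :: complex) = 0" for n :: 'n by (simp add: axis_def vec_eq_iff)
        ultimately show ?thesis by (auto simp: u_def inner_axis_axis)
      qed
      then show ?thesis by (simp add: ip_def)
    qed
    show "0 \<le> E" by (simp add: E_def)
    show "(ip (\<lambda>x. g x - h x) (u i))\<^sup>2 \<le> E * ip (\<lambda>x. g x - h x) (\<lambda>x. v x - w x)"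
      if "(v, g) \<in> box01 \<phi>" "(w, h) \<in> box01 \<phi>" for v g w h i
      by (rule box01_cauchy_schwarz[OF s\<phi> that ad energy])
  qed
qed

end
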